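(* Let $p$ be an odd prime and let $\ell, k$ be positive integers with $1<\ell<k$. Let $K=\overline{\mathbb{F}_p}$ and let $c\in K$ be nonzero. Let $B_k$ be the curve $y^p+cy=x^{p^k+1}$ and let $B_\ell$ be the curve $y^p+cy=x^{p^\ell+1}$ (nonsingular projective models over $K$). Let $P_k$ and $P_\ell$ be the points at infinity of $B_k$ and $B_\ell$, respectively. (a) If $p^\ell+1$ divides $p^k+1$, then there exists a non-constant morphism $\rho: B_k\longrightarrow B_\ell$ such that $\rho(P_k)=P_\ell$, $\rho$ is totally ramified at $P_k$, and $\deg(\rho)=\frac{p^k+1}{p^\ell+1}$. (b) Conversely, if there exists a non-constant morphism $\phi: B_k\longrightarrow B_\ell$ such that $\phi(P_k)=P_\ell$, $\phi$ is totally ramified at $P_k$, and $\deg(\phi)$ is relatively prime to $p$, then $p^\ell+1$ divides $p^k+1$ and $\deg(\phi)=\frac{p^k+1}{p^\ell+1}$.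
   Context: For $k\ge 1$ and nonzero $c\in K$, $B_k$ denotes the nonsingular projective model (normalization) of the plane curve with affine equation $y^p+cy=x^{p^k+1}$ over $K$; its function field is $K(x,y)$ with $y^p+cy=x^{p^k+1}$, and its genus is $p^k(p-1)/2$. The plane model has a unique point at infinity, with a single branch centered at it, so $B_k$ has a unique point $P_k$ at infinity. All morphisms are defined over $K$. A morphism $\phi$ is totally ramified at a point $P$ if its ramification index at $P$ equals $\deg(\phi)$. *)

theory Defs
  imports
    "HOL-Algebra.Algebraic_Closure_Type"
    "HOL-Algebra.Generated_Fields"
    "HOL-Library.FuncSet"
    "Berlekamp_Zassenhaus.Finite_Field"
begin

section \<open>Nonsingular projective curves\<close>

text \<open>
  Over an algebraically closed field, the nonsingular projective curve with function field
  \<open>F/K\<close> is taken in its intrinsic form (the abstract nonsingular curve of Hartshorne I.6):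
  its points are the valuation rings of \<open>F/K\<close>, the proper nonempty open sets are the cofinite
  ones, and the regular functions on \<open>U\<close> are the \<open>K\<close>-valued functions induced by the elements of
  \<open>F\<close> that lie in every local ring \<open>P \<in> U\<close>.  Here \<open>K \<subseteq> F\<close> are subfields of an ambient field
  type, and a point is identified with its local ring.
\<close>

definition curve_points :: "'f::field set \<Rightarrow> 'f set \<Rightarrow> 'f set set" where
  "curve_points K F =
     {P. subring P ring_of_type_algebra \<and> K \<subset> P \<and> P \<subset> F \<and> (\<forall>f\<in>F. f \<in> P \<or> inverse f \<in> P)}"

definition max_ideal :: "'f::field set \<Rightarrow> 'f set" where
  "max_ideal P = {f \<in> P. f = 0 \<or> inverse f \<notin> P}"

text \<open>The residue field of \<open>P\<close> is \<open>K\<close>, as \<open>K\<close> is algebraically closed.\<close>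

definition eval_at :: "'f::field set \<Rightarrow> 'f set \<Rightarrow> 'f \<Rightarrow> 'f" where
  "eval_at K P f = (THE a. a \<in> K \<and> f - a \<in> max_ideal P)"

definition curve_open :: "'f::field set \<Rightarrow> 'f set \<Rightarrow> 'f set set \<Rightarrow> bool" where
  "curve_open K F U \<longleftrightarrow>
     U \<subseteq> curve_points K F \<and> (U = {} \<or> finite (curve_points K F - U))"

definition regular_on :: "'f::field set \<Rightarrow> 'f set \<Rightarrow> 'f set set \<Rightarrow> ('f set \<Rightarrow> 'f) \<Rightarrow> bool" where
  "regular_on K F U h \<longleftrightarrow> (\<exists>f\<in>F. \<forall>P\<in>U. f \<in> P \<and> h P = eval_at K P f)"

definition curve_morphism ::
  "'f::field set \<Rightarrow> 'f set \<Rightarrow> 'f set \<Rightarrow> ('f set \<Rightarrow> 'f set) \<Rightarrow> bool" where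
  "curve_morphism K F G \<phi> \<longleftrightarrow>
     \<phi> \<in> curve_points K F \<rightarrow> curve_points K G \<and>
     (\<forall>V. curve_open K G V \<longrightarrow>
        curve_open K F (\<phi> -` V \<inter> curve_points K F) \<and>
        (\<forall>h. regular_on K G V h \<longrightarrow>
           regular_on K F (\<phi> -` V \<inter> curve_points K F) (h \<circ> \<phi>)))"

definition nonconstant :: "'f::field set \<Rightarrow> 'f set \<Rightarrow> ('f set \<Rightarrow> 'f set) \<Rightarrow> bool" where
  "nonconstant K F \<phi> \<longleftrightarrow> \<not> (\<exists>Q. \<forall>P\<in>curve_points K F. \<phi> P = Q)"

text \<open>
  Pullback of a rational function along a non-constant morphism: the rational function on the
  source whose values are those of \<open>g \<circ> \<phi>\<close> wherever \<open>g\<close> is regular at the image point.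
\<close>

definition pullback ::
  "'f::field set \<Rightarrow> 'f set \<Rightarrow> ('f set \<Rightarrow> 'f set) \<Rightarrow> 'f \<Rightarrow> 'f" where
  "pullback K F \<phi> g =
     (THE f. f \<in> F \<and>
        (\<forall>P\<in>curve_points K F. g \<in> \<phi> P \<longrightarrow> f \<in> P \<and> eval_at K P f = eval_at K (\<phi> P) g))"

definition morphism_degree ::
  "'f::field set \<Rightarrow> 'f set \<Rightarrow> 'f set \<Rightarrow> ('f set \<Rightarrow> 'f set) \<Rightarrow> nat" where
  "morphism_degree K F G \<phi> =
     (ring.dim ring_of_type_algebra over (pullback K F \<phi> ` G)) F"

definition uniformizer :: "'f::field set \<Rightarrow> 'f \<Rightarrow> bool" where
  "uniformizer P t \<longleftrightarrow> t \<in> P \<and> max_ideal P = (*) t ` P"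

text \<open>The order of vanishing of a nonzero function \<open>f\<close> at \<open>P\<close> (meaningless for \<open>f = 0\<close>).\<close>

definition ord_at :: "'f::field set \<Rightarrow> 'f \<Rightarrow> int" where
  "ord_at P f = (THE n. \<exists>t u. uniformizer P t \<and> u \<in> P - max_ideal P \<and> f = u * t powi n)"

definition ramification_index ::
  "'f::field set \<Rightarrow> 'f set \<Rightarrow> ('f set \<Rightarrow> 'f set) \<Rightarrow> 'f set \<Rightarrow> nat" where
  "ramification_index K F \<phi> P =
     (THE e. \<forall>t. uniformizer (\<phi> P) t \<longrightarrow> ord_at P (pullback K F \<phi> t) = int e)"

definition totally_ramified_at ::
  "'f::field set \<Rightarrow> 'f set \<Rightarrow> 'f set \<Rightarrow> ('f set \<Rightarrow> 'f set) \<Rightarrow> 'f set \<Rightarrow> bool" where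
  "totally_ramified_at K F G \<phi> P \<longleftrightarrow>
     ramification_index K F \<phi> P = morphism_degree K F G \<phi>"


section \<open>The curves \<open>y^p + c y = x^(p^k + 1)\<close>\<close>

text \<open>
  The function fields are realised inside an algebraic closure of the rational function field
  \<open>K(x)\<close>.
\<close>

type_synonym 'k ambient = "'k poly fract alg_closure"

definition const_fun :: "'k::field \<Rightarrow> 'k ambient" where
  "const_fun a = to_ac (Fraction_Field.Fract [:a:] 1)"

definition x_fun :: "'k::field ambient" where
  "x_fun = to_ac (Fraction_Field.Fract [:0, 1:] 1)"

text \<open>
  The choice of the root \<open>y\<close> is immaterial: for \<open>p\<close> the characteristic, two roots differ by a
  root of \<open>Y^p + c Y\<close>, which lies in \<open>K\<close>.
\<close>

definition y_fun :: "nat \<Rightarrow> 'k::field \<Rightarrow> nat \<Rightarrow> 'k ambient" where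
  "y_fun p c k = (SOME y. y ^ p + const_fun c * y = x_fun ^ (p ^ k + 1))"

lemma y_fun_equation:
  fixes c :: "'k::field"
  assumes "p > 1"
  shows "y_fun p c k ^ p + const_fun c * y_fun p c k = x_fun ^ (p ^ k + 1)"
proof -
  define q :: "'k ambient poly" where
    "q = monom 1 p + [:- (x_fun ^ (p ^ k + 1)), const_fun c:]"
  have "degree [:- (x_fun ^ (p ^ k + 1)), const_fun c:] < degree (monom (1 :: 'k ambient) p)"
    using assms by (simp add: degree_monom_eq)
  then have "degree q = p"
    unfolding q_def by (subst degree_add_eq_left) (simp_all add: degree_monom_eq)
  then obtain y where "poly q y = 0"
    using alg_closed_imp_poly_has_root[of q] assms by auto
  then have "y ^ p + const_fun c * y = x_fun ^ (p ^ k + 1)"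
    by (simp add: q_def poly_monom algebra_simps)
  then show ?thesis
    unfolding y_fun_def by (rule someI)
qed

definition constants :: "'k::field ambient set" where
  "constants = range const_fun"

definition B_field :: "nat \<Rightarrow> 'k::field \<Rightarrow> nat \<Rightarrow> 'k ambient set" where
  "B_field p c k = generate_field ring_of_type_algebra (constants \<union> {x_fun, y_fun p c k})"

text \<open>
  The point lying over the point at infinity of the plane model, that is, the one at which the
  affine coordinates \<open>x\<close>, \<open>y\<close> are not both regular.
\<close>

definition B_infinity :: "nat \<Rightarrow> 'k::field \<Rightarrow> nat \<Rightarrow> 'k ambient set" where
  "B_infinity p c k =
     (THE P. P \<in> curve_points constants (B_field p c k) \<and> \<not> {x_fun, y_fun p c k} \<subseteq> P)"

abbreviation B_morphism ::
  "nat \<Rightarrow> 'k::field \<Rightarrow> nat \<Rightarrow> nat \<Rightarrow> ('k ambient set \<Rightarrow> 'k ambient set) \<Rightarrow> bool" where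
  "B_morphism p c k l \<phi> \<equiv> curve_morphism constants (B_field p c k) (B_field p c l) \<phi>"

abbreviation B_degree ::
  "nat \<Rightarrow> 'k::field \<Rightarrow> nat \<Rightarrow> nat \<Rightarrow> ('k ambient set \<Rightarrow> 'k ambient set) \<Rightarrow> nat" where
  "B_degree p c k l \<phi> \<equiv> morphism_degree constants (B_field p c k) (B_field p c l) \<phi>"

end

theory Submission
  imports Defs
begin

text \<open>
  A point is a valuation ring, and a non-constant morphism is the same as an embedding of function
  fields over the constants.  At infinity \<open>x\<close> and \<open>y\<close> have poles of the coprime orders \<open>p\<close> and
  \<open>p\<^sup>k + 1\<close>, so that the order of a polynomial \<open>\<Sum> g\<^sub>j(x) y\<^sup>j\<close> with \<open>j < p\<close> is determined by its
  dominant monomial; at a point \<open>(a, b)\<close> the function \<open>x - a\<close> is a uniformizer.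

  (a) If \<open>p\<^sup>k + 1 = m (p\<^sup>l + 1)\<close>, take \<open>(x, y) \<mapsto> (x\<^sup>m, y)\<close>; the ramification index is read off the pole
  orders of \<open>x\<close>.

  (b) Total ramification makes the pullbacks \<open>g\<close> of \<open>x\<close> and \<open>f\<close> of \<open>y\<close> regular away from infinity, hence
  polynomials in \<open>x\<close> and \<open>y\<close>, with poles of order \<open>d p\<close> and \<open>d (p\<^sup>l + 1)\<close>.  Differentiating
  \<open>f\<^sup>p + c f = g^(p\<^sup>l + 1)\<close> gives \<open>c f' = g^(p\<^sup>l) g'\<close>, which bounds \<open>d\<close> so sharply that \<open>g\<close> is a polynomial
  in \<open>x\<close> and \<open>f = B(x) + b(x) y\<close>.  Comparing the coefficients of \<open>y\<close> in the equation yields \<open>b\<^sup>p = b\<close>,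
  so \<open>b\<close> is constant and \<open>f\<close> has the same pole order \<open>p\<^sup>k + 1\<close> as \<open>y\<close>.
\<close>

hide_const (open) Polynomials.degree Polynomials.lead_coeff

section \<open>Subrings and subfields of a field type\<close>

text \<open>Two inequalities result: p d < N leaves no room for y in g, and d (p^l + 1) < 2 N leaves
  none for y^2 in f; l > 1 makes the estimates close. Coprimality of d and p keeps the pole order of
  f prime to p, so that the dominant monomial of f contains y and the derivative of f does not
  vanish.

  That infinity has only one preimage is a weak form of the inequality between the degree and the
  sum of ramification indices: a second preimage would supply one more linearly independent
  function.

  As points are abstract valuation rings, they have to be found first: existence is by Zorn, and
  uniqueness holds because membership of g(x, y) / h(x) in the ring is decided by the polynomials
  and the centre alone.\<close>

lemma ring_type_algebra_simps [simp]:
  "carrier (ring_of_type_algebra :: 'f::field ring) = UNIV"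
  "monoid.mult (ring_of_type_algebra :: 'f::field ring) = (*)"
  "monoid.one (ring_of_type_algebra :: 'f::field ring) = 1"
  "ring.zero (ring_of_type_algebra :: 'f::field ring) = 0"
  "ring.add (ring_of_type_algebra :: 'f::field ring) = (+)"
  by (auto simp: ring_of_type_algebra_def)

lemma a_inv_type_algebra [simp]: "a_inv (ring_of_type_algebra :: 'f::field ring) x = - x"
proof -
  interpret ring "ring_of_type_algebra :: 'f ring" by (rule ring_from_type_algebra)
  show ?thesis using minus_equality[of "- x" x] by simp
qed

lemma m_inv_type_algebra [simp]:
  assumes "x \<noteq> 0"
  shows "m_inv (ring_of_type_algebra :: 'f::field ring) x = inverse x"
proof -
  interpret cring "ring_of_type_algebra :: 'f ring" by (rule cring_from_type_algebra)
  show ?thesis using comm_inv_char[of x "inverse x"] assms by simp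
qed

lemma subring_type_algebra_iff:
  "subring P (ring_of_type_algebra :: 'f::field ring) \<longleftrightarrow>
     1 \<in> P \<and> (\<forall>a\<in>P. - a \<in> P) \<and> (\<forall>a\<in>P. \<forall>b\<in>P. a + b \<in> P) \<and> (\<forall>a\<in>P. \<forall>b\<in>P. a * b \<in> P)"
proof -
  interpret ring "ring_of_type_algebra :: 'f ring" by (rule ring_from_type_algebra)
  show ?thesis
    using subringI[of P] subringE[of P "ring_of_type_algebra :: 'f ring"] by auto
qed

lemma subfield_type_algebra_iff:
  "subfield P (ring_of_type_algebra :: 'f::field ring) \<longleftrightarrow>
     subring P (ring_of_type_algebra :: 'f ring) \<and> (\<forall>a\<in>P. inverse a \<in> P)"
proof -
  interpret field "ring_of_type_algebra :: 'f ring" by (rule field_from_type_algebra)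
  show ?thesis
  proof
    assume *: "subfield P (ring_of_type_algebra :: 'f ring)"
    have "inverse a \<in> P" if "a \<in> P" for a
      using subfield_m_inv(1)[OF *, of a] that by (cases "a = 0") auto
    then show "subring P (ring_of_type_algebra :: 'f ring) \<and> (\<forall>a\<in>P. inverse a \<in> P)"
      using subfieldE(1)[OF *] by blast
  next
    assume *: "subring P (ring_of_type_algebra :: 'f ring) \<and> (\<forall>a\<in>P. inverse a \<in> P)"
    show "subfield P (ring_of_type_algebra :: 'f ring)"
      by (rule subfieldI') (use * in auto)
  qed
qed

locale field_subset =
  fixes F :: "'f::field set"
  assumes subfield: "subfield F ring_of_type_algebra"
begin

lemma subring: "subring F ring_of_type_algebra"
  using subfield by (simp add: subfield_type_algebra_iff)

lemma closed_basic [simp]: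
  "1 \<in> F" "0 \<in> F" "a \<in> F \<Longrightarrow> - a \<in> F" "a \<in> F \<Longrightarrow> b \<in> F \<Longrightarrow> a + b \<in> F"
  "a \<in> F \<Longrightarrow> b \<in> F \<Longrightarrow> a * b \<in> F" "a \<in> F \<Longrightarrow> inverse a \<in> F"
  using subfield subringE(2)[OF subring]
  by (auto simp: subfield_type_algebra_iff subring_type_algebra_iff)

lemma closed_derived [simp]:
  "a \<in> F \<Longrightarrow> b \<in> F \<Longrightarrow> a - b \<in> F" "a \<in> F \<Longrightarrow> b \<in> F \<Longrightarrow> a / b \<in> F"
  using closed_basic(3,4)[of b] closed_basic(4)[of a "- b"]
  by (auto simp: divide_inverse)

lemma closed_power [simp]: "a \<in> F \<Longrightarrow> a ^ n \<in> F"
  by (induction n) auto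

lemma closed_powi [simp]: "a \<in> F \<Longrightarrow> a powi n \<in> F"
  by (auto simp: power_int_def)

lemma closed_sum: "(\<And>i. i \<in> I \<Longrightarrow> g i \<in> F) \<Longrightarrow> sum g I \<in> F"
  by (induction I rule: infinite_finite_induct) auto

end

section \<open>Points and their residue and order functions\<close>

locale place = K: field_subset K + F: field_subset F for K F :: "'f::field set" +
  fixes P :: "'f set"
  assumes point: "P \<in> curve_points K F"
begin

lemma K_sub: "K \<subset> P" and P_sub: "P \<subset> F" and val: "f \<in> F \<Longrightarrow> f \<in> P \<or> inverse f \<in> P"
  and subring_P: "subring P ring_of_type_algebra"
  using point by (auto simp: curve_points_def)

lemma P_basic [simp]:
  "1 \<in> P" "0 \<in> P" "a \<in> P \<Longrightarrow> - a \<in> P" "a \<in> P \<Longrightarrow> b \<in> P \<Longrightarrow> a + b \<in> P"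
  "a \<in> P \<Longrightarrow> b \<in> P \<Longrightarrow> a * b \<in> P"
  using subring_P subringE(2)[OF subring_P]
  by (auto simp: subring_type_algebra_iff)

lemma P_diff [simp]: "a \<in> P \<Longrightarrow> b \<in> P \<Longrightarrow> a - b \<in> P"
  using P_basic(4)[of a "- b"] by auto

lemma P_power [simp]: "a \<in> P \<Longrightarrow> a ^ n \<in> P"
  by (induction n) auto

lemma P_sum: "(\<And>i. i \<in> I \<Longrightarrow> g i \<in> P) \<Longrightarrow> sum g I \<in> P"
  by (induction I rule: infinite_finite_induct) auto

lemma in_P_if_const [simp]: "a \<in> K \<Longrightarrow> a \<in> P" using K_sub by auto

lemma in_F [simp]: "a \<in> P \<Longrightarrow> a \<in> F" using P_sub by auto

abbreviation M where "M \<equiv> max_ideal P"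

lemma M_sub [simp]: "a \<in> M \<Longrightarrow> a \<in> P" by (auto simp: max_ideal_def)

lemma zero_in_M [simp]: "0 \<in> M" by (auto simp: max_ideal_def simp del: M_sub)

lemma one_notin_M [simp]: "1 \<notin> M" by (auto simp: max_ideal_def simp del: M_sub)

lemma unit_iff: "u \<in> P - M \<longleftrightarrow> u \<in> P \<and> u \<noteq> 0 \<and> inverse u \<in> P"
  by (auto simp: max_ideal_def simp del: M_sub)

lemma unitD: "u \<in> P \<Longrightarrow> u \<notin> M \<Longrightarrow> u \<noteq> 0" "u \<in> P \<Longrightarrow> u \<notin> M \<Longrightarrow> inverse u \<in> P"
  using unit_iff[of u] by blast+

lemma inverse_in_M: "f \<in> F \<Longrightarrow> f \<notin> P \<Longrightarrow> inverse f \<in> M"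
  using val by (auto simp: max_ideal_def simp del: M_sub)

lemma const_unit: "a \<in> K \<Longrightarrow> a \<noteq> 0 \<Longrightarrow> a \<in> P - M"
  unfolding unit_iff by simp

lemma const_in_M_iff: "a \<in> K \<Longrightarrow> a \<in> M \<longleftrightarrow> a = 0"
  using const_unit by auto

lemma M_mult [simp]:
  assumes "a \<in> P" "b \<in> M" shows "a * b \<in> M"
proof (rule ccontr)
  assume "a * b \<notin> M"
  moreover have "a * b \<in> P" using assms by auto
  ultimately have "a * b \<noteq> 0" "inverse (a * b) \<in> P" by (auto simp: max_ideal_def simp del: M_sub)
  then have "a * inverse (a * b) \<in> P" "b \<noteq> 0" using assms by auto
  moreover have "a * inverse (a * b) = inverse b" using \<open>a * b \<noteq> 0\<close> by (simp add: field_simps)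
  ultimately have "inverse b \<in> P" by argo
  then have "b \<in> P - M" using assms(2) \<open>b \<noteq> 0\<close> unfolding unit_iff by simp
  then show False using assms(2) by blast
qed

lemma M_mult' [simp]: "a \<in> M \<Longrightarrow> b \<in> P \<Longrightarrow> a * b \<in> M"
  using M_mult[of b a] by (simp add: mult.commute)

lemma M_uminus [simp]: "a \<in> M \<Longrightarrow> - a \<in> M"
  using M_mult[of "-1" a] by auto

text \<open>One of a / b and b / a is regular at P, so the sum is a regular multiple of one
  summand.\<close>

lemma M_add [simp]:
  assumes "a \<in> M" "b \<in> M" shows "a + b \<in> M"
proof -
  have *: "a + b \<in> M" if "a \<in> M" "b \<in> M" "a / b \<in> P" "b \<noteq> 0" for a b
  proof -
    have "a + b = b * (a / b + 1)" using that by (simp add: field_simps)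
    then show ?thesis using M_mult'[OF \<open>b \<in> M\<close>, of "a / b + 1"] that by auto
  qed
  show ?thesis
  proof (cases "a = 0 \<or> b = 0")
    case False
    then have "a / b \<in> P \<or> b / a \<in> P"
      using val[of "a / b"] assms M_sub in_F by (simp add: F.closed_derived(2))
    then show ?thesis using *[of a b] *[of b a] False assms by (auto simp: add.commute)
  qed (use assms in auto)
qed

lemma M_diff [simp]: "a \<in> M \<Longrightarrow> b \<in> M \<Longrightarrow> a - b \<in> M"
  using M_add[of a "- b"] M_uminus[of b] by simp

lemma M_sum: "(\<And>i. i \<in> I \<Longrightarrow> g i \<in> M) \<Longrightarrow> sum g I \<in> M"
  by (induction I rule: infinite_finite_induct) auto

lemma M_power: "a \<in> M \<Longrightarrow> n > 0 \<Longrightarrow> a ^ n \<in> M"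
  by (cases n) (simp_all add: M_mult')

lemma M_prime: "a * b \<in> M \<Longrightarrow> a \<in> P \<Longrightarrow> b \<in> P \<Longrightarrow> a \<in> M \<or> b \<in> M"
proof (rule ccontr)
  assume *: "a * b \<in> M" "a \<in> P" "b \<in> P" "\<not> (a \<in> M \<or> b \<in> M)"
  then have "a \<noteq> 0" "b \<noteq> 0" "inverse a * inverse b \<in> P" "a * b \<in> P" by (auto simp: unitD)
  then have "a * b \<in> P - M" unfolding unit_iff by simp
  then show False using * by blast
qed

lemma unit_mult: "u \<in> P - M \<Longrightarrow> v \<in> P - M \<Longrightarrow> u * v \<in> P - M"
  by (metis DiffD1 DiffD2 DiffI M_prime P_basic(5))

lemma unit_inverse: "u \<in> P - M \<Longrightarrow> inverse u \<in> P - M"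
  unfolding unit_iff by simp

lemma unit_power: "u \<in> P - M \<Longrightarrow> u ^ n \<in> P - M"
  by (induction n) (use unit_mult in auto)

lemma M_power_iff: "a \<in> P \<Longrightarrow> n > 0 \<Longrightarrow> a ^ n \<in> M \<longleftrightarrow> a \<in> M"
  by (metis DiffD2 DiffI M_power unit_power)

lemma unit_powi: "u \<in> P - M \<Longrightarrow> u powi n \<in> P - M"
  using unit_power[of u] unit_power[OF unit_inverse, of u] by (simp add: power_int_def)

lemma unit_add: "u \<in> P - M \<Longrightarrow> e \<in> M \<Longrightarrow> u + e \<in> P - M"
  using M_diff[of "u + e" e] by auto

lemma residue_unique: "a \<in> K \<Longrightarrow> b \<in> K \<Longrightarrow> f - a \<in> M \<Longrightarrow> f - b \<in> M \<Longrightarrow> a = b"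
  using M_diff[of "f - a" "f - b"] const_in_M_iff[of "b - a"] by auto

text \<open>Lets expansions be computed for numerator and denominator separately: the difference is
  ((u - a) b - a (v - b)) / (v b), with a unit below.\<close>

lemma quotient_residue:
  assumes "a \<in> K" "b \<in> K" "b \<noteq> 0" "u - a \<in> M" "v - b \<in> M"
  shows "u / v - a / b \<in> M"
proof -
  have "v \<in> P - M" using unit_add[OF const_unit[of b] assms(5)] assms by simp
  then have v: "v \<noteq> 0" "inverse v \<in> P" "inverse b \<in> P" using assms by (auto simp: unitD)
  have "u / v - a / b = ((u - a) * b - a * (v - b)) * (inverse v * inverse b)"
    using v assms(3) by (simp add: field_simps)
  also have "\<dots> \<in> M"
  proof (rule M_mult'[OF M_diff])
    show "(u - a) * b \<in> M" by (rule M_mult') (use assms in auto)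
    show "a * (v - b) \<in> M" by (rule M_mult) (use assms in auto)
    show "inverse v * inverse b \<in> P" by (rule P_basic(5)[OF v(2,3)])
  qed
  finally show ?thesis .
qed

lemma eval_atI: "a \<in> K \<Longrightarrow> f - a \<in> M \<Longrightarrow> eval_at K P f = a"
  unfolding eval_at_def using residue_unique by (intro the_equality) auto

lemma eval_const [simp]: "a \<in> K \<Longrightarrow> eval_at K P a = a"
  by (rule eval_atI) auto

end

text \<open>The axiom \<open>expansion\<close> says two things at once: every function is a power of
  t times a unit, and the leading coefficient lies in K, so that K is the residue field. Affine
  points and infinity both deliver exactly this form.\<close>

locale local_parameter = place +
  fixes t :: 'a
  assumes t_M: "t \<in> max_ideal P" and t_nz: "t \<noteq> 0"
    and expansion: "f \<in> F \<Longrightarrow> f \<noteq> 0 \<Longrightarrow>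
      \<exists>n::int. \<exists>a\<in>K. \<exists>e\<in>max_ideal P. a \<noteq> 0 \<and> f = t powi n * (a + e)"
begin

lemma t_P [simp]: "t \<in> P" and t_F [simp]: "t \<in> F" using t_M by auto

lemma unit_expansion:
  assumes "f \<in> F" "f \<noteq> 0"
  obtains n u where "u \<in> P - M" "f = u * t powi n"
  using expansion[OF assms] unit_add[OF const_unit] by (metis mult.commute)

lemma t_powi_M: "n > 0 \<Longrightarrow> t powi n \<in> M"
  using M_power[OF t_M, of "nat n"] by (simp add: power_int_def)

lemma t_powi_notin:
  assumes "n < 0" shows "t powi n \<notin> P"
proof
  assume "t powi n \<in> P"
  then have "t powi n * t powi (- n) \<in> M" using t_powi_M[of "- n"] assms by auto
  then show False using t_nz by (simp flip: power_int_add)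
qed

lemma unit_powi_mem:
  assumes "u \<in> P - M"
  shows "u * t powi n \<in> P \<longleftrightarrow> n \<ge> 0" "u * t powi n \<in> M \<longleftrightarrow> n > 0"
proof -
  have u: "u \<noteq> 0" "inverse u \<in> P" "u \<in> P" using assms by (auto simp: unitD)
  have 1: "u * t powi n \<in> P" if "n \<ge> 0"
    using that u by (auto simp: power_int_def)
  have 2: "u * t powi n \<in> M" if "n > 0"
    using that t_powi_M u by auto
  have 3: "u * t powi n \<notin> P" if "n < 0"
  proof
    assume "u * t powi n \<in> P"
    then have "inverse u * (u * t powi n) \<in> P" using P_basic(5) u by blast
    then show False using t_powi_notin[OF that] u by (simp add: field_simps)
  qed
  have 4: "u * t powi n \<notin> M" if "n = 0" using that assms by simp
  show "u * t powi n \<in> P \<longleftrightarrow> n \<ge> 0" using 1 3 by fastforce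
  show "u * t powi n \<in> M \<longleftrightarrow> n > 0" using 2 3 4 M_sub by (metis linorder_neqE)
qed

lemma powi_unique:
  assumes "u \<in> P - M" "v \<in> P - M" "u * t powi n = v * t powi m"
  shows "n = m"
proof -
  have u: "u \<noteq> 0" "v \<noteq> 0" using assms by (auto simp: unitD)
  have "u * inverse v * t powi (n - m) = 1"
    using assms(3) t_nz u by (simp add: power_int_diff field_simps)
  moreover have "u * inverse v \<in> P - M" by (intro unit_mult unit_inverse assms)
  ultimately show ?thesis using unit_powi_mem[of "u * inverse v" "n - m"] by force
qed

lemma residue_exists:
  assumes "f \<in> P" shows "\<exists>a\<in>K. f - a \<in> M"
proof (cases "f = 0")
  case True then show ?thesis by (intro bexI[of _ 0]) simp_all
next
  case False
  have "f \<in> F" using assms by simp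
  then obtain n a e where *: "a \<in> K" "e \<in> M" "a \<noteq> 0" "f = t powi n * (a + e)"
    using expansion[OF _ False] by metis
  have u: "a + e \<in> P - M" by (intro unit_add const_unit) (use * in auto)
  then have "n \<ge> 0" using unit_powi_mem[OF u, of n] assms * by (simp add: mult.commute)
  then consider "n = 0" | "n > 0" by fastforce
  then show ?thesis
  proof cases
    case 1 then show ?thesis using * by (intro bexI[of _ a]) auto
  next
    case 2 then show ?thesis using * unit_powi_mem[OF u, of n]
      by (intro bexI[of _ 0]) (auto simp: mult.commute)
  qed
qed

lemma eval_at_K: "f \<in> P \<Longrightarrow> eval_at K P f \<in> K"
  and eval_at_M: "f \<in> P \<Longrightarrow> f - eval_at K P f \<in> M"
  using residue_exists[of f] eval_atI[of _ f] by auto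

lemma eval_add: "f \<in> P \<Longrightarrow> g \<in> P \<Longrightarrow> eval_at K P (f + g) = eval_at K P f + eval_at K P g"
  using eval_at_K eval_at_M M_add[of "f - eval_at K P f" "g - eval_at K P g"]
  by (intro eval_atI) (auto simp: algebra_simps)

lemma eval_mult:
  assumes "f \<in> P" "g \<in> P" shows "eval_at K P (f * g) = eval_at K P f * eval_at K P g"
proof (rule eval_atI)
  have "f * (g - eval_at K P g) + (f - eval_at K P f) * eval_at K P g \<in> M"
    using assms by (simp add: eval_at_K eval_at_M)
  then show "f * g - eval_at K P f * eval_at K P g \<in> M" by (simp add: algebra_simps)
qed (use assms eval_at_K in auto)

lemma eval_diff: "f \<in> P \<Longrightarrow> g \<in> P \<Longrightarrow> eval_at K P (f - g) = eval_at K P f - eval_at K P g"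
  using eval_at_K eval_at_M M_diff[of "f - eval_at K P f" "g - eval_at K P g"]
  by (intro eval_atI) (auto simp: algebra_simps)

lemma eval_eq_0_iff: "f \<in> P \<Longrightarrow> eval_at K P f = 0 \<longleftrightarrow> f \<in> M"
  using eval_at_M[of f] eval_atI[of 0 f] by auto

text \<open>Write a generator of M as s = u t^n: then n > 0 because s lies in M, and n <= 1 because
  t is a multiple of s.\<close>

lemma uniformizer_iff: "uniformizer P s \<longleftrightarrow> (\<exists>w. w \<in> P - M \<and> s = w * t)"
proof
  assume s: "uniformizer P s"
  then have "t \<in> (*) s ` P" "s \<in> P" using t_M by (auto simp: uniformizer_def)
  then obtain g where g: "g \<in> P" "t = s * g" by auto
  have "s \<noteq> 0" using g t_nz by auto
  then obtain u n where u: "u \<in> P - M" "s = u * t powi n" using unit_expansion[of s] \<open>s \<in> P\<close> by (metis in_F)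
  have "s \<in> M" using s by (auto simp: uniformizer_def intro!: image_eqI[of _ _ 1])
  then have n: "n > 0" using u unit_powi_mem by simp
  have "n \<le> 1"
  proof (rule ccontr)
    assume "\<not> n \<le> 1"
    then have "t powi (n - 1) \<in> M" using t_powi_M by auto
    then have "t powi (n - 1) * (u * g) \<in> M" using u(1) g(1) by simp
    moreover have "t * (t powi (n - 1) * (u * g)) = t * 1"
      using arg_cong[OF u(2), of "\<lambda>z. z * g"] g(2) t_nz by (simp add: power_int_diff field_simps)
    ultimately show False using t_nz one_notin_M by (metis mult_left_cancel)
  qed
  then have "n = 1" using n by simp
  then show "\<exists>w. w \<in> P - M \<and> s = w * t" using u by auto
next
  assume "\<exists>w. w \<in> P - M \<and> s = w * t"
  then obtain w where w: "w \<in> P - M" "s = w * t" by auto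
  have wi: "inverse w \<in> P" "w \<noteq> 0" using w by (auto simp: unitD)
  have "f \<in> (*) s ` P" if f: "f \<in> M" for f
  proof (cases "f = 0")
    case False
    then obtain u n where u: "u \<in> P - M" "f = u * t powi n" using unit_expansion[of f] f by (metis in_F M_sub)
    have "n > 0" using unit_powi_mem u f by auto
    then have "u * t powi (n - 1) \<in> P" using unit_powi_mem(1)[OF u(1)] by simp
    moreover have "f = s * (inverse w * (u * t powi (n - 1)))"
      using u w wi t_nz \<open>n > 0\<close> by (simp add: power_int_diff field_simps)
    ultimately show ?thesis using wi P_basic(5) by (metis imageI)
  qed auto
  then show "uniformizer P s" using w t_M by (auto simp: uniformizer_def)
qed

lemma uniformizer_t: "uniformizer P t"
  unfolding uniformizer_iff by (rule exI[of _ 1]) auto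

text \<open>The description in \<open>ord_at\<close> ranges over all uniformizers; they differ from
  t by units only, so the exponent does not depend on the choice.\<close>

lemma ord_at_eq:
  assumes "u \<in> P - M" shows "ord_at P (u * t powi n) = n"
  unfolding ord_at_def
proof (rule the_equality)
  show "\<exists>t' u'. uniformizer P t' \<and> u' \<in> P - M \<and> u * t powi n = u' * t' powi n"
    using uniformizer_t assms by metis
next
  fix m assume "\<exists>t' u'. uniformizer P t' \<and> u' \<in> P - M \<and> u * t powi n = u' * t' powi m"
  then obtain w u' where w: "w \<in> P - M" "u' \<in> P - M" "u * t powi n = u' * (w * t) powi m"
    using uniformizer_iff by auto
  then have "u * t powi n = (u' * w powi m) * t powi m"
    by (simp add: power_int_mult_distrib)
  then show "m = n" using powi_unique[OF assms, of "u' * w powi m" n m] unit_mult[OF w(2) unit_powi[OF w(1)]] by simp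
qed

lemma ord_expansion:
  assumes "f \<in> F" "f \<noteq> 0"
  obtains u where "u \<in> P - M" "f = u * t powi (ord_at P f)"
  using unit_expansion[OF assms] ord_at_eq by metis

lemma ord_mult:
  assumes "f \<in> F" "f \<noteq> 0" "g \<in> F" "g \<noteq> 0"
  shows "ord_at P (f * g) = ord_at P f + ord_at P g"
proof -
  obtain u v where u: "u \<in> P - M" "f = u * t powi (ord_at P f)"
    and v: "v \<in> P - M" "g = v * t powi (ord_at P g)"
    using ord_expansion assms by metis
  then have "f * g = (u * v) * t powi (ord_at P f + ord_at P g)"
    using t_nz by (metis power_int_add mult.assoc mult.left_commute)
  then show ?thesis using ord_at_eq[OF unit_mult[OF u(1) v(1)]] by metis
qed

lemma ord_unit: "u \<in> P - M \<Longrightarrow> ord_at P u = 0"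
  using ord_at_eq[of u 0] by simp

lemma ord_powi:
  assumes "f \<in> F" "f \<noteq> 0" shows "ord_at P (f powi n) = n * ord_at P f"
proof -
  obtain u where u: "u \<in> P - M" "f = u * t powi (ord_at P f)"
    using ord_expansion assms by metis
  then have "f powi n = u powi n * (t powi (ord_at P f)) powi n"
    by (metis power_int_mult_distrib)
  also have "\<dots> = u powi n * t powi (n * ord_at P f)"
    by (metis power_int_mult mult.commute)
  finally show ?thesis using ord_at_eq[OF unit_powi[OF u(1)]] by metis
qed

lemma ord_power: "f \<in> F \<Longrightarrow> f \<noteq> 0 \<Longrightarrow> ord_at P (f ^ n) = int n * ord_at P f"
  using ord_powi[of f "int n"] by simp

lemma ord_inverse: "f \<in> F \<Longrightarrow> f \<noteq> 0 \<Longrightarrow> ord_at P (inverse f) = - ord_at P f"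
  using ord_powi[of f "- 1"] by (simp add: power_int_minus)

lemma mem_P_iff_ord: "f \<in> F \<Longrightarrow> f \<noteq> 0 \<Longrightarrow> f \<in> P \<longleftrightarrow> ord_at P f \<ge> 0"
  using ord_expansion[of f] unit_powi_mem(1) by metis

lemma mem_M_iff_ord: "f \<in> F \<Longrightarrow> f \<noteq> 0 \<Longrightarrow> f \<in> M \<longleftrightarrow> ord_at P f > 0"
  using ord_expansion[of f] unit_powi_mem(2) by metis

text \<open>Turns a lower bound on the order into membership in P, where closure under sums is
  available.\<close>

lemma mem_ord_ge:
  assumes "f \<in> F" "f \<noteq> 0" shows "f * t powi (- n) \<in> P \<longleftrightarrow> ord_at P f \<ge> n"
proof -
  have "f * t powi (- n) \<noteq> 0" "t powi (- n) \<noteq> 0" using assms t_nz by auto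
  moreover have "ord_at P (t powi (- n)) = - n" using ord_at_eq[of 1 "- n"] by simp
  ultimately show ?thesis
    using mem_P_iff_ord[of "f * t powi (- n)"] assms ord_mult[of f "t powi (- n)"] t_nz by auto
qed

lemma ord_sum_ge:
  assumes "\<And>i. i \<in> I \<Longrightarrow> g i \<in> F" "\<And>i. i \<in> I \<Longrightarrow> g i \<noteq> 0 \<Longrightarrow> ord_at P (g i) \<ge> n" "sum g I \<noteq> 0"
  shows "ord_at P (sum g I) \<ge> n"
proof -
  have "g i * t powi (- n) \<in> P" if "i \<in> I" for i
    using mem_ord_ge[of "g i" n] assms that by (cases "g i = 0") auto
  then have "sum g I * t powi (- n) \<in> P" unfolding sum_distrib_right by (rule P_sum)
  then show ?thesis using mem_ord_ge assms F.closed_sum by metis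
qed

lemma ord_add_ge:
  assumes "f \<in> F" "g \<in> F" "f \<noteq> 0 \<Longrightarrow> ord_at P f \<ge> n" "g \<noteq> 0 \<Longrightarrow> ord_at P g \<ge> n" "f + g \<noteq> 0"
  shows "ord_at P (f + g) \<ge> n"
  using ord_sum_ge[of "{True, False}" "\<lambda>b. if b then f else g" n] assms by (simp split: if_splits)

lemma ord_minus: "f \<in> F \<Longrightarrow> f \<noteq> 0 \<Longrightarrow> ord_at P (- f) = ord_at P f"
  using ord_mult[of "- 1" f] ord_unit[of "- 1"] const_unit[of "- 1"] by auto

lemma ord_add_eq:
  assumes "f \<in> F" "g \<in> F" "f \<noteq> 0" "g \<noteq> 0 \<Longrightarrow> ord_at P f < ord_at P g"
  shows "f + g \<noteq> 0" "ord_at P (f + g) = ord_at P f"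
proof -
  show nz: "f + g \<noteq> 0"
  proof
    assume "f + g = 0"
    then have "g = - f" by (simp add: eq_neg_iff_add_eq_0 add.commute)
    then show False using assms ord_minus[of f] by simp
  qed
  have "ord_at P (f + g) \<ge> ord_at P f"
    by (rule ord_add_ge) (use assms nz in auto)
  moreover have "ord_at P (f + g) \<le> ord_at P f"
  proof (rule ccontr)
    assume *: "\<not> ?thesis"
    \<comment> \<open>If the order of f + g were larger, f = (f + g) + (- g) would have an order
      above its own.\<close>
    have "ord_at P ((f + g) + (- g)) \<ge> ord_at P f + 1"
      by (rule ord_add_ge) (use * assms ord_minus[of g] nz in auto)
    then show False by simp
  qed
  ultimately show "ord_at P (f + g) = ord_at P f" by simp
qed

end

section \<open>Nonsingular curves and comorphisms\<close>

context local_parameter begin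

lemma ord_sum_dominant:
  assumes "finite I" "i \<in> I" "\<And>j. j \<in> I \<Longrightarrow> g j \<in> F" "g i \<noteq> 0"
    and "\<And>j. j \<in> I \<Longrightarrow> j \<noteq> i \<Longrightarrow> g j \<noteq> 0 \<Longrightarrow> ord_at P (g i) < ord_at P (g j)"
  shows "sum g I \<noteq> 0" "ord_at P (sum g I) = ord_at P (g i)"
proof -
  have *: "sum g I = g i + sum g (I - {i})"
    using assms(1,2) by (rule sum.remove)
  have F: "sum g (I - {i}) \<in> F" by (rule F.closed_sum) (use assms in auto)
  have "ord_at P (g i) < ord_at P (sum g (I - {i}))" if "sum g (I - {i}) \<noteq> 0"
  proof -
    have "ord_at P (g i) + 1 \<le> ord_at P (sum g (I - {i}))"
      by (rule ord_sum_ge) (use assms that in fastforce)+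
    then show ?thesis by simp
  qed
  then show "sum g I \<noteq> 0" "ord_at P (sum g I) = ord_at P (g i)"
    unfolding * using ord_add_eq[of "g i" "sum g (I - {i})"] assms F by auto
qed

text \<open>Terms of distinct orders cannot cancel: the nonzero one of least order dominates. Linear
  independence over a pulled back field rests on this.\<close>

lemma ord_sum_distinct:
  assumes "finite I" "\<And>j. j \<in> I \<Longrightarrow> g j \<in> F" "i \<in> I" "g i \<noteq> 0"
    and "inj_on (\<lambda>j. ord_at P (g j)) {j \<in> I. g j \<noteq> 0}"
  shows "sum g I \<noteq> 0" "ord_at P (sum g I) \<le> ord_at P (g i)"
proof -
  let ?J = "{j \<in> I. g j \<noteq> 0}"
  have J: "finite ?J" "?J \<noteq> {}" using assms by auto
  define i0 where "i0 = arg_min_on (\<lambda>j. ord_at P (g j)) ?J"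
  have i0: "i0 \<in> ?J" unfolding i0_def by (rule arg_min_if_finite(1)[OF J])
  have le: "ord_at P (g i0) \<le> ord_at P (g j)" if "j \<in> ?J" for j
    using arg_min_if_finite(2)[OF J, of "\<lambda>j. ord_at P (g j)"] that unfolding i0_def by force
  have lt: "ord_at P (g i0) < ord_at P (g j)" if "j \<in> I" "j \<noteq> i0" "g j \<noteq> 0" for j
    using le[of j] inj_onD[OF assms(5), of j i0] i0 that by fastforce
  have "sum g I \<noteq> 0 \<and> ord_at P (sum g I) = ord_at P (g i0)"
    using ord_sum_dominant[OF assms(1), of i0 g] assms(2) i0 lt by auto
  then show "sum g I \<noteq> 0" "ord_at P (sum g I) \<le> ord_at P (g i)"
    using le[of i] assms by auto
qed

end

text \<open>The three facts about a curve on which the passage between morphisms and field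
  embeddings depends; they are verified for the concrete curves later.\<close>

locale nonsingular_curve = K: field_subset K + F: field_subset F for K F :: "'f::field set" +
  assumes local_parameter_exists: "P \<in> curve_points K F \<Longrightarrow> \<exists>t. local_parameter K F P t"
    and infinite_points: "infinite (curve_points K F)"
    and finite_zeros: "f \<in> F \<Longrightarrow> f \<noteq> 0 \<Longrightarrow> finite {P \<in> curve_points K F. f \<in> max_ideal P}"
begin

lemma placeI: "P \<in> curve_points K F \<Longrightarrow> place K F P"
  by unfold_locales

lemma K_psub: "K \<subset> F"
proof -
  obtain P where "P \<in> curve_points K F" using infinite_points by (metis finite.emptyI ex_in_conv)
  then show ?thesis by (auto simp: curve_points_def)
qed

lemma finite_poles:
  assumes "f \<in> F" shows "finite {P \<in> curve_points K F. f \<notin> P}"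
proof (cases "f = 0")
  case True
  then have "{P \<in> curve_points K F. f \<notin> P} = {}"
    using place.P_basic(2)[OF placeI] by auto
  then show ?thesis by (metis finite.emptyI)
next
  case False
  have "{P \<in> curve_points K F. f \<notin> P} \<subseteq> {P \<in> curve_points K F. inverse f \<in> max_ideal P}"
    using place.inverse_in_M[OF placeI] assms by auto
  then show ?thesis
    by (rule finite_subset[OF _ finite_zeros]) (use False assms in auto)
qed

text \<open>The difference f - g vanishes on the infinite set S. This is the uniqueness behind
  \<open>pullback\<close>.\<close>

lemma eq_if_eval_eq:
  assumes "infinite S" "S \<subseteq> curve_points K F" "f \<in> F" "g \<in> F"
    and "\<And>P. P \<in> S \<Longrightarrow> f \<in> P \<and> g \<in> P \<and> eval_at K P f = eval_at K P g"
  shows "f = g"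
proof (rule ccontr)
  assume "f \<noteq> g"
  have "f - g \<in> max_ideal P" if S: "P \<in> S" for P
  proof -
    obtain t where "local_parameter K F P t" using local_parameter_exists[of P] S assms(2) by auto
    then interpret local_parameter K F P t .
    show ?thesis using eval_eq_0_iff[of "f - g"] eval_diff[of f g] assms(5)[OF S] by simp
  qed
  then have "S \<subseteq> {P \<in> curve_points K F. f - g \<in> max_ideal P}" using assms by auto
  moreover have "finite {P \<in> curve_points K F. f - g \<in> max_ideal P}"
    by (rule finite_zeros) (use \<open>f \<noteq> g\<close> assms in auto)
  ultimately show False using assms(1) finite_subset by blast
qed

end

text \<open>The link between \<open>sg\<close> and \<open>\<phi>\<close> is
  \<open>sg_mem_iff\<close>: the local ring at \<open>\<phi> P\<close> is the preimage of that at P.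
  Injectivity of \<open>sg\<close> is not an axiom, since a ring homomorphism out of a field that
  fixes 1 is injective.\<close>

locale comorphism = C: nonsingular_curve K F + D: nonsingular_curve K G
  for K F G :: "'f::field set" +
  fixes sg :: "'f \<Rightarrow> 'f" and \<phi> :: "'f set \<Rightarrow> 'f set"
  assumes sg_F: "g \<in> G \<Longrightarrow> sg g \<in> F"
    and sg_add: "g \<in> G \<Longrightarrow> h \<in> G \<Longrightarrow> sg (g + h) = sg g + sg h"
    and sg_mult: "g \<in> G \<Longrightarrow> h \<in> G \<Longrightarrow> sg (g * h) = sg g * sg h"
    and sg_const: "a \<in> K \<Longrightarrow> sg a = a"
    and \<phi>_points: "P \<in> curve_points K F \<Longrightarrow> \<phi> P \<in> curve_points K G"
    and sg_mem_iff: "P \<in> curve_points K F \<Longrightarrow> g \<in> G \<Longrightarrow> sg g \<in> P \<longleftrightarrow> g \<in> \<phi> P"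
begin

lemma K_G: "a \<in> K \<Longrightarrow> a \<in> G"
  using D.K_psub by auto

lemma sg_0 [simp]: "sg 0 = 0" and sg_1 [simp]: "sg 1 = 1"
  by (auto simp: sg_const)

lemma sg_minus: "g \<in> G \<Longrightarrow> sg (- g) = - sg g"
  using sg_add[of g "- g"] by (simp add: eq_neg_iff_add_eq_0 add.commute)

lemma sg_diff: "g \<in> G \<Longrightarrow> h \<in> G \<Longrightarrow> sg (g - h) = sg g - sg h"
  using sg_add[of g "- h"] by (simp add: sg_minus)

lemma sg_eq_0_iff: "g \<in> G \<Longrightarrow> sg g = 0 \<longleftrightarrow> g = 0"
  using sg_mult[of g "inverse g"] by (cases "g = 0") auto

lemma sg_inverse: "g \<in> G \<Longrightarrow> sg (inverse g) = inverse (sg g)"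
  using sg_mult[of g "inverse g"] inverse_unique[of "sg g" "sg (inverse g)"] by (cases "g = 0") auto

lemma sg_power: "g \<in> G \<Longrightarrow> sg (g ^ n) = sg g ^ n"
  by (induction n) (auto simp: sg_mult)

lemma sg_powi: "g \<in> G \<Longrightarrow> sg (g powi n) = sg g powi n"
  by (auto simp: power_int_def sg_power sg_inverse)

lemma sg_max_ideal_iff:
  assumes "P \<in> curve_points K F" "g \<in> G"
  shows "sg g \<in> max_ideal P \<longleftrightarrow> g \<in> max_ideal (\<phi> P)"
  using sg_mem_iff[OF assms] sg_mem_iff[OF assms(1), of "inverse g"] sg_inverse sg_eq_0_iff assms(2)
  by (auto simp: max_ideal_def)

lemma eval_sg:
  assumes P: "P \<in> curve_points K F" and g: "g \<in> \<phi> P"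
  shows "eval_at K P (sg g) = eval_at K (\<phi> P) g"
proof -
  obtain t where "local_parameter K G (\<phi> P) t" using D.local_parameter_exists \<phi>_points[OF P] by blast
  then interpret Q: local_parameter K G "\<phi> P" t .
  interpret P: place K F P by (rule C.placeI[OF P])
  define a where "a = eval_at K (\<phi> P) g"
  have a: "a \<in> K" "g - a \<in> max_ideal (\<phi> P)" "a \<in> G" "g \<in> G"
    using g Q.eval_at_K Q.eval_at_M K_G by (auto simp: a_def)
  then have "sg (g - a) \<in> max_ideal P" using sg_max_ideal_iff[OF P, of "g - a"] by simp
  then show ?thesis
    using a by (intro P.eval_atI) (auto simp: sg_diff sg_const a_def)
qed

text \<open>The pullback of a local parameter at Q is a nonzero function that vanishes on the whole
  fibre.\<close>

lemma finite_fibre: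
  assumes "Q \<in> curve_points K G" shows "finite {P \<in> curve_points K F. \<phi> P = Q}"
proof -
  obtain t where "local_parameter K G Q t" using D.local_parameter_exists assms by blast
  then interpret Q: local_parameter K G Q t .
  have "{P \<in> curve_points K F. \<phi> P = Q} \<subseteq> {P \<in> curve_points K F. sg t \<in> max_ideal P}"
    using sg_max_ideal_iff[of _ t] Q.t_M by auto
  then show ?thesis
    by (rule finite_subset[OF _ C.finite_zeros]) (use sg_F sg_eq_0_iff Q.t_nz in auto)
qed

text \<open>Uniqueness: \<open>sg g\<close> has finitely many poles, and at the infinitely many
  other points the required values are prescribed.\<close>

lemma pullback_eq:
  assumes "g \<in> G" shows "pullback K F \<phi> g = sg g"
  unfolding pullback_def
proof (rule the_equality)
  show "sg g \<in> F \<and> (\<forall>P\<in>curve_points K F. g \<in> \<phi> P \<longrightarrow> sg g \<in> P \<and> eval_at K P (sg g) = eval_at K (\<phi> P) g)"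
    using assms sg_F eval_sg sg_mem_iff by auto
next
  fix f assume f: "f \<in> F \<and> (\<forall>P\<in>curve_points K F. g \<in> \<phi> P \<longrightarrow> f \<in> P \<and> eval_at K P f = eval_at K (\<phi> P) g)"
  have "finite {P \<in> curve_points K F. sg g \<notin> P}" using C.finite_poles sg_F assms by auto
  moreover have "curve_points K F = {P \<in> curve_points K F. sg g \<notin> P} \<union> {P \<in> curve_points K F. sg g \<in> P}" by auto
  ultimately have "infinite {P \<in> curve_points K F. sg g \<in> P}"
    using C.infinite_points by (metis finite_UnI)
  then show "f = sg g"
    by (rule C.eq_if_eval_eq) (use f assms sg_F eval_sg sg_mem_iff in auto)
qed

lemma curve_morphism: "curve_morphism K F G \<phi>"
  unfolding curve_morphism_def
proof (intro conjI allI impI)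
  show "\<phi> \<in> curve_points K F \<rightarrow> curve_points K G" using \<phi>_points by auto
next
  fix V assume V: "curve_open K G V"
  \<comment> \<open>Continuity for the cofinite topology: the complement of the preimage is a finite
    union of finite fibres.\<close>
  have *: "finite (curve_points K F - (\<phi> -` V \<inter> curve_points K F))" if "V \<noteq> {}"
  proof -
    have "curve_points K F - (\<phi> -` V \<inter> curve_points K F) =
       (\<Union>Q\<in>curve_points K G - V. {P \<in> curve_points K F. \<phi> P = Q})"
      using \<phi>_points by auto
    then show ?thesis using V that finite_fibre by (auto simp: curve_open_def)
  qed
  show "curve_open K F (\<phi> -` V \<inter> curve_points K F)"
    using * by (cases "V = {}") (auto simp: curve_open_def)
next
  fix V h assume V: "curve_open K G V" and h: "regular_on K G V h"
  then obtain g where g: "g \<in> G" "\<And>Q. Q \<in> V \<Longrightarrow> g \<in> Q \<and> h Q = eval_at K Q g"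
    by (auto simp: regular_on_def)
  show "regular_on K F (\<phi> -` V \<inter> curve_points K F) (h \<circ> \<phi>)"
    unfolding regular_on_def
    by (rule bexI[of _ "sg g"]) (use g sg_F sg_mem_iff eval_sg in auto)
qed

lemma nonconstant: "nonconstant K F \<phi>"
  unfolding nonconstant_def
proof
  assume "\<exists>Q. \<forall>P\<in>curve_points K F. \<phi> P = Q"
  then obtain Q where Q: "\<And>P. P \<in> curve_points K F \<Longrightarrow> \<phi> P = Q" by auto
  obtain P where P: "P \<in> curve_points K F" using C.infinite_points by (metis finite.emptyI ex_in_conv)
  then have "Q \<in> curve_points K G" using Q \<phi>_points by metis
  then have "finite {P \<in> curve_points K F. \<phi> P = Q}" by (rule finite_fibre)
  moreover have "{P \<in> curve_points K F. \<phi> P = Q} = curve_points K F" using Q by auto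
  ultimately show False using C.infinite_points by simp
qed

text \<open>Units at \<open>\<phi> P\<close> pull back to units at P, so orders are multiplied by
  the order e of the pullback of one local parameter, and every other uniformizer yields the same
  e.\<close>

lemma ord_sg:
  assumes P: "P \<in> curve_points K F" and g: "g \<in> G" "g \<noteq> 0"
  shows "ord_at P (sg g) = int (ramification_index K F \<phi> P) * ord_at (\<phi> P) g"
    and "ramification_index K F \<phi> P > 0"
proof -
  obtain t where "local_parameter K G (\<phi> P) t" using D.local_parameter_exists \<phi>_points[OF P] by blast
  then interpret Q: local_parameter K G "\<phi> P" t .
  obtain s where "local_parameter K F P s" using C.local_parameter_exists P by blast
  then interpret P: local_parameter K F P s .
  define e where "e = ord_at P (sg t)"
  have st: "sg t \<in> F" "sg t \<noteq> 0" using sg_F sg_eq_0_iff Q.t_nz by auto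
  have "e > 0" unfolding e_def
    using P.mem_M_iff_ord[OF st] sg_max_ideal_iff[OF P, of t] Q.t_M by simp
  have unit: "sg u \<in> P - max_ideal P" if "u \<in> \<phi> P - max_ideal (\<phi> P)" for u
    using sg_mem_iff[OF P, of u] sg_max_ideal_iff[OF P, of u] that Q.in_F by auto
  have ord: "ord_at P (sg g) = e * ord_at (\<phi> P) g" if gG: "g \<in> G" "g \<noteq> 0" for g
  proof -
    obtain u where u: "u \<in> \<phi> P - max_ideal (\<phi> P)" "g = u * t powi (ord_at (\<phi> P) g)"
      using Q.ord_expansion[OF gG] by metis
    then have uG: "u \<in> G" by simp
    have su: "sg u \<in> P - max_ideal P" by (rule unit[OF u(1)])
    then have su': "sg u \<in> F" "sg u \<noteq> 0" by auto
    have "sg g = sg u * sg t powi (ord_at (\<phi> P) g)"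
      using arg_cong[OF u(2), of sg] uG sg_mult sg_powi by simp
    moreover have "ord_at P (sg u * sg t powi (ord_at (\<phi> P) g)) = 0 + ord_at (\<phi> P) g * e"
      using P.ord_mult[OF su'] P.ord_powi[OF st] st P.ord_unit[OF su] by (simp add: e_def)
    ultimately show ?thesis by simp
  qed
  have unif: "ord_at P (pullback K F \<phi> t') = e" if t': "uniformizer (\<phi> P) t'" for t'
  proof -
    obtain w where w: "w \<in> \<phi> P - max_ideal (\<phi> P)" "t' = w * t"
      using t' Q.uniformizer_iff by auto
    have *: "t' \<in> G" "t' \<noteq> 0" using w Q.t_nz by (auto simp: Q.unitD)
    have "ord_at (\<phi> P) t' = 1" using Q.ord_at_eq[OF w(1), of 1] w(2) by simp
    then show ?thesis using ord[OF *] pullback_eq[OF *(1)] by simp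
  qed
  have "ramification_index K F \<phi> P = nat e"
    unfolding ramification_index_def
  proof (rule the_equality)
    show "\<forall>t. uniformizer (\<phi> P) t \<longrightarrow> ord_at P (pullback K F \<phi> t) = int (nat e)"
      using unif \<open>e > 0\<close> by auto
  next
    fix e' assume "\<forall>t. uniformizer (\<phi> P) t \<longrightarrow> ord_at P (pullback K F \<phi> t) = int e'"
    then have "int e' = e" using unif Q.uniformizer_t by metis
    then show "e' = nat e" by simp
  qed
  then show "ord_at P (sg g) = int (ramification_index K F \<phi> P) * ord_at (\<phi> P) g"
    and "ramification_index K F \<phi> P > 0"
    using ord[OF g] \<open>e > 0\<close> by auto
qed

lemma subfield_image: "subfield (sg ` G) ring_of_type_algebra"
proof -
  have "sg g + sg h \<in> sg ` G" "sg g * sg h \<in> sg ` G" if "g \<in> G" "h \<in> G" for g h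
    using that sg_add sg_mult by (metis D.F.closed_basic(4,5) imageI)+
  moreover have "- sg g \<in> sg ` G" "inverse (sg g) \<in> sg ` G" if "g \<in> G" for g
    using that sg_minus sg_inverse by (metis D.F.closed_basic(3,6) imageI)+
  moreover have "1 \<in> sg ` G" using sg_1 by (metis D.F.closed_basic(1) imageI)
  ultimately show ?thesis
    unfolding subfield_type_algebra_iff subring_type_algebra_iff by auto
qed

lemma morphism_degree_eq:
  "morphism_degree K F G \<phi> = (ring.dim ring_of_type_algebra over (sg ` G)) F"
proof -
  have "pullback K F \<phi> ` G = sg ` G" using pullback_eq by (rule image_cong[OF refl])
  then show ?thesis by (simp add: morphism_degree_def)
qed

end

text \<open>Valuation rings contract to valuation rings along a field embedding over K; what needs
  an argument is that the contraction is neither K nor all of G.\<close>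

lemma comorphism_comap:
  assumes "nonsingular_curve K F" "nonsingular_curve K G"
    and sg_F: "\<And>g. g \<in> G \<Longrightarrow> sg g \<in> F"
    and add: "\<And>g h. g \<in> G \<Longrightarrow> h \<in> G \<Longrightarrow> sg (g + h) = sg g + sg h"
    and mult: "\<And>g h. g \<in> G \<Longrightarrow> h \<in> G \<Longrightarrow> sg (g * h) = sg g * sg h"
    and const: "\<And>a. a \<in> K \<Longrightarrow> sg a = a"
  shows "comorphism K F G sg (\<lambda>P. {g \<in> G. sg g \<in> P})"
proof -
  interpret C: nonsingular_curve K F by fact
  interpret D: nonsingular_curve K G by fact
  have KG: "a \<in> G" if "a \<in> K" for a using that D.K_psub by auto
  have zero: "sg 0 = 0" and one: "sg 1 = 1" using const by auto
  have minus: "sg (- g) = - sg g" if "g \<in> G" for g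
    using add[of g "- g"] that zero by (simp add: eq_neg_iff_add_eq_0 add.commute)
  have inv: "sg (inverse g) = inverse (sg g)" if "g \<in> G" for g
    using mult[of g "inverse g"] inverse_unique[of "sg g" "sg (inverse g)"] that zero one
    by (cases "g = 0") auto
  have pts: "{g \<in> G. sg g \<in> P} \<in> curve_points K G" if P: "P \<in> curve_points K F" for P
  proof -
    obtain s where "local_parameter K F P s" using C.local_parameter_exists P by blast
    then interpret P: local_parameter K F P s .
    let ?Q = "{g \<in> G. sg g \<in> P}"
    have "subring ?Q ring_of_type_algebra"
      unfolding subring_type_algebra_iff using one minus add mult by auto
    moreover have val: "\<forall>g\<in>G. g \<in> ?Q \<or> inverse g \<in> ?Q"
    proof
      fix g assume g: "g \<in> G"
      then show "g \<in> ?Q \<or> inverse g \<in> ?Q"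
        using P.val[OF sg_F[OF g]] inv[OF g] by auto
    qed
    moreover have "K \<subseteq> ?Q"
    proof
      fix a assume "a \<in> K"
      then show "a \<in> ?Q" using KG[of a] const[of a] by simp
    qed
    moreover have "K \<noteq> ?Q"
    proof
      assume "K = ?Q"
      have "g \<in> K" if "g \<in> G" for g
      proof -
        have "g \<in> ?Q \<or> inverse g \<in> ?Q" using val that by (rule bspec)
        then have "g \<in> K \<or> inverse g \<in> K" by (simp only: \<open>K = ?Q\<close>)
        then show ?thesis using C.K.closed_basic(6)[of "inverse g"] inverse_inverse_eq[of g] by metis
      qed
      then show False using D.K_psub by auto
    qed
    \<comment> \<open>For a nonconstant g with residue a at P, \<open>sg (g - a)\<close> lies in the
      maximal ideal. If all of G were regular, its inverse would be regular too.\<close>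
    moreover have "?Q \<noteq> G"
    proof
      assume Q: "?Q = G"
      obtain g where g: "g \<in> G" "g \<notin> K" using D.K_psub by auto
      define a where "a = eval_at K P (sg g)"
      have a: "a \<in> K" "sg g - a \<in> max_ideal P" "sg g \<in> P"
        using Q g P.eval_at_K P.eval_at_M by (auto simp: a_def)
      have nz: "g - a \<noteq> 0" "g - a \<in> G" "- a \<in> G" using a g KG by auto
      then have "inverse (g - a) \<in> ?Q" unfolding Q by simp
      moreover have "sg (g - a) = sg g - a"
        using add[of g "- a"] minus[of a] const a g KG nz by simp
      ultimately have "sg (g - a) * sg (inverse (g - a)) \<in> max_ideal P"
        using a by auto
      then show False using mult[of "g - a" "inverse (g - a)"] nz one P.one_notin_M by simp
    qed
    ultimately show ?thesis unfolding curve_points_def by blast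
  qed
  show ?thesis
    by unfold_locales (use sg_F add mult const pts in auto)
qed

text \<open>Regularity of the composite on the set where g is regular provides the pullback, and all
  identities are checked on values at infinitely many points. Nonconstancy enters through the
  fibres: the preimage of the complement of Q is nonempty and open, hence cofinite.\<close>

lemma comorphism_pullback:
  assumes "nonsingular_curve K F" "nonsingular_curve K G"
    and mor: "curve_morphism K F G \<phi>" and nonconst: "nonconstant K F \<phi>"
  shows "comorphism K F G (pullback K F \<phi>) \<phi>"
proof -
  interpret C: nonsingular_curve K F by fact
  interpret D: nonsingular_curve K G by fact
  have pts: "\<phi> P \<in> curve_points K G" if "P \<in> curve_points K F" for P
    using mor that by (auto simp: curve_morphism_def)
  have fibre: "finite {P \<in> curve_points K F. \<phi> P = Q}" if "Q \<in> curve_points K G" for Q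
  proof -
    let ?V = "curve_points K G - {Q}"
    have "curve_points K G - ?V \<subseteq> {Q}" by auto
    then have "curve_open K G ?V" by (auto simp: curve_open_def intro: finite_subset)
    then have "curve_open K F (\<phi> -` ?V \<inter> curve_points K F)"
      using mor by (auto simp: curve_morphism_def)
    moreover have "\<phi> -` ?V \<inter> curve_points K F \<noteq> {}"
    proof -
      obtain P where "P \<in> curve_points K F" "\<phi> P \<noteq> Q"
        using nonconst unfolding nonconstant_def by metis
      then show ?thesis using pts[of P] by auto
    qed
    ultimately have "finite (curve_points K F - (\<phi> -` ?V \<inter> curve_points K F))"
      by (simp add: curve_open_def)
    moreover have "{P \<in> curve_points K F. \<phi> P = Q} \<subseteq> curve_points K F - (\<phi> -` ?V \<inter> curve_points K F)"
      by auto
    ultimately show ?thesis by (rule finite_subset[rotated])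
  qed
  have poles: "finite {P \<in> curve_points K F. g \<notin> \<phi> P}" if "g \<in> G" for g
  proof -
    have "{P \<in> curve_points K F. g \<notin> \<phi> P} \<subseteq>
       (\<Union>Q\<in>{Q \<in> curve_points K G. g \<notin> Q}. {P \<in> curve_points K F. \<phi> P = Q})"
      using pts by auto
    moreover have "finite \<dots>"
      by (rule finite_UN_I[OF D.finite_poles[OF that]]) (use fibre in auto)
    ultimately show ?thesis by (rule finite_subset)
  qed
  have inf: "infinite {P \<in> curve_points K F. g \<in> \<phi> P \<and> h \<in> \<phi> P}" if "g \<in> G" "h \<in> G" for g h
  proof -
    have "curve_points K F \<subseteq> {P \<in> curve_points K F. g \<in> \<phi> P \<and> h \<in> \<phi> P} \<union>
       ({P \<in> curve_points K F. g \<notin> \<phi> P} \<union> {P \<in> curve_points K F. h \<notin> \<phi> P})" by auto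
    moreover have "finite ({P \<in> curve_points K F. g \<notin> \<phi> P} \<union> {P \<in> curve_points K F. h \<notin> \<phi> P})"
      by (intro finite_UnI poles that)
    ultimately show ?thesis using C.infinite_points finite_subset finite_UnI by blast
  qed
  define sg where "sg = pullback K F \<phi>"
  have pb: "sg g \<in> F \<and> (\<forall>P\<in>curve_points K F. g \<in> \<phi> P \<longrightarrow> sg g \<in> P \<and> eval_at K P (sg g) = eval_at K (\<phi> P) g)"
    if g: "g \<in> G" for g
    unfolding sg_def pullback_def
  proof (rule theI')
    let ?V = "{Q \<in> curve_points K G. g \<in> Q}"
    let ?P = "\<lambda>f. f \<in> F \<and> (\<forall>P\<in>curve_points K F. g \<in> \<phi> P \<longrightarrow> f \<in> P \<and> eval_at K P f = eval_at K (\<phi> P) g)"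
    have "curve_points K G - ?V = {Q \<in> curve_points K G. g \<notin> Q}" by auto
    then have "curve_open K G ?V" using D.finite_poles[OF g] by (auto simp: curve_open_def)
    moreover have "regular_on K G ?V (\<lambda>Q. eval_at K Q g)"
      using g by (auto simp: regular_on_def)
    ultimately have "regular_on K F (\<phi> -` ?V \<inter> curve_points K F) ((\<lambda>Q. eval_at K Q g) \<circ> \<phi>)"
      using mor unfolding curve_morphism_def by blast
    then obtain f where f: "f \<in> F"
      "\<And>P. P \<in> \<phi> -` ?V \<inter> curve_points K F \<Longrightarrow> f \<in> P \<and> eval_at K (\<phi> P) g = eval_at K P f"
      by (auto simp: regular_on_def)
    have 1: "?P f" using f pts by auto
    have "f' = f" if "?P f'" for f'
      by (rule C.eq_if_eval_eq[OF inf[OF g g]]) (use 1 that in auto)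
    then show "\<exists>!f. ?P f" using 1 by blast
  qed
  have ev: "sg g \<in> P \<and> eval_at K P (sg g) = eval_at K (\<phi> P) g"
    if "P \<in> curve_points K F" "g \<in> \<phi> P" "g \<in> G" for P g
    using pb that by blast
  have param: "\<exists>s t. local_parameter K F P s \<and> local_parameter K G (\<phi> P) t" if "P \<in> curve_points K F" for P
    using C.local_parameter_exists D.local_parameter_exists pts that by metis
  have add_mult: "sg (g + h) = sg g + sg h \<and> sg (g * h) = sg g * sg h" if gh: "g \<in> G" "h \<in> G" for g h
  proof -
    have *: "(sg (g + h) \<in> P \<and> sg g + sg h \<in> P \<and> eval_at K P (sg (g + h)) = eval_at K P (sg g + sg h)) \<and>
      (sg (g * h) \<in> P \<and> sg g * sg h \<in> P \<and> eval_at K P (sg (g * h)) = eval_at K P (sg g * sg h))"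
      if P: "P \<in> curve_points K F" "g \<in> \<phi> P" "h \<in> \<phi> P" for P
    proof -
      obtain s t where "local_parameter K F P s" "local_parameter K G (\<phi> P) t" using param P by blast
      then interpret P: local_parameter K F P s + Q: local_parameter K G "\<phi> P" t by auto
      show ?thesis
        using ev[OF P(1) P(2) gh(1)] ev[OF P(1) P(3) gh(2)] ev[OF P(1), of "g + h"] ev[OF P(1), of "g * h"] gh P
        by (simp add: P.eval_add P.eval_mult Q.eval_add Q.eval_mult)
    qed
    show ?thesis
      by (intro conjI; rule C.eq_if_eval_eq[OF inf[OF gh]]) (use * pb gh in auto)
  qed
  have KG: "a \<in> G" "a \<in> F" if "a \<in> K" for a using that D.K_psub C.K_psub by auto
  have const: "sg a = a" if a: "a \<in> K" for a
  proof (rule C.eq_if_eval_eq[OF inf[of a a]])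
    fix P assume P: "P \<in> {P \<in> curve_points K F. a \<in> \<phi> P \<and> a \<in> \<phi> P}"
    then obtain s t where "local_parameter K F P s" "local_parameter K G (\<phi> P) t" using param by blast
    then interpret P: local_parameter K F P s + Q: local_parameter K G "\<phi> P" t by auto
    show "sg a \<in> P \<and> a \<in> P \<and> eval_at K P (sg a) = eval_at K P a"
      using ev[of P a] P a KG by simp
  qed (use pb a KG in auto)
  \<comment> \<open>If g had a pole at \<open>\<phi> P\<close>, then 1 / g would vanish there and
    its pullback would vanish at P, so its product with the regular function \<open>sg g\<close>
    could not be 1.\<close>
  have mem: "sg g \<in> P \<longleftrightarrow> g \<in> \<phi> P" if P: "P \<in> curve_points K F" and g: "g \<in> G" for P g
  proof
    assume *: "sg g \<in> P"
    show "g \<in> \<phi> P"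
    proof (rule ccontr)
      assume "g \<notin> \<phi> P"
      obtain s t where "local_parameter K F P s" "local_parameter K G (\<phi> P) t" using param P by blast
      then interpret P: local_parameter K F P s + Q: local_parameter K G "\<phi> P" t by auto
      have i: "inverse g \<in> max_ideal (\<phi> P)" "inverse g \<in> \<phi> P" "inverse g \<in> G" "g \<noteq> 0"
        using Q.inverse_in_M[OF g \<open>g \<notin> \<phi> P\<close>] g \<open>g \<notin> \<phi> P\<close> by auto
      then have "eval_at K P (sg (inverse g)) = 0" using ev[OF P i(2,3)] Q.eval_eq_0_iff by simp
      then have "sg (inverse g) \<in> max_ideal P" using ev[OF P i(2,3)] P.eval_eq_0_iff[of "sg (inverse g)"] by simp
      then have "sg g * sg (inverse g) \<in> max_ideal P" using * by simp
      then show False using add_mult[OF g i(3)] i(4) const[of 1] by simp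
    qed
  qed (use ev P g in auto)
  have "comorphism K F G sg \<phi>"
    by unfold_locales (use pb add_mult const pts mem in auto)
  then show ?thesis by (simp add: sg_def)
qed

section \<open>Linear independence by orders\<close>

text \<open>The list is reversed because \<open>Span\<close> peels off the head: the vector of
  highest index is then the one added last, which suits induction on n.\<close>

lemma Span_rev_upt_iff:
  fixes w :: "nat \<Rightarrow> 'f::field"
  assumes "subfield E ring_of_type_algebra"
  shows "v \<in> ring.Span ring_of_type_algebra E (map w (rev [0..<n])) \<longleftrightarrow>
     (\<exists>a. (\<forall>i<n. a i \<in> E) \<and> v = (\<Sum>i<n. a i * w i))"
proof -
  interpret R: field "ring_of_type_algebra :: 'f ring" by (rule field_from_type_algebra)
  show ?thesis
  proof (induction n arbitrary: v)
    case 0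
    then show ?case by simp
  next
    case (Suc n)
    have "v \<in> R.Span E (map w (rev [0..<Suc n])) \<longleftrightarrow>
        (\<exists>k\<in>E. \<exists>v'\<in>R.Span E (map w (rev [0..<n])). v = k * w n + v')"
      using R.line_extension_mem_iff[of v E "w n"] by simp
    also have "\<dots> \<longleftrightarrow> (\<exists>a. (\<forall>i<Suc n. a i \<in> E) \<and> v = (\<Sum>i<Suc n. a i * w i))"
    proof
      assume "\<exists>k\<in>E. \<exists>v'\<in>R.Span E (map w (rev [0..<n])). v = k * w n + v'"
      then obtain k v' where k': "k \<in> E" "v' \<in> R.Span E (map w (rev [0..<n]))" "v = k * w n + v'"
        by blast
      then obtain a where k: "\<forall>i<n. a i \<in> E" "v = k * w n + (\<Sum>i<n. a i * w i)" "k \<in> E"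
        using Suc.IH[of v'] by blast
      have "(\<Sum>i<n. (a(n := k)) i * w i) = (\<Sum>i<n. a i * w i)" by (rule sum.cong) auto
      then show "\<exists>a. (\<forall>i<Suc n. a i \<in> E) \<and> v = (\<Sum>i<Suc n. a i * w i)"
        using k by (intro exI[of _ "a(n := k)"]) (auto simp: less_Suc_eq add.commute)
    next
      assume "\<exists>a. (\<forall>i<Suc n. a i \<in> E) \<and> v = (\<Sum>i<Suc n. a i * w i)"
      then obtain a where a: "\<forall>i<Suc n. a i \<in> E" "v = (\<Sum>i<Suc n. a i * w i)" by auto
      then have "(\<Sum>i<n. a i * w i) \<in> R.Span E (map w (rev [0..<n]))"
        unfolding Suc.IH by (intro exI[of _ a]) simp
      then show "\<exists>k\<in>E. \<exists>v'\<in>R.Span E (map w (rev [0..<n])). v = k * w n + v'"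
        using a by (intro bexI[of _ "a n"] bexI[of _ "\<Sum>i<n. a i * w i"]) (auto simp: add.commute)
    qed
    finally show ?case .
  qed
qed

lemma independent_rev_uptI:
  fixes w :: "nat \<Rightarrow> 'f::field"
  assumes "subfield E ring_of_type_algebra"
    and "\<And>n a. n < N \<Longrightarrow> (\<And>i. i < n \<Longrightarrow> a i \<in> E) \<Longrightarrow> w n \<noteq> (\<Sum>i<n. a i * w i)"
  shows "ring.independent ring_of_type_algebra E (map w (rev [0..<N]))"
proof -
  interpret R: field "ring_of_type_algebra :: 'f ring" by (rule field_from_type_algebra)
  show ?thesis
    using assms(2)
  proof (induction N)
    case 0
    then show ?case by simp
  next
    case (Suc N)
    have "w N \<notin> R.Span E (map w (rev [0..<N]))"
      unfolding Span_rev_upt_iff[OF assms(1)] using Suc.prems[of N] by blast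
    then have "R.independent E (w N # map w (rev [0..<N]))"
      by (intro R.li_Cons Suc.IH) (use Suc.prems in auto)
    then show ?case by simp
  qed
qed

context comorphism begin

lemma not_sum_if_distinct_orders:
  fixes w :: "nat \<Rightarrow> 'f"
  assumes P: "P \<in> curve_points K F"
    and w: "\<And>i. i \<le> n \<Longrightarrow> w i \<in> F" "\<And>i. i \<le> n \<Longrightarrow> w i \<noteq> 0"
    and inj: "inj_on (\<lambda>i. ord_at P (w i) mod int (ramification_index K F \<phi> P)) {..n}"
    and a: "\<And>i. i < n \<Longrightarrow> a i \<in> sg ` G"
  shows "w n \<noteq> (\<Sum>i<n. a i * w i)"
proof
  assume eq: "w n = (\<Sum>i<n. a i * w i)"
  obtain s where "local_parameter K F P s" using C.local_parameter_exists P by blast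
  then interpret P: local_parameter K F P s .
  define e where "e = int (ramification_index K F \<phi> P)"
  define g where "g i = (if i = n then - w n else a i * w i)" for i
  have aF: "a i \<in> F" if "i < n" for i using a[OF that] sg_F by auto
  have "sum g {..n} = sum g {..<n} + g n"
    using sum.lessThan_Suc[of g n] by (simp only: lessThan_Suc_atMost)
  also have "sum g {..<n} = w n" unfolding eq by (rule sum.cong) (auto simp: g_def)
  finally have 0: "sum g {..n} = 0" by (simp add: g_def)
  have ord: "ord_at P (g i) mod e = ord_at P (w i) mod e" if i: "i \<le> n" "g i \<noteq> 0" for i
  proof (cases "i = n")
    case True
    then show ?thesis using P.ord_minus[of "w n"] w by (simp add: g_def)
  next
    case False
    then obtain b where b: "b \<in> G" "a i = sg b" using a[of i] i by auto
    have "a i \<noteq> 0" using i False by (auto simp: g_def)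
    then have "b \<noteq> 0" using b by auto
    have "ord_at P (g i) = e * ord_at (\<phi> P) b + ord_at P (w i)"
      using P.ord_mult[of "a i" "w i"] aF[of i] w[of i] i False \<open>a i \<noteq> 0\<close> ord_sg(1)[OF P b(1) \<open>b \<noteq> 0\<close>] b(2)
      by (simp add: g_def e_def)
    then show ?thesis by simp
  qed
  have "inj_on (\<lambda>i. ord_at P (g i)) {i \<in> {..n}. g i \<noteq> 0}"
  proof (rule inj_onI)
    fix i j assume ij: "i \<in> {i \<in> {..n}. g i \<noteq> 0}" "j \<in> {i \<in> {..n}. g i \<noteq> 0}" "ord_at P (g i) = ord_at P (g j)"
    then have "ord_at P (w i) mod e = ord_at P (w j) mod e" using ord[of i] ord[of j] by simp
    then show "i = j" using inj_onD[OF inj, of i j] ij by (auto simp: e_def)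
  qed
  then have "sum g {..n} \<noteq> 0"
    by (intro P.ord_sum_distinct(1)[of _ g n]) (use w aF in \<open>auto simp: g_def\<close>)
  then show False using 0 by simp
qed

text \<open>
  With \<open>e\<close> the ramification index at \<open>P\<close>, the \<open>e + 1\<close> functions \<open>1, t, \<dots>, t^(e - 1), f\<close> are linearly
  independent over the smaller field.
\<close>

lemma degree_gt_ramification:
  assumes P: "P \<in> curve_points K F" and P': "P' \<in> curve_points K F" "\<phi> P' = \<phi> P"
    and t: "t \<in> P'" "t \<noteq> 0" "ord_at P t = 1"
    and f: "f \<in> P'" "f \<notin> max_ideal P'" "ord_at P f \<ge> int (ramification_index K F \<phi> P)"
    and d: "ring.dimension ring_of_type_algebra d (sg ` G) F"
  shows "ramification_index K F \<phi> P < d"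
proof -
  interpret R: field "ring_of_type_algebra :: 'f ring" by (rule field_from_type_algebra)
  obtain s where "local_parameter K F P s" using C.local_parameter_exists P by blast
  then interpret P: local_parameter K F P s .
  interpret P': place K F P' by (rule C.placeI[OF P'(1)])
  define e where "e = ramification_index K F \<phi> P"
  define w where "w i = (if i = e then f else t ^ i)" for i
  have tF: "t \<in> F" and fF: "f \<in> F" "f \<noteq> 0" using t f by auto
  have w: "w i \<in> F" "w i \<noteq> 0" for i using tF fF t by (auto simp: w_def)
  have ordt: "ord_at P (t ^ i) = int i" for i using P.ord_power[OF tF t(2), of i] t(3) by simp
  have "w n \<noteq> (\<Sum>i<n. a i * w i)" if n: "n < Suc e" and a: "\<And>i. i < n \<Longrightarrow> a i \<in> sg ` G" for n a
  proof (cases "n = e")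
    case False
    then have "n < e" using n by simp
    show ?thesis
    proof (rule not_sum_if_distinct_orders[OF P])
      show "inj_on (\<lambda>i. ord_at P (w i) mod int (ramification_index K F \<phi> P)) {..n}"
        unfolding e_def[symmetric] using \<open>n < e\<close> by (intro inj_onI) (auto simp: w_def ordt)
    qed (use w a in auto)
  next
    case True
    show ?thesis
    proof
      assume eq: "w n = (\<Sum>i<n. a i * w i)"
      have sum: "f = (\<Sum>i<e. a i * t ^ i)"
        using eq True by (simp add: w_def)
      have "\<forall>i. \<exists>b. i < e \<longrightarrow> b \<in> G \<and> a i = sg b" using a True by auto
      then obtain b where b: "\<And>i. i < e \<Longrightarrow> b i \<in> G \<and> a i = sg (b i)"
        using choice[of "\<lambda>i b. i < e \<longrightarrow> b \<in> G \<and> a i = sg b"] by blast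
      have aF: "a i \<in> F" if "i < e" for i using b[OF that] sg_F by auto
      have ord: "ord_at P (a i * t ^ i) = int e * ord_at (\<phi> P) (b i) + int i" if i: "i < e" "a i \<noteq> 0" for i
      proof -
        have "b i \<noteq> 0" using b[of i] i by auto
        then show ?thesis
          using P.ord_mult[of "a i" "t ^ i"] aF[OF i(1)] i tF t ordt[of i] b[OF i(1)] ord_sg(1)[OF P, of "b i"]
          by (simp add: e_def)
      qed
      have inj: "inj_on (\<lambda>i. ord_at P (a i * t ^ i)) {i \<in> {..<e}. a i * t ^ i \<noteq> 0}"
      proof (rule inj_onI)
        fix i j assume ij: "i \<in> {i \<in> {..<e}. a i * t ^ i \<noteq> 0}" "j \<in> {i \<in> {..<e}. a i * t ^ i \<noteq> 0}"
          "ord_at P (a i * t ^ i) = ord_at P (a j * t ^ j)"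
        then have "(int e * ord_at (\<phi> P) (b i) + int i) mod int e = (int e * ord_at (\<phi> P) (b j) + int j) mod int e"
          using ord[of i] ord[of j] by simp
        then show "i = j" using ij by simp
      qed
      \<comment> \<open>No cancellation is possible, so each term has order at least that of f,
        hence at least e. As i < e, the coefficient must vanish at \<open>\<phi> P\<close>, which is
        also \<open>\<phi> P'\<close>. Then f vanishes at P', a contradiction.\<close>
      have "a i * t ^ i \<in> max_ideal P'" if i: "i < e" for i
      proof (cases "a i = 0")
        case False
        have "ord_at P f \<le> ord_at P (a i * t ^ i)"
          unfolding sum
          by (rule P.ord_sum_distinct(2)[OF _ _ _ _ inj]) (use i False aF tF t in auto)
        then have *: "int e \<le> int e * ord_at (\<phi> P) (b i) + int i" using ord[OF i False] f(3) by (simp add: e_def)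
        have "ord_at (\<phi> P) (b i) > 0"
        proof (rule ccontr)
          assume "\<not> ?thesis"
          then have "int e * ord_at (\<phi> P) (b i) \<le> 0" by (simp add: mult_nonneg_nonpos)
          then show False using * i by simp
        qed
        moreover have "b i \<noteq> 0" "b i \<in> G" using False b[OF i] by auto
        moreover obtain u where "local_parameter K G (\<phi> P) u"
          using D.local_parameter_exists \<phi>_points[OF P] by blast
        ultimately have "b i \<in> max_ideal (\<phi> P')"
          using local_parameter.mem_M_iff_ord P'(2) by metis
        then have "a i \<in> max_ideal P'" using sg_max_ideal_iff[OF P'(1)] b[OF i] by simp
        then show ?thesis using t by simp
      qed simp
      then have "f \<in> max_ideal P'" unfolding sum by (intro P'.M_sum) auto
      then show False using f by simp
    qed
  qed
  then have "R.independent (sg ` G) (map w (rev [0..<Suc e]))"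
    by (rule independent_rev_uptI[OF subfield_image])
  then have "length (map w (rev [0..<Suc e])) \<le> d"
    by (rule R.independent_length_le_dimension[OF subfield_image d]) (use w in auto)
  then show ?thesis by (simp add: e_def)
qed

end

section \<open>Existence of points\<close>

text \<open>With a the leading coefficient of q and b the constant one of q', the second relation
  times f^(n + 1) expresses (1 - b) f^(n + 1) by lower powers of f, namely as r(f). Multiplying q(f)
  = 1 by 1 - b and substituting removes the top term; the b that remains is moved to the constant
  term, so all coefficients stay in I.\<close>

lemma place_existence_step:
  fixes f :: "'f::field" and q q' :: "'f poly"
  assumes add: "\<And>a b. a \<in> I \<Longrightarrow> b \<in> I \<Longrightarrow> a + b \<in> I" and diff: "\<And>a b. a \<in> I \<Longrightarrow> b \<in> I \<Longrightarrow> a - b \<in> I"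
    and mult: "\<And>a b. a \<in> I \<Longrightarrow> b \<in> I \<Longrightarrow> a * b \<in> I" and zero: "0 \<in> I"
    and f: "f \<noteq> 0"
    and q: "\<And>i. coeff q i \<in> I" "degree q = Suc n" "poly q f = 1"
    and q': "\<And>i. coeff q' i \<in> I" "degree q' \<le> Suc n" "poly q' (inverse f) = 1"
  obtains q'' where "\<And>i. coeff q'' i \<in> I" "degree q'' \<le> n" "poly q'' f = 1"
proof -
  define a where "a = coeff q (Suc n)"
  define b where "b = coeff q' 0"
  define q1 where "q1 = q - monom a (Suc n)"
  define r where "r = (\<Sum>j=1..Suc n. monom (coeff q' j) (Suc n - j))"
  have sum_I: "(\<And>j. j \<in> J \<Longrightarrow> g j \<in> I) \<Longrightarrow> sum g J \<in> I" for g :: "nat \<Rightarrow> 'f" and J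
    by (induction J rule: infinite_finite_induct) (auto simp: zero add)
  have aI: "a \<in> I" "b \<in> I" using q q' by (auto simp: a_def b_def)
  have q1: "coeff q1 i \<in> I" for i
    using q(1) aI zero diff by (auto simp: q1_def a_def)
  have r: "coeff r i \<in> I" for i
    unfolding r_def coeff_sum by (rule sum_I) (use q' zero in auto)
  have degr: "degree r \<le> n"
    unfolding r_def by (rule degree_sum_le) (auto intro!: order_trans[OF degree_monom_le])
  have degq1: "degree q1 \<le> n"
  proof (rule degree_le, intro allI impI)
    fix i assume i: "n < i"
    show "coeff q1 i = 0"
      using i q(2) coeff_eq_0[of q i] by (cases "i = Suc n") (auto simp: q1_def a_def)
  qed
  have "poly q' (inverse f) = (\<Sum>j\<le>Suc n. coeff q' j * inverse f ^ j)"
    using q'(2) coeff_eq_0[of q'] unfolding poly_altdef by (intro sum.mono_neutral_left) auto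
  also have "\<dots> = b + (\<Sum>j=1..Suc n. coeff q' j * inverse f ^ j)"
    unfolding b_def by (subst sum.atMost_shift) (simp add: sum.atLeast1_atMost_eq flip: lessThan_Suc_atMost)
  finally have "1 - b = (\<Sum>j=1..Suc n. coeff q' j * inverse f ^ j)" using q'(3) by (simp add: algebra_simps)
  then have "(1 - b) * f ^ Suc n = (\<Sum>j=1..Suc n. coeff q' j * inverse f ^ j * f ^ Suc n)"
    by (simp only: sum_distrib_right)
  also have "\<dots> = poly r f"
    unfolding r_def poly_sum poly_monom
  proof (rule sum.cong[OF refl])
    fix j assume "j \<in> {1..Suc n}"
    then have "f ^ Suc n = f ^ (Suc n - j) * f ^ j" by (simp flip: power_add)
    then show "coeff q' j * inverse f ^ j * f ^ Suc n = coeff q' j * f ^ (Suc n - j)"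
      using f by (simp add: power_inverse)
  qed
  finally have r_eq: "(1 - b) * f ^ Suc n = poly r f" .
  define q'' where "q'' = [:b:] + q1 - smult b q1 + smult a r"
  show thesis
  proof (rule that)
    show "coeff q'' i \<in> I" for i
      using aI q1[of i] r[of i] zero by (cases i) (auto simp: q''_def add diff mult)
    have "degree (smult b q1) \<le> n" "degree (smult a r) \<le> n" "degree [:b:] \<le> n"
      using degq1 degr by (auto intro: order_trans[OF degree_smult_le])
    then show "degree q'' \<le> n" unfolding q''_def
      using degq1 by (intro degree_add_le degree_diff_le) auto
    have "poly q'' f = b + (1 - b) * poly q1 f + a * poly r f"
      by (simp add: q''_def algebra_simps)
    also have "\<dots> = b + (1 - b) * (poly q1 f + a * f ^ Suc n)"
      unfolding r_eq[symmetric] by (simp add: algebra_simps)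
    also have "poly q1 f + a * f ^ Suc n = 1"
      using q(3) by (simp add: q1_def poly_monom)
    finally show "poly q'' f = 1" by simp
  qed
qed

text \<open>
  A subring that is maximal among those in which \<open>u\<close> and \<open>v\<close> generate a proper ideal is a valuation
  ring: relations of minimal degree for \<open>f\<close> and for \<open>inverse f\<close> would shorten one another.
\<close>

lemma place_exists:
  fixes K F A :: "'f::field set"
  assumes K: "field_subset K" and F: "field_subset F"
    and A: "subring A ring_of_type_algebra" "K \<subseteq> A" "A \<subseteq> F"
    and uv: "u \<in> A" "v \<in> A" "u \<noteq> 0" "\<And>r s. r \<in> A \<Longrightarrow> s \<in> A \<Longrightarrow> u * r + v * s \<noteq> 1"
  obtains P where "P \<in> curve_points K F" "A \<subseteq> P" "u \<in> max_ideal P" "v \<in> max_ideal P"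
proof -
  interpret K: field_subset K by fact
  interpret F: field_subset F by fact
  \<comment> \<open>Two generators serve the affine points, with x - a and y - b; at infinity the
    choice will be u = 1 / x and v = 0.\<close>
  define fam where "fam = {R :: 'f set. subring R ring_of_type_algebra \<and> A \<subseteq> R \<and> R \<subseteq> F \<and>
     (\<forall>r\<in>R. \<forall>s\<in>R. u * r + v * s \<noteq> 1)}"
  have "\<exists>Q\<in>fam. \<forall>Q'\<in>fam. Q \<subseteq> Q' \<longrightarrow> Q' = Q"
  proof (rule subset_Zorn_nonempty)
    have "A \<in> fam" unfolding fam_def using A uv(4) by blast
    then show "fam \<noteq> {}" by blast
  next
    fix C assume C: "C \<noteq> {}" "subset.chain fam C"
    then have sub: "R \<in> fam" if "R \<in> C" for R using that by (auto simp: subset.chain_def)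
    have dir: "\<exists>R\<in>C. a \<in> R \<and> b \<in> R" if ab: "a \<in> \<Union>C" "b \<in> \<Union>C" for a b
    proof -
      obtain R S where RS: "R \<in> C" "a \<in> R" "S \<in> C" "b \<in> S" using ab by blast
      then have "R \<subseteq> S \<or> S \<subseteq> R" using C(2) by (auto simp: subset_chain_def)
      then show ?thesis using RS by blast
    qed
    have ring: "1 \<in> R" "a \<in> R \<Longrightarrow> - a \<in> R" "a \<in> R \<Longrightarrow> b \<in> R \<Longrightarrow> a + b \<in> R" "a \<in> R \<Longrightarrow> b \<in> R \<Longrightarrow> a * b \<in> R"
      if "R \<in> C" for R a b
      using sub[OF that] by (auto simp: fam_def subring_type_algebra_iff)
    have "subring (\<Union>C) ring_of_type_algebra"
      unfolding subring_type_algebra_iff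
    proof (intro conjI ballI)
      show "1 \<in> \<Union>C" using C(1) ring(1) by blast
      show "- a \<in> \<Union>C" if "a \<in> \<Union>C" for a using that ring(2) by blast
      show "a + b \<in> \<Union>C" "a * b \<in> \<Union>C" if "a \<in> \<Union>C" "b \<in> \<Union>C" for a b
        using dir[OF that] ring(3,4) by blast+
    qed
    moreover have "A \<subseteq> \<Union>C"
    proof -
      obtain R where "R \<in> C" using C(1) by blast
      then show ?thesis using sub[of R] by (auto simp: fam_def)
    qed
    moreover have "\<Union>C \<subseteq> F" using sub by (auto simp: fam_def)
    moreover have "\<forall>r\<in>\<Union>C. \<forall>s\<in>\<Union>C. u * r + v * s \<noteq> 1"
    proof (intro ballI)
      fix r s assume "r \<in> \<Union>C" "s \<in> \<Union>C"
      from dir[OF this] obtain R where "R \<in> C" "r \<in> R" "s \<in> R" by blast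
      then show "u * r + v * s \<noteq> 1" using sub[of R] by (auto simp: fam_def)
    qed
    ultimately show "\<Union>C \<in> fam" by (simp add: fam_def)
  qed
  then obtain P where P: "P \<in> fam" and max: "\<And>Q. Q \<in> fam \<Longrightarrow> P \<subseteq> Q \<Longrightarrow> Q = P" by blast
  have Pr: "subring P ring_of_type_algebra" "A \<subseteq> P" "P \<subseteq> F"
    and no1: "\<And>r s. r \<in> P \<Longrightarrow> s \<in> P \<Longrightarrow> u * r + v * s \<noteq> 1"
    using P by (auto simp: fam_def)
  have ring: "0 \<in> P" "1 \<in> P" "\<And>a. a \<in> P \<Longrightarrow> - a \<in> P" "\<And>a b. a \<in> P \<Longrightarrow> b \<in> P \<Longrightarrow> a + b \<in> P"
    "\<And>a b. a \<in> P \<Longrightarrow> b \<in> P \<Longrightarrow> a * b \<in> P"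
    using Pr(1) subringE(2)[OF Pr(1)] by (auto simp: subring_type_algebra_iff)
  have ring_diff: "a - b \<in> P" if "a \<in> P" "b \<in> P" for a b using ring(4)[OF that(1) ring(3)[OF that(2)]] by simp
  have ring_sum: "(\<And>j. j \<in> J \<Longrightarrow> g j \<in> P) \<Longrightarrow> sum g J \<in> P" for g :: "nat \<Rightarrow> 'f" and J
    by (induction J rule: infinite_finite_induct) (auto simp: ring)
  have uvP: "u \<in> P" "v \<in> P" using Pr uv by auto
  define I where "I = {u * r + v * s | r s. r \<in> P \<and> s \<in> P}"
  have I_I: "u * r + v * s \<in> I" if "r \<in> P" "s \<in> P" for r s using that by (auto simp: I_def)
  have I_P: "a \<in> P" if "a \<in> I" for a using that uvP ring by (auto simp: I_def)
  have I_smult: "a * b \<in> I" if "a \<in> I" "b \<in> P" for a b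
  proof -
    obtain r s where "r \<in> P" "s \<in> P" "a = u * r + v * s" using \<open>a \<in> I\<close> by (auto simp: I_def)
    then have "a * b = u * (r * b) + v * (s * b)" "r * b \<in> P" "s * b \<in> P"
      using ring \<open>b \<in> P\<close> by (auto simp: algebra_simps)
    then show ?thesis using I_I by metis
  qed
  have I_add: "a + b \<in> I" if ab: "a \<in> I" "b \<in> I" for a b
  proof -
    obtain r s r' s' where "r \<in> P" "s \<in> P" "a = u * r + v * s" "r' \<in> P" "s' \<in> P" "b = u * r' + v * s'"
      using ab by (auto simp: I_def)
    then have "a + b = u * (r + r') + v * (s + s')" "r + r' \<in> P" "s + s' \<in> P"
      using ring by (auto simp: algebra_simps)
    then show ?thesis using I_I by metis
  qed
  have I_diff: "a - b \<in> I" if "a \<in> I" "b \<in> I" for a b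
    using I_add[OF that(1) I_smult[OF that(2) ring(3)[OF ring(2)]]] by simp
  have I_0: "0 \<in> I" using I_I[OF ring(1) ring(1)] by simp
  have I_1: "1 \<notin> I" using no1 by (auto simp: I_def)
  \<comment> \<open>By maximality P[g] falls out of the family. A relation u r + v s = 1 with r, s
    in P[g] is a polynomial in g with coefficients in the ideal I.\<close>
  have relation: "\<exists>q. (\<forall>i. coeff q i \<in> I) \<and> poly q g = 1" if g: "g \<in> F" "g \<notin> P" for g
  proof -
    define S where "S = {poly q g | q. \<forall>i. coeff q i \<in> P}"
    have S_I: "poly q g \<in> S" if "\<And>i. coeff q i \<in> P" for q using that by (auto simp: S_def)
    have "P \<subseteq> S"
    proof
      fix a assume "a \<in> P"
      then have "coeff [:a:] i \<in> P" for i using ring by (cases i) auto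
      then have "poly [:a:] g \<in> S" by (rule S_I)
      then show "a \<in> S" by simp
    qed
    have "coeff [:0, 1:] i \<in> P" for i using ring by (auto simp: coeff_pCons split: nat.splits)
    then have "poly [:0, 1:] g \<in> S" by (rule S_I)
    then have gS: "g \<in> S" by simp
    have "subring S ring_of_type_algebra"
      unfolding subring_type_algebra_iff
    proof (intro conjI ballI)
      show "1 \<in> S" using ring \<open>P \<subseteq> S\<close> by auto
    next
      fix a assume "a \<in> S"
      then obtain q where q: "\<And>i. coeff q i \<in> P" "a = poly q g" by (auto simp: S_def)
      then have "poly (- q) g \<in> S" by (intro S_I) (simp add: ring)
      then show "- a \<in> S" using q by simp
    next
      fix a b assume "a \<in> S" "b \<in> S"
      then obtain q q' where q: "\<And>i. coeff q i \<in> P" "a = poly q g" "\<And>i. coeff q' i \<in> P" "b = poly q' g"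
        by (auto simp: S_def)
      have "poly (q + q') g \<in> S" by (intro S_I) (simp add: ring q)
      then show "a + b \<in> S" using q by simp
      have "poly (q * q') g \<in> S" unfolding coeff_mult by (intro S_I) (auto simp: coeff_mult intro!: ring_sum ring q)
      then show "a * b \<in> S" using q by simp
    qed
    moreover have "S \<subseteq> F"
      using Pr(3) g(1) by (auto simp: S_def poly_altdef intro!: F.closed_sum F.closed_basic(5) F.closed_power)
    moreover have "S \<noteq> P" using gS g by auto
    ultimately have "S \<notin> fam" using max[of S] \<open>P \<subseteq> S\<close> by auto
    then obtain r s where rs: "r \<in> S" "s \<in> S" "u * r + v * s = 1"
      using \<open>subring S _\<close> \<open>S \<subseteq> F\<close> \<open>P \<subseteq> S\<close> Pr by (auto simp: fam_def)
    then obtain q q' where q: "\<And>i. coeff q i \<in> P" "r = poly q g" "\<And>i. coeff q' i \<in> P" "s = poly q' g"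
      by (auto simp: S_def)
    then show ?thesis using rs I_I by (intro exI[of _ "smult u q + smult v q'"]) auto
  qed
  have val: "f \<in> P \<or> inverse f \<in> P" if "f \<in> F" for f
  proof (rule ccontr)
    assume not: "\<not> ?thesis"
    define T where "T g n \<longleftrightarrow> (\<exists>q. (\<forall>i. coeff q i \<in> I) \<and> degree q \<le> n \<and> poly q g = 1)" for g n
    have no_0: "\<not> T g 0" for g
    proof
      assume "T g 0"
      then obtain q where q: "\<And>i. coeff q i \<in> I" "degree q = 0" "poly q g = 1" by (auto simp: T_def)
      then have "coeff q 0 = 1" by (metis degree_0_id poly_0_coeff_0 poly_const_conv)
      then show False using q(1)[of 0] I_1 by simp
    qed
    have step: "T g n" if T: "T g (Suc n)" "T (inverse g) (Suc n)" and g: "g \<noteq> 0" for g n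
    proof -
      obtain q q' where q: "\<forall>i. coeff q i \<in> I" "degree q \<le> Suc n" "poly q g = 1"
        "\<forall>i. coeff q' i \<in> I" "degree q' \<le> Suc n" "poly q' (inverse g) = 1"
        using T by (auto simp: T_def)
      show ?thesis
      proof (cases "degree q = Suc n")
        case True
        have "\<exists>q''. (\<forall>i. coeff q'' i \<in> I) \<and> degree q'' \<le> n \<and> poly q'' g = 1"
          by (rule place_existence_step[of I g q n q'])
            (use I_add I_diff I_smult I_P I_0 g q True in \<open>auto simp del: degree_pCons_eq\<close>)
        then show ?thesis by (simp add: T_def)
      next
        case False
        then show ?thesis using q by (auto simp: T_def)
      qed
    qed
    have "f \<noteq> 0" using not ring(1) by auto
    have fF: "f \<in> F" "inverse f \<in> F" "f \<notin> P" "inverse f \<notin> P" using that not by auto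
    have ex: "\<exists>n. T f n \<and> T (inverse f) n"
    proof -
      obtain q q' where "\<forall>i. coeff q i \<in> I" "poly q f = 1" "\<forall>i. coeff q' i \<in> I" "poly q' (inverse f) = 1"
        using relation fF by metis
      then have "T f (max (degree q) (degree q')) \<and> T (inverse f) (max (degree q) (degree q'))"
        by (auto simp: T_def)
      then show ?thesis by blast
    qed
    \<comment> \<open>A least common degree bound for relations of f and of 1 / f;
      \<open>step\<close> lowers it for both.\<close>
    define n where "n = (LEAST n. T f n \<and> T (inverse f) n)"
    have n: "T f n" "T (inverse f) n" using LeastI_ex[OF ex] by (auto simp: n_def)
    then obtain m where m: "n = Suc m" using no_0 by (cases n) auto
    have "T f m" by (rule step) (use n m \<open>f \<noteq> 0\<close> in auto)
    moreover have "T (inverse f) m" by (rule step) (use n m \<open>f \<noteq> 0\<close> in auto)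
    ultimately have "n \<le> m" unfolding n_def by (intro Least_le) auto
    then show False using m by simp
  qed
  have notunit: "w \<in> max_ideal P" if "w \<in> I" for w
    unfolding max_ideal_def using that I_P I_smult[OF that, of "inverse w"] I_1 by (cases "w = 0") auto
  have uM: "u \<in> max_ideal P" "v \<in> max_ideal P"
    using notunit I_I[OF ring(2,1)] I_I[OF ring(1,2)] by auto
  show thesis
  proof (rule that)
    have "inverse u \<notin> P" using uM(1) uv(3) by (auto simp: max_ideal_def)
    then have *: "K \<noteq> P" "P \<noteq> F" using uvP(1) K.closed_basic(6)[of u] F.closed_basic(6)[of u] Pr(3) by blast+
    show "P \<in> curve_points K F"
      unfolding curve_points_def using Pr val A(2) * by auto
  qed (use Pr uM in auto)
qed

section \<open>The function field of \<open>y^p + c y = x^(p^k + 1)\<close>\<close>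

lemma comm_ring_hom_eval_map_poly:
  assumes "comm_ring_hom h" shows "comm_ring_hom (\<lambda>q. poly (map_poly h q) z)"
proof -
  interpret comm_ring_hom h by fact
  interpret map_poly_comm_ring_hom h ..
  show ?thesis by unfold_locales (auto simp: hom_distribs)
qed

text \<open>The ambient field enters only through two properties: x is transcendental over the
  constants, and every element is algebraic over the field generated by x.\<close>

locale artin_schreier =
  fixes cst :: "'k::alg_closed_field \<Rightarrow> 'f::field" and x y :: 'f and p k :: nat and c :: 'k
  assumes cst_hom: "comm_ring_hom cst"
    and x_trans: "poly (map_poly cst h) x = 0 \<Longrightarrow> h = 0"
    and algebraic: "\<exists>r. r \<noteq> 0 \<and> poly (map_poly (\<lambda>h. poly (map_poly cst h) x) r) f = 0"
    and p_prime: "prime p" and CHAR_k: "CHAR('k) = p"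
    and k_pos: "k > 0" and c_nz: "c \<noteq> 0"
    and equation: "y ^ p + cst c * y = x ^ (p ^ k + 1)"
begin

abbreviation N :: nat where "N \<equiv> p ^ k + 1"

text \<open>Elements of \<open>'k poly poly\<close> are read as polynomials in y with coefficients
  in k[x].\<close>

definition E :: "'k poly \<Rightarrow> 'f" where "E h = poly (map_poly cst h) x"

definition ev :: "'k poly poly \<Rightarrow> 'f" where "ev g = poly (map_poly E g) y"

definition F :: "'f set" where "F = generate_field ring_of_type_algebra (range cst \<union> {x, y})"

sublocale cst: comm_ring_hom cst by (rule cst_hom)

sublocale E: comm_ring_hom E
  unfolding E_def[abs_def] by (rule comm_ring_hom_eval_map_poly[OF cst_hom])

sublocale ev: comm_ring_hom ev
  unfolding ev_def[abs_def] by (rule comm_ring_hom_eval_map_poly[OF E.comm_ring_hom_axioms])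

lemma E_eq_0_iff [simp]: "E h = 0 \<longleftrightarrow> h = 0"
  using x_trans by (auto simp: E_def)

lemma cst_eq_0_iff [simp]: "cst a = 0 \<longleftrightarrow> a = 0"
  using x_trans[of "[:a:]"] by (auto simp: Polynomial.map_poly_pCons)

lemma cst_inj [simp]: "cst a = cst b \<longleftrightarrow> a = b"
  using cst_eq_0_iff[of "a - b"] by (simp add: cst.hom_minus del: cst_eq_0_iff)

lemma cst_inverse: "cst (inverse a) = inverse (cst a)"
  using inverse_unique[of "cst a" "cst (inverse a)"] cst.hom_mult[of a "inverse a"] by (cases "a = 0") auto

lemma E_const [simp]: "E [:a:] = cst a" by (simp add: E_def Polynomial.map_poly_pCons)
lemma E_pCons: "E (pCons a h) = cst a + x * E h" by (simp add: E_def Polynomial.map_poly_pCons)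
lemma E_x [simp]: "E [:0, 1:] = x" by (simp add: E_pCons)
lemma E_monom: "E (monom a n) = cst a * x ^ n" by (simp add: E_def poly_monom)
lemma E_sum: "E h = (\<Sum>i\<le>degree h. cst (coeff h i) * x ^ i)"
  by (subst (1) poly_as_sum_of_monoms[symmetric]) (simp add: E.hom_sum E_monom)

lemma ev_const [simp]: "ev [:h:] = E h" by (simp add: ev_def Polynomial.map_poly_pCons)
lemma ev_pCons: "ev (pCons h g) = E h + y * ev g" by (simp add: ev_def Polynomial.map_poly_pCons)
lemma ev_y [simp]: "ev [:0, 1:] = y" by (simp add: ev_pCons)
lemma ev_monom: "ev (monom h n) = E h * y ^ n" by (simp add: ev_def poly_monom)
lemma ev_sum: "ev g = (\<Sum>j\<le>degree g. E (coeff g j) * y ^ j)"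
  by (subst (1) poly_as_sum_of_monoms[symmetric]) (simp add: ev.hom_sum ev_monom)
lemma ev_smult: "ev (smult h g) = E h * ev g"
  using ev.hom_mult[of "[:h:]" g] by simp

lemma p_gt_1: "p > 1" using p_prime by (rule prime_gt_1_nat)

lemma x_nz [simp]: "x \<noteq> 0"
  using E_eq_0_iff[of "[:0,1:]"] by (simp del: E_eq_0_iff)

lemma y_nz [simp]: "y \<noteq> 0"
proof
  assume "y = 0"
  then have "x ^ (p ^ k + 1) = 0" using equation p_gt_1 zero_power[of p, where 'a = 'f] by simp
  then show False by simp
qed

lemma CHAR_f: "CHAR('f) = p"
proof (rule CHAR_eqI)
  show "of_nat p = (0 :: 'f)" using cst.hom_of_nat[of p] CHAR_k of_nat_CHAR[where 'a = 'k] by simp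
next
  fix n assume "of_nat n = (0 :: 'f)"
  then have "cst (of_nat n) = 0" by (simp add: cst.hom_of_nat)
  then show "p dvd n" using CHAR_k of_nat_eq_0_iff_char_dvd[where 'a = 'k] by simp
qed

lemma frobenius: "(a + b :: 'f) ^ (p ^ n) = a ^ (p ^ n) + b ^ (p ^ n)"
  by (rule freshmans_dream') (use CHAR_f p_prime in auto)

lemma frobenius_diff: "(a - b :: 'f) ^ p = a ^ p - b ^ p"
  using frobenius[of "a - b" b 1] by simp

lemma subfield_constants: "subfield (range cst) ring_of_type_algebra"
proof -
  have "1 \<in> range cst" using cst.hom_one by (metis rangeI)
  then show ?thesis
    unfolding subfield_type_algebra_iff subring_type_algebra_iff
    by (auto simp flip: cst.hom_add cst.hom_mult cst.hom_uminus cst_inverse)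
qed

lemma subfield_F: "subfield F ring_of_type_algebra"
proof -
  interpret field "ring_of_type_algebra :: 'f ring" by (rule field_from_type_algebra)
  show ?thesis
    unfolding F_def by (rule generate_field_is_subfield) simp
qed

sublocale K: field_subset "range cst" by (rule field_subset.intro[OF subfield_constants])

sublocale F: field_subset F by (rule field_subset.intro[OF subfield_F])

lemma cst_F [simp]: "cst a \<in> F" and x_F [simp]: "x \<in> F" and y_F [simp]: "y \<in> F"
  unfolding F_def by (auto intro: generate_field.incl)

lemma E_F [simp]: "E h \<in> F"
  unfolding E_sum by (rule F.closed_sum) simp

lemma ev_F [simp]: "ev g \<in> F"
  unfolding ev_sum by (rule F.closed_sum) simp

abbreviation points where "points \<equiv> curve_points (range cst) F"

definition rel :: "'k poly poly" where
  "rel = monom 1 p + [:- monom 1 N, [:c:]:]"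

lemma ev_rel [simp]: "ev rel = 0"
  using equation by (simp add: rel_def ev.hom_add ev_monom ev_pCons E_monom E.hom_uminus algebra_simps)

lemma degree_rel_aux: "degree [:- monom 1 N, [:c:]:] < p"
  using p_gt_1 by (auto intro: le_less_trans[OF degree_pCons_le])

lemma coeff_rel: "coeff rel p = 1" "degree rel \<le> p"
  using degree_rel_aux coeff_eq_0[OF degree_rel_aux]
  by (auto simp: rel_def intro!: degree_add_le degree_monom_le)

text \<open>Long division by \<open>rel\<close>, which is monic in y, so that coefficients from k[x]
  need not be inverted.\<close>

lemma reduce: "\<exists>q r. g = q * rel + r \<and> degree r < p"
proof (induction g)
  case 0
  then show ?case using p_gt_1 by (intro exI[of _ 0]) auto
next
  case (pCons a g)
  then obtain q r where qr: "g = q * rel + r" "degree r < p" by blast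
  define b where "b = coeff (pCons a r) p"
  define r' where "r' = pCons a r - smult b rel"
  have "degree (pCons a r) \<le> p" using qr(2) by (intro order_trans[OF degree_pCons_le]) simp
  then have "degree r' \<le> p" unfolding r'_def
    using coeff_rel(2) by (intro degree_diff_le order_trans[OF degree_smult_le])
  moreover have "coeff r' p = 0" by (simp add: r'_def b_def coeff_rel)
  ultimately have "degree r' < p"
    using p_gt_1 eq_zero_or_degree_less[of r' p] by (auto simp: le_less)
  moreover have "pCons a g = (pCons 0 q + [:b:]) * rel + r'"
    by (simp add: r'_def qr(1) algebra_simps)
  ultimately show ?case by blast
qed

lemma reduce_ev: obtains r where "ev g = ev r" "degree r < p"
  using reduce[of g] by (metis add_0 ev.hom_add ev.hom_mult ev_rel mult_zero_right)

text \<open>As f is nonzero, factors of the variable can be cancelled from any relation.\<close>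

lemma algebraic_relation:
  assumes "f \<noteq> 0"
  obtains r where "poly (map_poly E r) f = 0" "coeff r 0 \<noteq> 0"
proof -
  have "\<exists>r. poly (map_poly E r) f = 0 \<and> coeff r 0 \<noteq> 0" if "r \<noteq> 0" "poly (map_poly E r) f = 0" for r
    using that
  proof (induction r)
    case (pCons a r)
    show ?case
    proof (cases "a = 0")
      case True
      then have "poly (map_poly E r) f = 0" "r \<noteq> 0" using pCons assms by auto
      then show ?thesis using pCons.IH by blast
    next
      case False
      then show ?thesis using pCons.prems by (intro exI[of _ "pCons a r"]) auto
    qed
  qed simp
  then show thesis using algebraic[of f] that unfolding E_def[abs_def] by metis
qed

text \<open>A relation a + f r'(f) = 0 for f = \<open>ev g\<close> exhibits f as a divisor of the
  nonzero polynomial a in x. Hence denominators in the function field can be taken in k[x].\<close>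

lemma algebraic_multiple:
  assumes "ev g \<noteq> 0"
  obtains g' h where "h \<noteq> 0" "ev g * ev g' = E h"
proof -
  obtain r where r: "poly (map_poly E r) (ev g) = 0" "coeff r 0 \<noteq> 0"
    using algebraic_relation[OF assms] .
  obtain a r' where ar: "r = pCons a r'" by (cases r)
  have in_range: "poly (map_poly E q) (ev g) \<in> range ev" for q
  proof (induction q)
    case 0
    then show ?case using ev.hom_zero by (metis map_poly_0 poly_0 rangeI)
  next
    case (pCons a q)
    then obtain g' where "poly (map_poly E q) (ev g) = ev g'" by auto
    then have "poly (map_poly E (pCons a q)) (ev g) = ev ([:a:] + g * g')"
      using pCons.hyps by (simp add: ev.hom_add ev.hom_mult)
    then show ?case by simp
  qed
  obtain g' where g': "poly (map_poly E r') (ev g) = ev g'" using in_range by blast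
  have "ev g * ev (- g') = E a" using r(1) ar g'
    by (cases "pCons a r' = 0") (auto simp: ev.hom_uminus add_eq_0_iff Polynomial.map_poly_pCons)
  then show thesis using that[of a "- g'"] r(2) ar by auto
qed

lemma F_eq: "F = {ev g / E h | g h. h \<noteq> 0}"
proof
  define S where "S = {ev g / E h | g h. h \<noteq> 0}"
  have S_I: "ev g / E h \<in> S" if "h \<noteq> 0" for g h using that by (auto simp: S_def)
  have S_ev: "ev g \<in> S" for g using S_I[of 1 g] by simp
  interpret field "ring_of_type_algebra :: 'f ring" by (rule field_from_type_algebra)
  have "subfield S ring_of_type_algebra"
    unfolding subfield_type_algebra_iff subring_type_algebra_iff
  proof (intro conjI ballI)
    show "1 \<in> S" using S_ev[of 1] by simp
  next
    fix a assume "a \<in> S"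
    then obtain g h where gh: "a = ev g / E h" "h \<noteq> 0" by (auto simp: S_def)
    then have "- a = ev (- g) / E h" by (simp add: ev.hom_uminus)
    then show "- a \<in> S" using S_I gh by metis
    show "inverse a \<in> S"
    proof (cases "ev g = 0")
      case True
      then show ?thesis using gh S_ev[of 0] by simp
    next
      case False
      then obtain g' h' where g': "h' \<noteq> 0" "ev g * ev g' = E h'" using algebraic_multiple by blast
      then have "ev g' \<noteq> 0" by auto
      have "inverse a = E h / ev g" using gh by simp
      also have "\<dots> = ev (smult h g') / E h'"
        unfolding g'(2)[symmetric] ev_smult using False \<open>ev g' \<noteq> 0\<close> by (simp add: field_simps)
      finally show ?thesis using S_I g' by metis
    qed
  next
    fix a b assume "a \<in> S" "b \<in> S"
    then obtain g h g' h' where gh: "a = ev g / E h" "h \<noteq> 0" "b = ev g' / E h'" "h' \<noteq> 0"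
      by (auto simp: S_def)
    then have "a + b = ev (smult h' g + smult h g') / E (h * h')" "a * b = ev (g * g') / E (h * h')"
      by (simp_all add: ev.hom_add ev.hom_mult ev_smult E.hom_mult add_divide_distrib mult.commute)
    then show "a + b \<in> S" "a * b \<in> S" using S_I gh by (metis no_zero_divisors)+
  qed
  moreover have "range cst \<union> {x, y} \<subseteq> S"
    using S_ev[of "[:0,1:]"] S_ev[of "[:[:0,1:]:]"] S_ev[of "[:[:a:]:]" for a] by auto
  ultimately show "F \<subseteq> {ev g / E h | g h. h \<noteq> 0}"
    unfolding F_def S_def by (intro generate_field_min_subfield1) auto
next
  show "{ev g / E h | g h. h \<noteq> 0} \<subseteq> F" by auto
qed

lemma F_reduced:
  assumes "f \<in> F" obtains g h where "f = ev g / E h" "h \<noteq> 0" "degree g < p"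
proof -
  obtain g h where gh: "f = ev g / E h" "h \<noteq> 0" using assms unfolding F_eq by blast
  obtain r where "ev g = ev r" "degree r < p" by (rule reduce_ev)
  then show thesis using that gh by metis
qed

text \<open>Applied to the ring K[1 / x]: there 1 / x is not invertible, because 1 / x is
  transcendental, as reversing the coefficients of a relation shows.\<close>

lemma place_at_infinity_exists: "\<exists>P\<in>points. x \<notin> P"
proof -
  define A where "A = range (\<lambda>h. poly (map_poly cst h) (inverse x))"
  interpret A: comm_ring_hom "\<lambda>h. poly (map_poly cst h) (inverse x)"
    by (rule comm_ring_hom_eval_map_poly[OF cst_hom])
  have A_I: "poly (map_poly cst h) (inverse x) \<in> A" for h by (auto simp: A_def)
  have A_0: "h = 0" if "poly (map_poly cst h) (inverse x) = 0" for h
  proof -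
    have "reflect_poly (map_poly cst h) = map_poly cst (reflect_poly h)"
      by (rule poly_eqI) (auto simp: coeff_reflect_poly coeff_map_poly degree_map_poly)
    moreover have "poly (reflect_poly (map_poly cst h)) x = 0"
      using that by (simp add: poly_reflect_poly_nz)
    ultimately have "reflect_poly h = 0" using x_trans by metis
    then show ?thesis by simp
  qed
  have "subring A ring_of_type_algebra"
    unfolding subring_type_algebra_iff
    using A_I[of 1] by (auto simp: A_def simp flip: A.hom_add A.hom_mult A.hom_uminus)
  moreover have "range cst \<subseteq> A"
  proof
    fix a assume "a \<in> range cst"
    then obtain a' where "a = cst a'" by blast
    then show "a \<in> A" using A_I[of "[:a':]"] by (simp add: Polynomial.map_poly_pCons)
  qed
  moreover have "A \<subseteq> F"
    by (auto simp: A_def poly_altdef coeff_map_poly intro!: F.closed_sum)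
  moreover have "inverse x \<in> A" using A_I[of "[:0,1:]"] by simp
  moreover have "0 \<in> A" using A_I[of 0] by simp
  moreover have "inverse x * r + 0 * s \<noteq> 1" if rA: "r \<in> A" for r s
  proof
    assume *: "inverse x * r + 0 * s = 1"
    obtain h where h: "r = poly (map_poly cst h) (inverse x)" using rA by (auto simp: A_def)
    have "poly (map_poly cst (pCons 0 h - 1)) (inverse x) = 0"
      using * h by (simp add: A.hom_minus) (simp add: Polynomial.map_poly_pCons)
    then have "pCons 0 h = 1" using A_0 by force
    then show False by (metis coeff_pCons_0 one_pCons zero_neq_one)
  qed
  ultimately obtain P where P: "P \<in> points" "inverse x \<in> max_ideal P"
    using place_exists[OF K.field_subset_axioms F.field_subset_axioms, of A "inverse x" 0] by (metis inverse_nonzero_iff_nonzero x_nz)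
  then have "x \<notin> P" by (auto simp: max_ideal_def)
  then show ?thesis using P by blast
qed

text \<open>The weighted degree in which x counts p and y counts N. For g of y-degree below p it is
  the pole order of \<open>ev g\<close> at infinity; on the zero polynomial it has no
  meaning.\<close>

definition wt :: "'k poly poly \<Rightarrow> nat" where
  "wt g = Max ((\<lambda>j. p * degree (coeff g j) + N * j) ` {j. coeff g j \<noteq> 0})"

lemma finite_coeffs: "finite {j. coeff g j \<noteq> 0}"
  by (rule finite_subset[of _ "{..degree g}"]) (auto intro: le_degree)

lemma wt_ge: "coeff g j \<noteq> 0 \<Longrightarrow> p * degree (coeff g j) + N * j \<le> wt g"
  unfolding wt_def by (rule Max_ge) (use finite_coeffs in auto)

lemma wt_attained:
  assumes "g \<noteq> 0" obtains j where "coeff g j \<noteq> 0" "wt g = p * degree (coeff g j) + N * j"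
proof -
  have "coeff g (degree g) \<noteq> 0" using assms by simp
  then have "(\<lambda>j. p * degree (coeff g j) + N * j) ` {j. coeff g j \<noteq> 0} \<noteq> {}" by blast
  from Max_in[OF _ this] show thesis using finite_coeffs that by (auto simp: wt_def)
qed

lemma wt_const: "h \<noteq> 0 \<Longrightarrow> wt [:h:] = p * degree h"
proof -
  assume "h \<noteq> 0"
  then have "coeff [:h:] j \<noteq> 0 \<longleftrightarrow> j = 0" for j by (cases j) auto
  then have "{j. coeff [:h:] j \<noteq> 0} = {0}" by simp
  then show ?thesis by (simp add: wt_def)
qed

lemma N_mod: "N * j mod p = j mod p"
proof -
  obtain k' where "k = Suc k'" using k_pos by (cases k) auto
  then have "N * j = j + p * (p ^ k' * j)" by (simp add: algebra_simps)
  then show ?thesis by (metis mod_mult_self2)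
qed

text \<open>N is 1 modulo p, so for exponents of y below p the weight modulo p reveals the exponent
  of y.\<close>

lemma weights_distinct:
  assumes "p * a + N * i = p * b + N * j" "i < p" "j < p"
  shows "i = j" "a = b"
proof -
  have "(p * a + N * i) mod p = i" "(p * b + N * j) mod p = j"
    using N_mod assms(2,3) by (metis mod_mult_self4 mod_less)+
  then show "i = j" using assms(1) by metis
  then show "a = b" using assms(1) p_gt_1 by simp
qed

end

subsection \<open>The point at infinity\<close>

locale as_place = artin_schreier + place "range cst" F P for P

locale as_infinity = as_place + assumes x_notin: "x \<notin> P"
begin

text \<open>\<open>t\<close> is a uniformizer since \<open>p\<^sup>k + 1 - p \<cdot> p\<^sup>k\<^sup>-\<^sup>1 = 1\<close>.\<close>

definition t where "t = x ^ (p ^ (k - 1)) / y"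

text \<open>The 1-units. Working modulo them preserves leading coefficients exactly, which the
  expansions below must produce.\<close>

definition U1 where "U1 = {f \<in> P. f - 1 \<in> M}"

lemma U1_mult: assumes "f \<in> U1" "g \<in> U1" shows "f * g \<in> U1"
proof -
  have "f * (g - 1) + (f - 1) \<in> M" using assms by (simp add: U1_def)
  then show ?thesis using assms by (simp add: U1_def algebra_simps)
qed

lemma U1_power: "f \<in> U1 \<Longrightarrow> f ^ n \<in> U1"
  by (induction n) (simp add: U1_def, simp add: U1_mult)

lemma inverse_x_M: "inverse x \<in> M"
  using inverse_in_M[OF x_F x_notin] .

lemma y_notin: "y \<notin> P"
proof
  assume "y \<in> P"
  then have "x ^ N \<in> P" unfolding equation[symmetric] by simp
  moreover have "inverse x ^ N \<in> M" by (rule M_power[OF inverse_x_M]) simp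
  ultimately have "x ^ N * inverse x ^ N \<in> M" by (rule M_mult)
  then show False by (simp only: power_mult_distrib[symmetric]) simp
qed

lemma inverse_y_M: "inverse y \<in> M"
  using inverse_in_M[OF y_F y_notin] .

lemma t_F: "t \<in> F" and t_nz: "t \<noteq> 0"
  by (simp_all add: t_def)

lemma p_pow_k: "p ^ k = p * p ^ (k - 1)"
  using k_pos by (cases k) auto

text \<open>By the equation x t^p = x^N / y^p = 1 + c y^(1 - p), and y has a pole.\<close>

lemma xt: "x * t ^ p \<in> U1"
proof -
  have "x * t ^ p = x ^ N / y ^ p"
    by (simp add: t_def power_divide flip: power_mult p_pow_k) (simp add: p_pow_k mult.commute)
  also have "\<dots> = 1 + cst c * inverse y ^ (p - 1)"
    using p_gt_1 unfolding equation[symmetric] by (cases p) (simp_all add: field_simps)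
  finally have "x * t ^ p - 1 = cst c * inverse y ^ (p - 1)" by simp
  moreover have "\<dots> \<in> M" using M_power[OF inverse_y_M, of "p - 1"] p_gt_1 by simp
  ultimately have "x * t ^ p - 1 \<in> M" by simp
  then have "x * t ^ p - 1 + 1 \<in> P" by (intro P_basic(4)) auto
  then show ?thesis using \<open>x * t ^ p - 1 \<in> M\<close> by (simp add: U1_def)
qed

lemma t_M: "t \<in> M"
proof -
  have "t ^ p = inverse x * (x * t ^ p)" by simp
  also have "\<dots> \<in> M" using inverse_x_M xt by (intro M_mult') (auto simp: U1_def)
  finally have tp: "t ^ p \<in> M" .
  have "t \<in> P"
  proof (rule ccontr)
    assume "t \<notin> P"
    then have "inverse t \<in> M" using t_F inverse_in_M by blast
    then have "t ^ p * inverse t ^ p \<in> M" using tp p_gt_1 by (intro M_mult') auto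
    then show False using t_nz by (simp flip: power_mult_distrib)
  qed
  then show ?thesis using M_power_iff[of t p] tp p_gt_1 by simp
qed

lemma t_P [simp]: "t \<in> P" using t_M by simp

text \<open>Since y t = x^(p^(k - 1)), the product y t^N is the p^(k - 1)-th power of x t^p.\<close>

lemma yt: "y * t ^ N \<in> U1"
proof -
  have "y * t ^ N = y * t * t ^ (p ^ k)" by simp
  also have "y * t = x ^ (p ^ (k - 1))" by (simp add: t_def)
  also have "t ^ (p ^ k) = (t ^ p) ^ (p ^ (k - 1))" by (simp only: p_pow_k power_mult)
  also have "x ^ (p ^ (k - 1)) * (t ^ p) ^ (p ^ (k - 1)) = (x * t ^ p) ^ (p ^ (k - 1))"
    by (simp add: power_mult_distrib)
  finally show ?thesis using U1_power[OF xt] by simp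
qed

lemma E_expansion:
  assumes "h \<noteq> 0"
  shows "E h * t ^ (p * degree h) - cst (lead_coeff h) \<in> M"
proof -
  define n where "n = degree h"
  have "E h * t ^ (p * n) = (\<Sum>i\<le>n. cst (coeff h i) * x ^ i) * t ^ (p * n)"
    by (simp add: E_sum n_def)
  also have "\<dots> = (\<Sum>i\<le>n. cst (coeff h i) * (x * t ^ p) ^ i * t ^ (p * (n - i)))"
    unfolding sum_distrib_right
  proof (rule sum.cong[OF refl])
    fix i assume "i \<in> {..n}"
    then have "p * n = p * i + p * (n - i)" by (simp flip: distrib_left)
    then have "t ^ (p * n) = (t ^ p) ^ i * t ^ (p * (n - i))" by (simp only: power_add power_mult)
    then show "cst (coeff h i) * x ^ i * t ^ (p * n) = cst (coeff h i) * (x * t ^ p) ^ i * t ^ (p * (n - i))"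
      by (simp add: power_mult_distrib)
  qed
  also have "\<dots> = (\<Sum>i<n. cst (coeff h i) * (x * t ^ p) ^ i * t ^ (p * (n - i))) + cst (coeff h n) * (x * t ^ p) ^ n"
    unfolding lessThan_Suc_atMost[symmetric] by simp
  finally have eq: "E h * t ^ (p * n) - cst (coeff h n) =
     (\<Sum>i<n. cst (coeff h i) * (x * t ^ p) ^ i * t ^ (p * (n - i))) + cst (coeff h n) * ((x * t ^ p) ^ n - 1)"
    by (simp add: algebra_simps)
  have xtP: "x * t ^ p \<in> P" using xt by (simp add: U1_def)
  have "(\<Sum>i<n. cst (coeff h i) * (x * t ^ p) ^ i * t ^ (p * (n - i))) \<in> M"
  proof (rule M_sum)
    fix i assume "i \<in> {..<n}"
    then have "t ^ (p * (n - i)) \<in> M" using p_gt_1 by (intro M_power[OF t_M]) auto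
    then show "cst (coeff h i) * (x * t ^ p) ^ i * t ^ (p * (n - i)) \<in> M"
      by (intro M_mult P_basic(5) P_power xtP) auto
  qed
  moreover have "cst (coeff h n) * ((x * t ^ p) ^ n - 1) \<in> M"
    using U1_power[OF xt, of n] by (intro M_mult) (auto simp: U1_def)
  ultimately show ?thesis unfolding n_def[symmetric] eq by (rule M_add)
qed

lemma monomial_expansion:
  assumes "h \<noteq> 0"
  shows "E h * y ^ j * t ^ (p * degree h + N * j) - cst (lead_coeff h) \<in> M"
proof -
  define a where "a = E h * t ^ (p * degree h)"
  define u where "u = (y * t ^ N) ^ j"
  have u: "u \<in> P" "u - 1 \<in> M" using U1_power[OF yt, of j] by (auto simp: u_def U1_def)
  have a: "a - cst (lead_coeff h) \<in> M" using E_expansion[OF assms] by (simp add: a_def)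
  have "E h * y ^ j * t ^ (p * degree h + N * j) = a * u"
    using power_add[of t "p * degree h" "N * j"] power_mult[of t N j]
    unfolding a_def u_def power_mult_distrib by (simp only: mult_ac)
  also have "a * u - cst (lead_coeff h) = (a - cst (lead_coeff h)) * u + cst (lead_coeff h) * (u - 1)"
    by (simp add: algebra_simps)
  also have "\<dots> \<in> M" using a u by (intro M_add M_mult' M_mult) auto
  finally show ?thesis .
qed

text \<open>Weights of distinct powers of y differ, so one coefficient attains the maximum; every
  other term keeps a positive power of t after multiplication by t^(wt g).\<close>

lemma ev_expansion:
  assumes "g \<noteq> 0" "degree g < p"
  obtains a where "a \<noteq> 0" "ev g * t ^ wt g - cst a \<in> M"
proof -
  obtain j where j: "coeff g j \<noteq> 0" "wt g = p * degree (coeff g j) + N * j"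
    using wt_attained[OF assms(1)] .
  have jle: "j \<le> degree g" using j le_degree by blast
  let ?T = "\<lambda>i. E (coeff g i) * y ^ i * t ^ wt g"
  have "?T i \<in> M" if i: "i \<le> degree g" "i \<noteq> j" for i
  proof (cases "coeff g i = 0")
    case False
    define w where "w = p * degree (coeff g i) + N * i"
    have "w \<noteq> wt g"
      using weights_distinct(1)[of "degree (coeff g i)" i "degree (coeff g j)" j] i jle assms(2) j(2)
      by (auto simp: w_def)
    then have "w < wt g" using wt_ge[OF False] by (simp add: w_def)
    then have "?T i = (E (coeff g i) * y ^ i * t ^ w) * t ^ (wt g - w)"
      by (simp add: mult.assoc flip: power_add)
    moreover have "E (coeff g i) * y ^ i * t ^ w \<in> P"
      using P_basic(4)[OF M_sub[OF monomial_expansion[OF False, of i]], of "cst (lead_coeff (coeff g i))"]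
      by (simp add: w_def)
    moreover have "t ^ (wt g - w) \<in> M" using \<open>w < wt g\<close> by (intro M_power[OF t_M]) auto
    ultimately show ?thesis using M_mult by metis
  qed (simp)
  then have "sum ?T ({..degree g} - {j}) \<in> M" by (intro M_sum) auto
  moreover have "?T j - cst (lead_coeff (coeff g j)) \<in> M"
    using monomial_expansion[OF j(1), of j] j(2) by simp
  ultimately have "(?T j - cst (lead_coeff (coeff g j))) + sum ?T ({..degree g} - {j}) \<in> M" by simp
  moreover have "ev g * t ^ wt g = ?T j + sum ?T ({..degree g} - {j})"
    unfolding ev_sum sum_distrib_right using jle by (intro sum.remove) auto
  ultimately have "ev g * t ^ wt g - cst (lead_coeff (coeff g j)) \<in> M" by (simp add: algebra_simps)
  then show thesis using that[of "lead_coeff (coeff g j)"] j(1) by simp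
qed

lemma ev_unit_expansion:
  assumes "g \<noteq> 0" "degree g < p"
  obtains u where "u \<in> P - M" "ev g = u * t powi (- int (wt g))"
proof -
  obtain a where a: "a \<noteq> 0" "ev g * t ^ wt g - cst a \<in> M" using ev_expansion[OF assms] .
  have "cst a + (ev g * t ^ wt g - cst a) \<in> P - M"
    by (rule unit_add[OF const_unit]) (use a in auto)
  then show thesis
    using that[of "ev g * t ^ wt g"] t_nz by (simp add: power_int_minus field_simps)
qed

lemma ev_reduced_nz: "g \<noteq> 0 \<Longrightarrow> degree g < p \<Longrightarrow> ev g \<noteq> 0"
  using ev_expansion[of g] const_unit by (metis cst_eq_0_iff diff_0 M_uminus add.inverse_inverse const_in_M_iff mult_zero_left rangeI)

lemma local_parameter_t: "local_parameter (range cst) F P t"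
proof
  show "t \<in> max_ideal P" "t \<noteq> 0" by (rule t_M, rule t_nz)
next
  fix f assume f: "f \<in> F" "f \<noteq> 0"
  obtain g h where gh: "f = ev g / E h" "h \<noteq> 0" "degree g < p" using F_reduced[OF f(1)] .
  have "g \<noteq> 0" using gh f by auto
  obtain a where a: "a \<noteq> 0" "ev g * t ^ wt g - cst a \<in> M" using ev_expansion[OF \<open>g \<noteq> 0\<close> gh(3)] .
  have "[:h:] \<noteq> 0" "degree [:h:] < p" using gh p_gt_1 by auto
  then obtain b where b: "b \<noteq> 0" "ev [:h:] * t ^ wt [:h:] - cst b \<in> M" using ev_expansion by blast
  have "f = t powi (int (wt [:h:]) - int (wt g)) * ((ev g * t ^ wt g) / (ev [:h:] * t ^ wt [:h:]))"
    using gh t_nz by (simp add: power_int_diff field_simps)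
  moreover have "(ev g * t ^ wt g) / (ev [:h:] * t ^ wt [:h:]) - cst a / cst b \<in> M"
    by (rule quotient_residue) (use a b in auto)
  ultimately show "\<exists>n. \<exists>a\<in>range cst. \<exists>e\<in>max_ideal P. a \<noteq> 0 \<and> f = t powi n * (a + e)"
    using a b by (intro exI[of _ "int (wt [:h:]) - int (wt g)"] bexI[of _ "cst a / cst b"]
      bexI[of _ "(ev g * t ^ wt g) / (ev [:h:] * t ^ wt [:h:]) - cst a / cst b"]) auto
qed

sublocale local_parameter "range cst" F P t by (rule local_parameter_t)

lemma ord_ev: "g \<noteq> 0 \<Longrightarrow> degree g < p \<Longrightarrow> ord_at P (ev g) = - int (wt g)"
  using ev_unit_expansion[of g] ord_at_eq by metis

lemma ord_E: "h \<noteq> 0 \<Longrightarrow> ord_at P (E h) = - int (p * degree h)"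
  using ord_ev[of "[:h:]"] wt_const[of h] p_gt_1 by simp

text \<open>The criterion does not mention P, so there is at most one point at which x has a
  pole.\<close>

lemma mem_iff:
  assumes "g \<noteq> 0" "degree g < p" "h \<noteq> 0"
  shows "ev g / E h \<in> P \<longleftrightarrow> wt g \<le> p * degree h"
proof -
  have "ord_at P (ev g / E h) = int (p * degree h) - int (wt g)"
    unfolding divide_inverse
    using ord_mult[of "ev g" "inverse (E h)"] ord_inverse[of "E h"] ord_ev[of g] ord_E[of h] ev_reduced_nz[of g] assms
    by simp
  moreover have "ev g / E h \<noteq> 0" "ev g / E h \<in> F" using ev_reduced_nz[of g] assms by auto
  ultimately show ?thesis using mem_P_iff_ord[of "ev g / E h"] by (metis diff_ge_0_iff_ge of_nat_le_iff)
qed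

end

section \<open>Uniqueness of the point at infinity and the kernel of evaluation\<close>

context artin_schreier begin

lemma as_infinityI: "P \<in> points \<Longrightarrow> x \<notin> P \<Longrightarrow> as_infinity cst x y p k c P"
  by unfold_locales

lemma infinity_unique:
  assumes "P \<in> points" "x \<notin> P" "P' \<in> points" "x \<notin> P'"
  shows "P = P'"
proof -
  interpret P: as_infinity cst x y p k c P using as_infinityI assms by blast
  interpret P': as_infinity cst x y p k c P' using as_infinityI assms by blast
  have "f \<in> P \<longleftrightarrow> f \<in> P'" if f: "f \<in> F" for f
  proof -
    obtain g h where gh: "f = ev g / E h" "h \<noteq> 0" "degree g < p" using F_reduced[OF f] .
    then show ?thesis using P.mem_iff[of g h] P'.mem_iff[of g h] by (cases "g = 0") auto
  qed
  then show ?thesis using P.in_F P'.in_F by blast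
qed

text \<open>Independence of 1, y, ..., y^(p - 1) over K(x) is read off from the orders at infinity;
  no separate irreducibility proof for the equation is needed.\<close>

lemma ev_reduced_eq_0: "degree g < p \<Longrightarrow> ev g = 0 \<Longrightarrow> g = 0"
  using place_at_infinity_exists as_infinity.ev_reduced_nz[OF as_infinityI] by blast

lemma ev_eq_0_iff_rel: "ev g = 0 \<longleftrightarrow> rel dvd g"
proof
  assume "ev g = 0"
  obtain q r where qr: "g = q * rel + r" "degree r < p" using reduce by blast
  then have "ev r = 0" using \<open>ev g = 0\<close> by (simp add: ev.hom_add ev.hom_mult)
  then have "r = 0" using ev_reduced_eq_0 qr by blast
  then show "rel dvd g" using qr by simp
next
  assume "rel dvd g"
  then show "ev g = 0" by (auto simp: dvd_def ev.hom_mult)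
qed

text \<open>y is integral over K[x]: if y had a pole, dividing the equation by y^p would put 1 into
  the maximal ideal.\<close>

lemma y_in_if_x_in:
  assumes "P \<in> points" "x \<in> P" shows "y \<in> P"
proof (rule ccontr)
  assume "y \<notin> P"
  interpret place "range cst" F P using assms by unfold_locales
  have i: "inverse y \<in> M" using inverse_in_M[OF y_F \<open>y \<notin> P\<close>] .
  have "(x ^ N - cst c * y) * inverse y ^ p = 1"
    unfolding equation[symmetric] by (simp flip: power_mult_distrib)
  moreover have "(x ^ N - cst c * y) * inverse y ^ p = x ^ N * inverse y ^ p - cst c * inverse y ^ (p - 1)"
    using p_gt_1 by (cases p) (simp_all add: field_simps)
  moreover have "x ^ N * inverse y ^ p - cst c * inverse y ^ (p - 1) \<in> M"
    using assms p_gt_1 by (intro M_diff M_mult M_power i) auto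
  ultimately show False using one_notin_M by metis
qed

definition infinity where "infinity = (THE P. P \<in> points \<and> \<not> {x, y} \<subseteq> P)"

lemma infinity_point: "infinity \<in> points" and x_notin_infinity: "x \<notin> infinity"
proof -
  obtain P where P: "P \<in> points" "x \<notin> P" using place_at_infinity_exists by blast
  have "infinity = P" unfolding infinity_def
    by (rule the_equality) (use P y_in_if_x_in infinity_unique in auto)
  then show "infinity \<in> points" "x \<notin> infinity" using P by auto
qed

sublocale inf: as_infinity cst x y p k c infinity
  by (rule as_infinityI[OF infinity_point x_notin_infinity])

lemma infinity_eqI: "P \<in> points \<Longrightarrow> x \<notin> P \<Longrightarrow> P = infinity"
  by (rule infinity_unique[OF _ _ infinity_point x_notin_infinity])

end

subsection \<open>Affine points\<close>

context artin_schreier begin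

definition pv :: "'k \<Rightarrow> 'k \<Rightarrow> 'k poly poly \<Rightarrow> 'k" where "pv a b g = poly (poly g [:b:]) a"

lemma pv_simps [simp]:
  "pv a b 0 = 0" "pv a b 1 = 1" "pv a b (g + h) = pv a b g + pv a b h" "pv a b (g - h) = pv a b g - pv a b h"
  "pv a b (g * h) = pv a b g * pv a b h" "pv a b (g ^ n) = pv a b g ^ n" "pv a b [:r:] = poly r a"
  "pv a b (pCons r g) = poly r a + b * pv a b g" "pv a b (smult r g) = poly r a * pv a b g"
  by (simp_all add: pv_def)

text \<open>Divide by Y - b, and then the remainder, a polynomial in X, by X - a.\<close>

lemma ev_taylor:
  obtains h' g' where "ev g = cst (pv a b g) + (x - cst a) * E h' + (y - cst b) * ev g'"
proof -
  define r where "r = poly g [:b:]"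
  have "poly (g - [:r:]) [:b:] = 0" by (simp add: r_def)
  then obtain g' where g': "g - [:r:] = [:- [:b:], 1:] * g'" by (metis poly_eq_0_iff_dvd dvd_def)
  have "poly (r - [:poly r a:]) a = 0" by simp
  then obtain h' where h': "r - [:poly r a:] = [:- a, 1:] * h'" by (metis poly_eq_0_iff_dvd dvd_def)
  have ev_g: "ev (g - [:r:]) = (y - cst b) * ev g'"
    unfolding g' ev.hom_mult by (simp add: ev_pCons E.hom_uminus E_pCons cst.hom_uminus)
  have E_r: "E (r - [:poly r a:]) = (x - cst a) * E h'"
    unfolding h' E.hom_mult by (simp add: E_pCons cst.hom_uminus)
  have "ev g = E r + (y - cst b) * ev g'" unfolding ev_g[symmetric] by (simp add: ev.hom_minus)
  also have "E r = cst (poly r a) + (x - cst a) * E h'" unfolding E_r[symmetric] by (simp add: E.hom_minus)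
  finally have "ev g = cst (poly r a) + (x - cst a) * E h' + (y - cst b) * ev g'" .
  then show thesis using that by (simp add: pv_def r_def)
qed

lemma x_neq_const [simp]: "x \<noteq> cst a"
proof
  assume *: "x = cst a"
  have "E [:- a, 1:] = x - cst a" by (simp add: E_pCons cst.hom_uminus)
  then have "E [:- a, 1:] = 0" using * by (simp del: E_eq_0_iff)
  then show False unfolding E_eq_0_iff by simp
qed

lemma x_const_nz: "x - cst a \<noteq> 0"
  by simp

end

locale as_affine = as_place +
  fixes a b
  assumes x_M: "x - cst a \<in> max_ideal P" and y_M: "y - cst b \<in> max_ideal P"
begin

lemma x_P [simp]: "x \<in> P" and y_P [simp]: "y \<in> P"
  using P_basic(4)[OF M_sub[OF x_M], of "cst a"] P_basic(4)[OF M_sub[OF y_M], of "cst b"] by auto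

lemma E_P [simp]: "E h \<in> P" unfolding E_sum by (rule P_sum) simp

lemma ev_P [simp]: "ev g \<in> P" unfolding ev_sum by (rule P_sum) simp

lemma ev_residue: "ev g - cst (pv a b g) \<in> M"
proof -
  obtain h' g' where "ev g = cst (pv a b g) + (x - cst a) * E h' + (y - cst b) * ev g'" by (rule ev_taylor)
  then have "ev g - cst (pv a b g) = (x - cst a) * E h' + (y - cst b) * ev g'" by simp
  also have "\<dots> \<in> M" using x_M y_M by simp
  finally show ?thesis .
qed

lemma ev_M_iff: "ev g \<in> M \<longleftrightarrow> pv a b g = 0"
  using ev_residue[of g] M_diff[of "ev g" "ev g - cst (pv a b g)"] const_in_M_iff[of "cst (pv a b g)"] by auto

lemma ev_unit: "pv a b g \<noteq> 0 \<Longrightarrow> ev g \<in> P - M"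
  using ev_M_iff by simp

lemma point_eq: "b ^ p + c * b = a ^ N"
proof -
  have "pv a b rel = 0" using ev_M_iff[of rel] by simp
  then have "b ^ p + c * b - a ^ N = 0" by (simp add: rel_def pv_def poly_monom algebra_simps)
  then show ?thesis by simp
qed

text \<open>The cofactor in (y - b) w = (y - b)^p + c (y - b), which Frobenius turns into x^N - a^N,
  a multiple of x - a. Its value at (a, b) is c, so w is a unit there, and y - b is divisible by x -
  a up to that unit.\<close>

definition w :: "'a poly poly" where "w = [:- [:b:], 1:] ^ (p - 1) + [:[:c:]:]"

lemma pv_w: "pv a b w = c"
  using p_gt_1 by (simp add: w_def pv_def zero_power)

lemma ev_w: obtains q where "(y - cst b) * ev w = (x - cst a) * E q"
proof -
  have "poly (monom 1 N - [:a ^ N:]) a = 0" by (simp add: poly_monom)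
  then obtain q where q: "monom 1 N - [:a ^ N:] = [:- a, 1:] * q" by (metis poly_eq_0_iff_dvd dvd_def)
  have "ev w = (y - cst b) ^ (p - 1) + cst c"
    by (simp add: w_def ev.hom_add ev.hom_power ev_pCons E.hom_uminus cst.hom_uminus)
  then have "(y - cst b) * ev w = (y - cst b) ^ p + cst c * (y - cst b)"
    using p_gt_1 by (cases p) (simp_all add: algebra_simps)
  also have "\<dots> = x ^ N - cst (b ^ p + c * b)"
    unfolding frobenius_diff equation[symmetric] by (simp add: cst.hom_add cst.hom_mult cst.hom_power algebra_simps)
  also have "\<dots> = E (monom 1 N - [:a ^ N:])"
    unfolding point_eq by (simp add: E.hom_minus E_monom)
  also have "\<dots> = (x - cst a) * E q"
    unfolding q E.hom_mult by (simp add: E_pCons cst.hom_uminus)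
  finally show thesis using that by blast
qed

lemma divide_step:
  assumes "pv a b g = 0" obtains g' where "ev g * ev w = (x - cst a) * ev g'"
proof -
  obtain h' g' where "ev g = cst (pv a b g) + (x - cst a) * E h' + (y - cst b) * ev g'" by (rule ev_taylor)
  then have eq: "ev g = (x - cst a) * E h' + (y - cst b) * ev g'" using assms by simp
  have "ev g * ev w = (x - cst a) * E h' * ev w + ((y - cst b) * ev w) * ev g'"
    by (subst eq) (simp add: algebra_simps)
  also obtain q where q: "(y - cst b) * ev w = (x - cst a) * E q" by (rule ev_w)
  note q
  finally have "ev g * ev w = (x - cst a) * E h' * ev w + (x - cst a) * E q * ev g'" .
  also have "\<dots> = (x - cst a) * ev (smult h' w + smult q g')"
    by (simp add: ev.hom_add ev_smult algebra_simps)
  finally have "ev g * ev w = (x - cst a) * ev (smult h' w + smult q g')" .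
  then show thesis using that by blast
qed

text \<open>Iterates \<open>divide_step\<close>: either some quotient no longer vanishes at (a, b),
  or n factors x - a have been split off.\<close>

lemma divide_steps:
  "(\<exists>i g'. pv a b g' \<noteq> 0 \<and> ev g * ev w ^ i = (x - cst a) ^ i * ev g') \<or>
   (\<exists>g'. ev g * ev w ^ n = (x - cst a) ^ n * ev g')"
proof (induction n)
  case 0
  then show ?case by auto
next
  case (Suc n)
  show ?case
  proof (cases "\<exists>i g'. pv a b g' \<noteq> 0 \<and> ev g * ev w ^ i = (x - cst a) ^ i * ev g'")
    case False
    then obtain g' where g': "ev g * ev w ^ n = (x - cst a) ^ n * ev g'" using Suc by blast
    then have "pv a b g' = 0" using False by blast
    then obtain g'' where "ev g' * ev w = (x - cst a) * ev g''" by (rule divide_step)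
    then have "ev g * ev w ^ Suc n = (x - cst a) ^ Suc n * ev g''"
      using g' by (metis (no_types, lifting) mult.assoc power_Suc2)
    then show ?thesis by blast
  qed blast
qed

lemma E_order:
  assumes "h \<noteq> 0" obtains r h' where "E h = (x - cst a) ^ r * E h'" "poly h' a \<noteq> 0"
proof -
  obtain h' where h': "h = [:- a, 1:] ^ order a h * h'" "\<not> [:- a, 1:] dvd h'"
    using order_decomp[OF assms] by blast
  have "E h = (x - cst a) ^ order a h * E h'"
    by (subst h'(1)) (simp add: E.hom_mult E.hom_power E_pCons cst.hom_uminus)
  then show thesis using that h'(2) by (simp add: poly_eq_0_iff_dvd)
qed

text \<open>The division stops because \<open>ev g\<close> divides some h(x), whose order r at a is
  finite: after r + 1 steps a product of units would lie in the maximal ideal.\<close>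

lemma ev_order:
  assumes "ev g \<noteq> 0"
  obtains i g' where "pv a b g' \<noteq> 0" "ev g * ev w ^ i = (x - cst a) ^ i * ev g'"
proof -
  obtain g1 h where gh: "h \<noteq> 0" "ev g * ev g1 = E h" using algebraic_multiple[OF assms] .
  obtain r h' where h': "E h = (x - cst a) ^ r * E h'" "poly h' a \<noteq> 0" using E_order[OF gh(1)] .
  have "\<not> (\<exists>g'. ev g * ev w ^ Suc r = (x - cst a) ^ Suc r * ev g')"
  proof
    assume "\<exists>g'. ev g * ev w ^ Suc r = (x - cst a) ^ Suc r * ev g'"
    then obtain g' where g': "ev g * ev w ^ Suc r = (x - cst a) ^ Suc r * ev g'" by blast
    have "(x - cst a) ^ r * (E h' * ev w ^ Suc r) = (ev g * ev w ^ Suc r) * ev g1"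
      unfolding mult.assoc[symmetric] h'(1)[symmetric] gh(2)[symmetric] by (simp add: mult_ac)
    also have "\<dots> = (x - cst a) ^ r * ((x - cst a) * (ev g' * ev g1))"
      unfolding g' by (simp add: mult_ac)
    finally have "E h' * ev w ^ Suc r = (x - cst a) * (ev g' * ev g1)" by simp
    then have "ev ([:h':] * w ^ Suc r) = (x - cst a) * (ev g' * ev g1)"
      by (simp only: ev.hom_mult ev.hom_power ev_const)
    also have "\<dots> \<in> M" using x_M by simp
    finally show False unfolding ev_M_iff using h'(2) c_nz by (simp add: pv_w)
  qed
  then show thesis using divide_steps[of g "Suc r"] that by blast
qed

text \<open>The formula refers to P only through (a, b). It therefore yields the local parameter and
  also shows, in \<open>affine_unique\<close>, that (a, b) determines P.\<close>

lemma affine_expansion: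
  assumes "f \<in> F" "f \<noteq> 0"
  obtains n g1 g2 where "f = (x - cst a) powi n * (ev g1 / ev g2)" "pv a b g1 \<noteq> 0" "pv a b g2 \<noteq> 0"
proof -
  obtain g h where gh: "f = ev g / E h" "h \<noteq> 0" "degree g < p" using F_reduced[OF assms(1)] .
  then have "ev g \<noteq> 0" using assms by auto
  then obtain i g1 where g1: "pv a b g1 \<noteq> 0" "ev g * ev w ^ i = (x - cst a) ^ i * ev g1" by (rule ev_order)
  obtain r h' where h': "E h = (x - cst a) ^ r * E h'" "poly h' a \<noteq> 0" using E_order[OF gh(2)] .
  have nz: "ev w \<noteq> 0" "E h' \<noteq> 0" "x - cst a \<noteq> 0"
    using ev_unit[of w] pv_w c_nz h'(2) by (auto simp del: E_eq_0_iff) (simp add: unitD)+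
  have "f = (x - cst a) powi (int i - int r) * (ev g1 / (E h' * ev w ^ i))"
    using g1(2) nz unfolding gh(1) h'(1) by (simp add: power_int_diff field_simps)
  then have "f = (x - cst a) powi (int i - int r) * (ev g1 / ev ([:h':] * w ^ i))"
    by (simp only: ev.hom_mult ev.hom_power ev_const)
  moreover have "pv a b ([:h':] * w ^ i) \<noteq> 0" using h'(2) c_nz by (simp add: pv_w)
  ultimately show thesis using that g1(1) by blast
qed

lemma local_parameter_x: "local_parameter (range cst) F P (x - cst a)"
proof
  show "x - cst a \<in> max_ideal P" "x - cst a \<noteq> 0" by (rule x_M, rule x_const_nz)
next
  fix f assume f: "f \<in> F" "f \<noteq> 0"
  obtain n g1 g2 where g: "f = (x - cst a) powi n * (ev g1 / ev g2)" "pv a b g1 \<noteq> 0" "pv a b g2 \<noteq> 0"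
    using affine_expansion[OF f] .
  have "ev g1 / ev g2 - cst (pv a b g1) / cst (pv a b g2) \<in> M"
    by (rule quotient_residue) (use g ev_residue in auto)
  then show "\<exists>n. \<exists>a'\<in>range cst. \<exists>e\<in>max_ideal P. a' \<noteq> 0 \<and> f = (x - cst a) powi n * (a' + e)"
    using g by (intro exI[of _ n] bexI[of _ "cst (pv a b g1) / cst (pv a b g2)"]
      bexI[of _ "ev g1 / ev g2 - cst (pv a b g1) / cst (pv a b g2)"]) auto
qed

sublocale local_parameter "range cst" F P "x - cst a" by (rule local_parameter_x)

lemma affine_mem_iff:
  assumes "pv a b g1 \<noteq> 0" "pv a b g2 \<noteq> 0"
  shows "(x - cst a) powi n * (ev g1 / ev g2) \<in> P \<longleftrightarrow> n \<ge> 0"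
proof -
  have "ev g1 / ev g2 \<in> P - M"
    unfolding divide_inverse by (intro unit_mult unit_inverse ev_unit assms)
  from unit_powi_mem(1)[OF this, of n] show ?thesis by (simp only: mult.commute)
qed

end

section \<open>Existence and uniqueness of affine points\<close>

context artin_schreier begin

abbreviation affine_point where "affine_point \<equiv> as_affine cst x y p k c"

lemma affine_unique:
  assumes "affine_point P a b" "affine_point P' a b"
  shows "P = P'"
proof -
  interpret P: as_affine cst x y p k c P a b by fact
  interpret P': as_affine cst x y p k c P' a b by fact
  have "f \<in> P \<longleftrightarrow> f \<in> P'" if f: "f \<in> F" for f
  proof (cases "f = 0")
    case False
    obtain n g1 g2 where "f = (x - cst a) powi n * (ev g1 / ev g2)" "pv a b g1 \<noteq> 0" "pv a b g2 \<noteq> 0"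
      using P.affine_expansion[OF f False] .
    then show ?thesis using P.affine_mem_iff[of g1 g2 n] P'.affine_mem_iff[of g1 g2 n] by simp
  qed simp
  then show ?thesis using P.in_F P'.in_F by blast
qed

text \<open>Applied to the ring K[x, y] with x - a and y - b: a relation equal to 1 would be a
  polynomial identity modulo \<open>rel\<close>, and \<open>rel\<close> vanishes at (a, b), so
  evaluation there would give 0 = 1.\<close>

lemma affine_exists:
  assumes "b ^ p + c * b = a ^ N"
  obtains P where "affine_point P a b"
proof -
  define A where "A = range ev"
  have A_I: "ev g \<in> A" for g by (auto simp: A_def)
  have "subring A ring_of_type_algebra"
    unfolding subring_type_algebra_iff
    using A_I[of 1] by (auto simp: A_def simp flip: ev.hom_add ev.hom_mult ev.hom_uminus)
  moreover have "range cst \<subseteq> A"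
  proof
    fix z assume "z \<in> range cst"
    then obtain z' where "z = cst z'" by blast
    then show "z \<in> A" using A_I[of "[:[:z':]:]"] by simp
  qed
  moreover have "A \<subseteq> F" by (auto simp: A_def)
  moreover have x: "x - cst a = ev [:[:- a, 1:]:]" by (simp add: E_pCons cst.hom_uminus)
  moreover have y: "y - cst b = ev [:- [:b:], 1:]" by (simp add: ev_pCons E.hom_uminus cst.hom_uminus)
  moreover have "(x - cst a) * r + (y - cst b) * s \<noteq> 1" if rs: "r \<in> A" "s \<in> A" for r s
  proof
    assume *: "(x - cst a) * r + (y - cst b) * s = 1"
    obtain g h where gh: "r = ev g" "s = ev h" using rs by (auto simp: A_def)
    have "ev ([:[:- a, 1:]:] * g + [:- [:b:], 1:] * h - 1) = 0"
      using * unfolding gh x y by (simp only: ev.hom_add ev.hom_mult ev.hom_minus ev.hom_one) simp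
    then have "rel dvd [:[:- a, 1:]:] * g + [:- [:b:], 1:] * h - 1" unfolding ev_eq_0_iff_rel .
    then obtain q where q: "[:[:- a, 1:]:] * g + [:- [:b:], 1:] * h - 1 = rel * q" by (rule dvdE)
    have "b ^ p + c * b - a ^ N = 0" using assms by simp
    then have "pv a b rel = 0" by (simp add: rel_def pv_def poly_monom algebra_simps)
    then have "pv a b ([:[:- a, 1:]:] * g + [:- [:b:], 1:] * h - 1) = 0" unfolding q by (simp only: pv_simps mult_zero_left)
    then show False by (simp add: pv_def)
  qed
  ultimately obtain P where "P \<in> points" "x - cst a \<in> max_ideal P" "y - cst b \<in> max_ideal P"
    using place_exists[OF K.field_subset_axioms F.field_subset_axioms, of A "x - cst a" "y - cst b"] A_I x_const_nz
    by metis
  then have "affine_point P a b" by unfold_locales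
  then show thesis by (rule that)
qed

definition fibre_poly :: "'k \<Rightarrow> 'k poly" where "fibre_poly e = monom 1 p + [:- e, c:]"

lemma poly_fibre_poly: "poly (fibre_poly e) b = b ^ p + c * b - e"
  by (simp add: fibre_poly_def poly_monom algebra_simps)

lemma degree_fibre_poly: "degree (fibre_poly e) = p"
proof -
  have "degree [:- e, c:] < p" using p_gt_1 by (auto intro: le_less_trans[OF degree_pCons_le])
  then show ?thesis unfolding fibre_poly_def by (subst degree_add_eq_left) (simp_all add: degree_monom_eq)
qed

lemma fibre_poly_nz: "fibre_poly e \<noteq> 0"
  using degree_fibre_poly[of e] p_gt_1 by auto

lemma point_over: obtains b where "b ^ p + c * b = a ^ N"
proof -
  obtain b where "poly (fibre_poly (a ^ N)) b = 0"
    using alg_closed_imp_poly_has_root[of "fibre_poly (a ^ N)"] degree_fibre_poly p_gt_1 by auto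
  then show thesis using that[of b] by (simp add: poly_fibre_poly)
qed

end

context as_place begin

text \<open>Split q into linear factors over the algebraically closed constants; as M is prime, one
  factor lies in it.\<close>

lemma root_in_M:
  assumes "z \<in> P" "q \<noteq> 0" "poly (map_poly cst q) z \<in> M"
  shows "\<exists>a. poly q a = 0 \<and> z - cst a \<in> M"
  using assms(2,3)
proof (induction "degree q" arbitrary: q rule: less_induct)
  case less
  interpret pz: comm_ring_hom "\<lambda>q. poly (map_poly cst q) z" by (rule comm_ring_hom_eval_map_poly[OF cst_hom])
  show ?case
  proof (cases "degree q = 0")
    case True
    then obtain d where "q = [:d:]" by (metis degree_eq_zeroE)
    then show ?thesis using less(2,3) const_in_M_iff[of "cst d"] by (simp add: Polynomial.map_poly_pCons)
  next
    case False
    then obtain a where a: "poly q a = 0" using alg_closed_imp_poly_has_root[of q] by auto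
    then obtain q' where q': "q = [:- a, 1:] * q'" by (metis poly_eq_0_iff_dvd dvd_def)
    then have "q' \<noteq> 0" using less(2) by auto
    then have "degree q' < degree q" unfolding q' by (subst degree_mult_eq) auto
    have E: "poly (map_poly cst q) z = (z - cst a) * poly (map_poly cst q') z"
      unfolding q' pz.hom_mult by (simp add: Polynomial.map_poly_pCons cst.hom_uminus)
    have "poly (map_poly cst q') z \<in> P"
      unfolding poly_altdef using assms(1) by (intro P_sum) (simp add: coeff_map_poly)
    then have "z - cst a \<in> M \<or> poly (map_poly cst q') z \<in> M"
      using less(3) assms(1) unfolding E by (intro M_prime) auto
    then show ?thesis using a less(1)[OF \<open>degree q' < degree q\<close> \<open>q' \<noteq> 0\<close>] q' by auto
  qed
qed

end

section \<open>Classification of the points, finiteness of zeros, nonsingularity\<close>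

context artin_schreier begin

lemma affine_at:
  assumes "P \<in> points" "x - cst a \<in> max_ideal P"
  obtains b where "affine_point P a b"
proof -
  interpret as_place cst x y p k c P using assms by unfold_locales
  interpret py: comm_ring_hom "\<lambda>q. poly (map_poly cst q) y" by (rule comm_ring_hom_eval_map_poly[OF cst_hom])
  have x: "x \<in> P" using P_basic(4)[OF M_sub[OF assms(2)], of "cst a"] by simp
  then have y: "y \<in> P" using y_in_if_x_in assms by blast
  have "poly (map_poly cst (fibre_poly (a ^ N))) y = y ^ p + cst c * y - cst a ^ N"
    unfolding fibre_poly_def py.hom_add
    by (simp add: map_poly_monom poly_monom Polynomial.map_poly_pCons cst.hom_uminus cst.hom_power cst.hom_mult mult.commute)
  also have "\<dots> = x ^ N - cst a ^ N" unfolding equation ..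
  also have "\<dots> = (x - cst a) * (\<Sum>i<N. cst a ^ (N - Suc i) * x ^ i)"
    by (rule power_diff_sumr2)
  also have "\<dots> \<in> M" using assms(2) x by (intro M_mult' P_sum) auto
  finally obtain b where "y - cst b \<in> M" using root_in_M[OF y fibre_poly_nz] by blast
  then have "affine_point P a b" using assms by unfold_locales
  then show thesis by (rule that)
qed

text \<open>P is not all of F, so some g(x, y) / h(x) is not regular. Away from infinity numerators
  are regular, hence h(x) vanishes at P, and a root of h is the value of x.\<close>

lemma affine_or_infinity:
  assumes P: "P \<in> points" "P \<noteq> infinity"
  obtains a b where "affine_point P a b"
proof -
  interpret as_place cst x y p k c P using assms by unfold_locales
  have x: "x \<in> P" using infinity_eqI P by blast
  have y: "y \<in> P" using y_in_if_x_in P x by blast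
  have EP: "E h \<in> P" for h unfolding E_sum using x by (intro P_sum) simp
  have evP: "ev g \<in> P" for g unfolding ev_sum using y EP by (intro P_sum) simp
  obtain f where f: "f \<in> F" "f \<notin> P" using P_sub by blast
  obtain g h where gh: "f = ev g / E h" "h \<noteq> 0" "degree g < p" using F_reduced[OF f(1)] .
  have "E h \<in> M"
  proof (rule ccontr)
    assume "E h \<notin> M"
    then have "inverse (E h) \<in> P" using EP unitD by blast
    then have "ev g * inverse (E h) \<in> P" using evP P_basic(5) by blast
    then show False using f gh by (simp add: divide_inverse)
  qed
  then obtain a where "x - cst a \<in> M" using root_in_M[OF x gh(2)] unfolding E_def by blast
  then obtain b where "affine_point P a b" using affine_at[OF P(1)] by blast
  then show thesis by (rule that)
qed

lemma finite_points_over: "finite {P. \<exists>b. affine_point P a b}"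
proof -
  have "{P. \<exists>b. affine_point P a b} \<subseteq>
     (\<lambda>b. THE P. affine_point P a b) ` {b. poly (fibre_poly (a ^ N)) b = 0}"
  proof
    fix P assume "P \<in> {P. \<exists>b. affine_point P a b}"
    then obtain b where b: "affine_point P a b" by blast
    then have "(THE P. affine_point P a b) = P" using affine_unique by (intro the_equality) auto
    moreover have "poly (fibre_poly (a ^ N)) b = 0"
      using as_affine.point_eq[OF b] by (simp add: poly_fibre_poly)
    ultimately show "P \<in> (\<lambda>b. THE P. affine_point P a b) ` {b. poly (fibre_poly (a ^ N)) b = 0}" by force
  qed
  then show ?thesis using poly_roots_finite[OF fibre_poly_nz] by (rule finite_subset[OF _ finite_imageI])
qed

text \<open>At a zero of f the constant coefficient h(x) of a relation for f vanishes, so x takes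
  one of finitely many values, and each fibre of x is finite.\<close>

lemma finite_zeros:
  assumes "f \<in> F" "f \<noteq> 0" shows "finite {P \<in> points. f \<in> max_ideal P}"
proof -
  obtain r where r: "poly (map_poly E r) f = 0" "coeff r 0 \<noteq> 0" using algebraic_relation[OF assms(2)] .
  obtain h r' where hr: "r = pCons h r'" by (cases r)
  then have "h \<noteq> 0" using r by auto
  have "{P \<in> points. f \<in> max_ideal P} \<subseteq>
     insert infinity (\<Union>a\<in>{a. poly h a = 0}. {P. \<exists>b. affine_point P a b})"
  proof
    fix P assume "P \<in> {P \<in> points. f \<in> max_ideal P}"
    then have P: "P \<in> points" "f \<in> max_ideal P" by auto
    show "P \<in> insert infinity (\<Union>a\<in>{a. poly h a = 0}. {P. \<exists>b. affine_point P a b})"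
    proof (cases "P = infinity")
      case False
      interpret as_place cst x y p k c P using P by unfold_locales
      have x: "x \<in> P" using infinity_eqI P False by blast
      have EP: "E h \<in> P" for h unfolding E_sum using x by (intro P_sum) simp
      have "E h + f * poly (map_poly E r') f = 0" using r(1) hr by (simp add: Polynomial.map_poly_pCons)
      then have "E h = - (f * poly (map_poly E r') f)" by (simp add: add_eq_0_iff2)
      moreover have "poly (map_poly E r') f \<in> P"
        unfolding poly_altdef using EP P(2) by (intro P_sum) (simp add: coeff_map_poly)
      ultimately have "E h \<in> M" using P(2) by simp
      then obtain a where a: "poly h a = 0" "x - cst a \<in> M" using root_in_M[OF x \<open>h \<noteq> 0\<close>] unfolding E_def by blast
      then show ?thesis using affine_at[OF P(1) a(2)] by blast
    qed simp
  qed
  moreover have "finite (insert infinity (\<Union>a\<in>{a. poly h a = 0}. {P. \<exists>b. affine_point P a b}))"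
    using poly_roots_finite[OF \<open>h \<noteq> 0\<close>] finite_points_over by auto
  ultimately show ?thesis by (rule finite_subset)
qed

lemma infinite_constants: "infinite (UNIV :: 'k set)"
proof
  assume fin: "finite (UNIV :: 'k set)"
  define q :: "'k poly" where "q = (\<Prod>a\<in>UNIV. [:- a, 1:]) + 1"
  have "degree (\<Prod>a\<in>UNIV. [:- a, 1 :: 'k:]) = card (UNIV :: 'k set)"
    by (subst degree_prod_eq_sum_degree) auto
  moreover have "card (UNIV :: 'k set) > 0" using fin by (simp add: card_gt_0_iff)
  ultimately have "degree q > 0" unfolding q_def by (subst degree_add_eq_left) auto
  then obtain b where "poly q b = 0" using alg_closed_imp_poly_has_root by blast
  moreover have "(\<Prod>a\<in>UNIV. b - a) = 0" using fin by (simp add: prod_zero_iff)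
  ultimately show False by (simp add: q_def poly_prod)
qed

lemma infinite_points: "infinite (points)"
proof
  assume fin: "finite (points)"
  have "\<forall>a. \<exists>P b. affine_point P a b" using point_over affine_exists by metis
  then obtain Q where Q: "\<And>a. \<exists>b. affine_point (Q a) a b" by metis
  have "inj Q"
  proof (rule injI)
    fix a a' assume "Q a = Q a'"
    obtain b where "affine_point (Q a) a b" using Q by blast
    then interpret A: as_affine cst x y p k c "Q a" a b .
    obtain b' where "affine_point (Q a') a' b'" using Q by blast
    then interpret B: as_affine cst x y p k c "Q a'" a' b' .
    show "a = a'" using A.residue_unique[of "cst a" "cst a'" x] A.x_M B.x_M \<open>Q a = Q a'\<close> by simp
  qed
  moreover have "range Q \<subseteq> points"
  proof
    fix P assume "P \<in> range Q"
    then obtain a b where "affine_point P a b" using Q by blast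
    then interpret as_affine cst x y p k c P a b .
    show "P \<in> points" by (rule point)
  qed
  ultimately show False using fin infinite_constants by (metis finite_subset finite_imageD)
qed

lemma nonsingular_curve: "nonsingular_curve (range cst) F"
proof
  fix P assume P: "P \<in> points"
  show "\<exists>t. local_parameter (range cst) F P t"
  proof (cases "P = infinity")
    case True
    then show ?thesis using inf.local_parameter_t by blast
  next
    case False
    then obtain a b where "affine_point P a b" using affine_or_infinity[OF P] by blast
    then show ?thesis using as_affine.local_parameter_x by blast
  qed
qed (use infinite_points finite_zeros in auto)

sublocale nonsingular_curve "range cst" F by (rule nonsingular_curve)

end

section \<open>Functions regular away from infinity\<close>

lemma card_roots_separable:
  fixes q :: "'a::alg_closed_field poly"
  assumes "q \<noteq> 0" "\<And>b. poly q b = 0 \<Longrightarrow> poly (pderiv q) b \<noteq> 0"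
  shows "card {b. poly q b = 0} = degree q"
  using assms
proof (induction "degree q" arbitrary: q)
  case 0
  then obtain d where "q = [:d:]" by (metis degree_eq_zeroE)
  then show ?case using 0 by simp
next
  case (Suc n)
  then obtain b where b: "poly q b = 0" using alg_closed_imp_poly_has_root[of q] by auto
  then obtain q' where q': "q = [:- b, 1:] * q'" by (metis poly_eq_0_iff_dvd dvd_def)
  have nz: "q' \<noteq> 0" using Suc.prems q' by auto
  have deg: "degree q = Suc (degree q')" unfolding q' using nz by (subst degree_mult_eq) auto
  have pd: "poly (pderiv q) z = poly q' z + (z - b) * poly (pderiv q') z" for z
    unfolding q' pderiv_mult by (simp add: pderiv_pCons algebra_simps)
  have "poly q' b \<noteq> 0" using Suc.prems(2)[OF b] pd[of b] by simp
  have "card {z. poly q' z = 0} = degree q'"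
  proof (rule Suc.hyps(1))
    show "n = degree q'" using deg Suc.hyps(2) by simp
    show "poly (pderiv q') z \<noteq> 0" if "poly q' z = 0" for z
      using Suc.prems(2)[of z] pd[of z] that unfolding q' by (auto simp del: mult_pCons_left)
  qed (rule nz)
  moreover have "{z. poly q z = 0} = insert b {z. poly q' z = 0}" unfolding q' by auto
  ultimately show ?case using \<open>poly q' b \<noteq> 0\<close> poly_roots_finite[OF nz] deg by simp
qed

context artin_schreier begin

lemma of_nat_p [simp]: "of_nat p = (0 :: 'k)" "of_nat p = (0 :: 'k poly)" "of_nat p = (0 :: 'k poly poly)"
  by (simp_all add: of_nat_eq_0_iff_char_dvd CHAR_k)

lemma of_nat_k_eq_0_iff: "of_nat n = (0 :: 'k) \<longleftrightarrow> p dvd n"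
  by (simp add: of_nat_eq_0_iff_char_dvd CHAR_k)

text \<open>In characteristic p the derivative of Y^p + c Y - e is the constant c, so the fibre has
  p distinct points, too many roots for r.\<close>

lemma vanishing_fibre:
  assumes "degree r < p" "\<And>b. b ^ p + c * b = e \<Longrightarrow> poly r b = 0"
  shows "r = 0"
proof (rule ccontr)
  assume "r \<noteq> 0"
  have "poly (pderiv (fibre_poly e)) b = c" for b
    by (simp add: fibre_poly_def pderiv_add pderiv_monom pderiv_pCons poly_monom)
  then have "card {b. poly (fibre_poly e) b = 0} = p"
    using card_roots_separable[OF fibre_poly_nz] c_nz degree_fibre_poly by simp
  moreover have "{b. poly (fibre_poly e) b = 0} \<subseteq> {b. poly r b = 0}"
    using assms(2) by (auto simp: poly_fibre_poly)
  moreover have "card {b. poly r b = 0} \<le> degree r"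
    by (rule card_poly_roots_bound[OF \<open>r \<noteq> 0\<close>])
  ultimately show False
    using card_mono[OF poly_roots_finite[OF \<open>r \<noteq> 0\<close>], of "{b. poly (fibre_poly e) b = 0}"] assms(1) by simp
qed

lemma pv_eq_map_poly: "pv a b g = poly (map_poly (\<lambda>r. poly r a) g) b"
proof (induction g)
  case (pCons r g)
  then show ?case by (simp add: Polynomial.map_poly_pCons)
qed simp

text \<open>Functions without affine poles are polynomials. For a root a of the denominator the
  numerator vanishes at all p points over a; its y-degree is below p, so every coefficient is
  divisible by x - a, and the factor cancels.\<close>

lemma regular_affine_reduced:
  assumes z: "z \<in> F" "\<And>P. P \<in> points \<Longrightarrow> P \<noteq> infinity \<Longrightarrow> z \<in> P"
  obtains g where "z = ev g" "degree g < p"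
proof -
  have "\<exists>g'. z = ev g' \<and> degree g' < p" if "z = ev g / E h" "h \<noteq> 0" "degree g < p" for g h
    using that
  proof (induction "degree h" arbitrary: g h)
    case 0
    then obtain d where d: "h = [:d:]" by (metis degree_eq_zeroE)
    then have "d \<noteq> 0" using 0 by auto
    have "z = ev (smult [:inverse d:] g)"
      unfolding 0(2) d ev_smult E_const by (simp add: cst_inverse divide_inverse mult.commute)
    then show ?case using 0(4) by (metis degree_smult_le le_less_trans)
  next
    case (Suc n)
    then obtain a where a: "poly h a = 0" using alg_closed_imp_poly_has_root[of h] by auto
    have "map_poly (\<lambda>r. poly r a) g = 0"
    proof (rule vanishing_fibre)
      show "degree (map_poly (\<lambda>r. poly r a) g) < p"
        using Suc.prems(3) degree_map_poly_le le_less_trans by blast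
    next
      fix b assume "b ^ p + c * b = a ^ N"
      then obtain P where "affine_point P a b" by (rule affine_exists)
      then interpret as_affine cst x y p k c P a b .
      have "z \<in> P" using z(2)[OF point] x_notin_infinity by force
      have "E h \<in> M" using ev_M_iff[of "[:h:]"] a by simp
      then have "z * E h \<in> M" using \<open>z \<in> P\<close> by simp
      moreover have "z * E h = ev g" using Suc.prems by simp
      ultimately show "poly (map_poly (\<lambda>r. poly r a) g) b = 0"
        using ev_M_iff[of g] by (simp add: pv_eq_map_poly)
    qed
    then have "poly (coeff g j) a = 0" for j
      by (metis coeff_0 coeff_map_poly poly_0)
    then have dvd: "[:- a, 1:] dvd coeff g j" for j by (simp add: poly_eq_0_iff_dvd)
    have "[:[:- a, 1:]:] dvd g" unfolding const_poly_dvd_iff using dvd by blast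
    then obtain g' where g': "g = smult [:- a, 1:] g'" by (auto simp: dvd_def)
    obtain h' where h': "h = [:- a, 1:] * h'" using a by (metis poly_eq_0_iff_dvd dvd_def)
    have nz: "h' \<noteq> 0" using Suc.prems h' by auto
    have "degree h = Suc (degree h')" unfolding h' using nz by (subst degree_mult_eq) auto
    moreover have "degree g' = degree g" unfolding g' by (simp add: degree_smult_eq)
    moreover have "z = ev g' / E h'"
      unfolding Suc.prems(1) g' h' ev_smult E.hom_mult by (simp add: E_pCons cst.hom_uminus)
    ultimately show ?case using Suc.hyps(1)[of h' g'] Suc.hyps(2) Suc.prems(3) nz by simp
  qed
  moreover obtain g h where "z = ev g / E h" "h \<noteq> 0" "degree g < p" using F_reduced[OF z(1)] .
  ultimately show thesis using that by blast
qed

section \<open>The derivation \<open>d/dx\<close>\<close>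

text \<open>The factor of the \<open>y\<close>-derivative comes from \<open>c y' = x^(p\<^sup>k)\<close>, the derivative of the equation of the curve.\<close>

definition D :: "'k poly poly \<Rightarrow> 'k poly poly" where
  "D g = map_poly pderiv g + smult (monom (inverse c) (p ^ k)) (pderiv g)"

lemma coeff_D: "coeff (D g) j = pderiv (coeff g j) + monom (inverse c) (p ^ k) * (of_nat (Suc j) * coeff g (Suc j))"
  by (simp add: D_def coeff_map_poly coeff_pderiv)

lemma map_poly_pderiv_mult:
  "map_poly pderiv (g * h) = g * map_poly pderiv h + h * map_poly pderiv (g :: 'k poly poly)"
proof (rule poly_eqI)
  fix n
  have "coeff (map_poly pderiv (g * h)) n =
    (\<Sum>i\<le>n. pderiv (coeff g i * coeff h (n - i)))"
    by (simp add: coeff_map_poly coeff_mult pderiv_sum)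
  also have "\<dots> = (\<Sum>i\<le>n. coeff g i * pderiv (coeff h (n - i))) + (\<Sum>i\<le>n. pderiv (coeff g i) * coeff h (n - i))"
    by (simp add: pderiv_mult sum.distrib mult.commute)
  also have "\<dots> = coeff (g * map_poly pderiv h + map_poly pderiv g * h) n"
    by (simp add: coeff_mult coeff_map_poly)
  finally show "coeff (map_poly pderiv (g * h)) n = coeff (g * map_poly pderiv h + h * map_poly pderiv g) n"
    by (simp add: mult.commute)
qed

lemma D_mult: "D (g * h) = g * D h + h * D g"
  by (simp add: D_def map_poly_pderiv_mult pderiv_mult algebra_simps smult_add_right)

lemma D_add: "D (g + h) = D g + D h"
  by (rule poly_eqI) (simp add: coeff_D pderiv_add algebra_simps)

lemma D_diff: "D (g - h) = D g - D h"
  by (rule poly_eqI) (simp add: coeff_D pderiv_diff algebra_simps)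

lemma D_power: "D (g ^ n) = of_nat n * g ^ (n - 1) * D g"
proof (induction n)
  case 0
  show ?case by (rule poly_eqI) (simp add: coeff_D pderiv_1)
next
  case (Suc n)
  then show ?case by (cases n) (simp_all add: D_mult algebra_simps)
qed

lemma D_const: "D [:[:a:]:] = 0"
  by (rule poly_eqI) (simp add: coeff_D coeff_pCons pderiv_pCons split: nat.splits)

lemma D_y: "D [:0, 1:] = [:monom (inverse c) (p ^ k):]"
  by (simp add: D_def pderiv_pCons Polynomial.map_poly_pCons)

lemma D_x: "D [:[:0, 1:]:] = 1"
  by (simp add: D_def pderiv_pCons Polynomial.map_poly_pCons one_pCons)

text \<open>The p-th power has derivative 0 and N is 1 modulo p, so what remains is c (x^(p^k) / c)
  - x^(p^k).\<close>

lemma D_rel: "D rel = 0"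
proof -
  have "rel = [:0, 1:] ^ p + [:[:c:]:] * [:0, 1:] - [:[:0, 1:]:] ^ N"
    by (simp add: rel_def poly_eq_iff coeff_pCons coeff_monom poly_const_pow x_pow_n monom_altdef split: nat.splits)
  moreover have "of_nat N = (1 :: 'k poly poly)" using k_pos by (simp add: power_0_left)
  ultimately show ?thesis
    by (simp only: D_add D_diff D_mult D_power D_const D_y D_x)
      (use c_nz in \<open>simp add: poly_const_pow smult_monom monom_altdef\<close>)
qed

text \<open>As \<open>D rel = 0\<close>, the derivation maps the ideal of \<open>rel\<close> into
  itself and so descends to functions on the curve.\<close>

lemma ev_D_cong:
  assumes "ev g = ev h" shows "ev (D g) = ev (D h)"
proof -
  have "ev (g - h) = 0" using assms by (simp add: ev.hom_minus)
  then obtain q where "g - h = rel * q" by (auto simp: ev_eq_0_iff_rel dvd_def)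
  then have "D g - D h = rel * D q" using D_diff[of g h] by (simp add: D_mult D_rel)
  then have "ev (D g) - ev (D h) = 0" using ev.hom_minus[of "D g" "D h"] by (simp add: ev.hom_mult)
  then show ?thesis by simp
qed

lemma degree_D: "degree g < p \<Longrightarrow> degree (D g) < p"
  by (rule le_less_trans[of _ "degree g"]) (auto intro!: degree_le simp: coeff_D coeff_eq_0)

lemma N_less: "N < p * p ^ k"
proof -
  have "p ^ k \<ge> p ^ 1" using k_pos p_gt_1 by (intro power_increasing) auto
  then have "p ^ k \<ge> 2" using p_gt_1 by simp
  moreover have "2 * p ^ k \<le> p * p ^ k" using p_gt_1 by (intro mult_right_mono) auto
  ultimately show ?thesis by linarith
qed

text \<open>Differentiating a coefficient does not raise the weight; differentiating y trades a
  weight of N for p p^k. By \<open>N_less\<close> this second change is the larger one.\<close>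

lemma wt_D_le:
  assumes "D g \<noteq> 0" shows "wt (D g) + N \<le> wt g + p * p ^ k"
proof -
  obtain j where j: "coeff (D g) j \<noteq> 0" "wt (D g) = p * degree (coeff (D g) j) + N * j"
    using wt_attained[OF assms] .
  let ?A = "pderiv (coeff g j)" and ?B = "monom (inverse c) (p ^ k) * (of_nat (Suc j) * coeff g (Suc j))"
  have deg: "degree (coeff (D g) j) \<le> max (degree ?A) (degree ?B)"
    unfolding coeff_D by (rule degree_add_le_max)
  have A: "p * degree ?A + N * j + N \<le> wt g + p * p ^ k" if "coeff g j \<noteq> 0"
  proof -
    have "p * degree ?A + N * j \<le> wt g"
      using wt_ge[OF that] degree_pderiv_le[of "coeff g j"]
      by (meson add_le_mono1 diff_le_self le_trans mult_le_mono2)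
    then show ?thesis using N_less by linarith
  qed
  have B: "p * degree ?B + N * j + N \<le> wt g + p * p ^ k" if "coeff g (Suc j) \<noteq> 0"
  proof -
    have "degree ?B \<le> p ^ k + degree (coeff g (Suc j))"
      using degree_mult_le[of "monom (inverse c) (p ^ k)" "of_nat (Suc j) * coeff g (Suc j)"]
        degree_mult_le[of "of_nat (Suc j)" "coeff g (Suc j)"] degree_monom_le[of "inverse c" "p ^ k"]
        degree_of_nat[of "Suc j", where 'a = 'k] by linarith
    then have "p * degree ?B \<le> p * p ^ k + p * degree (coeff g (Suc j))"
      using mult_le_mono2[of _ _ p] by (simp add: distrib_left flip: distrib_left)
    then show ?thesis using wt_ge[OF that] by simp
  qed
  show ?thesis
  proof (cases "degree ?A \<ge> degree ?B \<and> coeff g j \<noteq> 0")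
    case True
    then have "degree (coeff (D g) j) \<le> degree ?A" using deg by simp
    then have "p * degree (coeff (D g) j) \<le> p * degree ?A" by simp
    then show ?thesis using A True j(2) by linarith
  next
    case False
    have "coeff g (Suc j) \<noteq> 0"
    proof
      assume 0: "coeff g (Suc j) = 0"
      then have "coeff g j \<noteq> 0" using j(1) by (auto simp: coeff_D)
      then show False using False 0 by simp
    qed
    have "degree (coeff (D g) j) \<le> degree ?B" using deg False by (cases "coeff g j = 0") auto
    then have "p * degree (coeff (D g) j) \<le> p * degree ?B" by simp
    then show ?thesis using B[OF \<open>coeff g (Suc j) \<noteq> 0\<close>] j(2) by linarith
  qed
qed

text \<open>Since p does not divide the weight, the dominant monomial has y-exponent j prime to p.
  Its y-derivative contributes to the coefficient of y^(j - 1) a term of higher degree than the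
  x-derivative of the coefficient already there.\<close>

lemma D_nz:
  assumes "g \<noteq> 0" "\<not> p dvd wt g" shows "D g \<noteq> 0"
proof -
  obtain j where j: "coeff g j \<noteq> 0" "wt g = p * degree (coeff g j) + N * j"
    using wt_attained[OF assms(1)] .
  have ndvd: "\<not> p dvd j"
    using assms(2) unfolding j(2) by auto
  then obtain i where i: "j = Suc i" by (cases j) auto
  let ?A = "pderiv (coeff g i)" and ?B = "monom (inverse c) (p ^ k) * (of_nat (Suc i) * coeff g (Suc i))"
  have "of_nat (Suc i) \<noteq> (0 :: 'k)" using ndvd i of_nat_k_eq_0_iff by metis
  have "?B = smult (of_nat (Suc i)) (monom (inverse c) (p ^ k) * coeff g (Suc i))"
    by (simp add: of_nat_poly del: of_nat_Suc)
  then have B: "degree ?B = p ^ k + degree (coeff g j)" "?B \<noteq> 0"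
    using \<open>of_nat (Suc i) \<noteq> 0\<close> j(1) c_nz i by (auto simp: degree_mult_eq degree_monom_eq)
  have "degree ?A < degree ?B"
  proof (cases "coeff g i = 0")
    case False
    have "p * degree (coeff g i) + N * i \<le> p * degree (coeff g j) + N * j"
      using wt_ge[OF False] j(2) by simp
    then have "p * degree (coeff g i) < p * degree (coeff g j) + p * p ^ k"
      using N_less i by simp
    then have "p * degree (coeff g i) < p * (degree (coeff g j) + p ^ k)" by (simp add: distrib_left)
    then have "degree (coeff g i) < degree (coeff g j) + p ^ k" by simp
    then show ?thesis using degree_pderiv_le[of "coeff g i"] B(1) by linarith
  qed (use B p_gt_1 in auto)
  then have "?A + ?B \<noteq> 0" using B(2) by (metis add.left_neutral degree_minus eq_neg_iff_add_eq_0 less_irrefl)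
  then have "coeff (D g) i \<noteq> 0" unfolding coeff_D .
  then show ?thesis by auto
qed

end

text \<open>In terms of a = p - 1, L = p^l and q = p^(k - l) the hypothesis \<open>le\<close> reads
  (a L - 1) d <= a q L - 1, which is Riemann-Hurwitz with tame total ramification at one
  point.\<close>

lemma weight_bound_arith:
  fixes p d l k :: nat
  assumes p: "p > 1" and l: "1 < l" "l < k"
    and le: "p * p ^ l * d + p ^ k + 1 \<le> d * (p ^ l + 1) + p * p ^ k"
  shows "p * d < p ^ k + 1" "d * (p ^ l + 1) < 2 * (p ^ k + 1)"
proof -
  define a L q d' where "a = int p - 1" and "L = int (p ^ l)" and "q = int (p ^ (k - l))" and "d' = int d"
  have pk: "int (p ^ k) = q * L"
    using l unfolding q_def L_def of_nat_mult[symmetric] power_add[symmetric] by simp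
  have a: "a \<ge> 1" "int p = a + 1" using p by (auto simp: a_def)
  have "int (p ^ 2) \<le> L" unfolding L_def of_nat_le_iff using p l by (intro power_increasing) auto
  \<comment> \<open>Here l > 1 enters; for L = p the factor a L - 1 - a^2 - a below would be
    -1.\<close>
  then have L: "L \<ge> (a + 1)\<^sup>2" using a by simp
  have q: "q \<ge> 1" using p by (simp add: q_def)
  have d: "d' \<ge> 0" by (simp add: d'_def)
  have "int (p * p ^ l * d + p ^ k + 1) \<le> int (d * (p ^ l + 1) + p * p ^ k)" using le by linarith
  moreover have "q * int p ^ l = int p ^ k" using pk by (simp add: L_def)
  ultimately have "(a + 1) * L * d' + q * L + 1 \<le> d' * (L + 1) + (a + 1) * (q * L)"
    by (simp add: a(2)[symmetric] L_def d'_def) (simp add: algebra_simps)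
  then have le': "(a * L - 1) * d' \<le> a * q * L - 1" by (simp add: algebra_simps)
  have a2: "a * a \<ge> a" using a by (simp add: mult_le_cancel_left1)
  have aL: "a * L \<ge> L" using mult_right_mono[of 1 a L] a by (simp add: L_def)
  have L': "L \<ge> a * a + 2 * a + 1" using L by (simp add: power2_eq_square algebra_simps)
  have L0: "L \<ge> 0" by (simp add: L_def)
  have aL1: "0 \<le> a * L - 1" using aL L' a a2 by linarith
  \<comment> \<open>The negation times a L - 1 contradicts a + 1 times \<open>le'\<close>; all
    depends on the sign of a L - 1 - a^2 - a. The second bound follows the same pattern.\<close>
  have "(a + 1) * d' \<le> q * L"
  proof (rule ccontr)
    assume "\<not> ?thesis"
    then have "q * L + 1 \<le> (a + 1) * d'" by simp
    then have "(a * L - 1) * (q * L + 1) \<le> (a * L - 1) * ((a + 1) * d')"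
      by (rule mult_left_mono[OF _ aL1])
    also have "\<dots> = (a + 1) * ((a * L - 1) * d')" by (simp add: algebra_simps)
    also have "\<dots> \<le> (a + 1) * (a * q * L - 1)" using le' a by (intro mult_left_mono) auto
    finally have "q * L * (a * L - 1 - a * a - a) + a * L + a \<le> 0" by (simp add: algebra_simps)
    moreover have "q * L * (a * L - 1 - a * a - a) \<ge> 0"
      by (intro mult_nonneg_nonneg) (use q L0 L' a a2 aL in linarith)+
    moreover have "a * L \<ge> 0" using aL L' a a2 by linarith
    ultimately show False using a by linarith
  qed
  then have "int (p * d) \<le> int (p ^ k)" by (simp add: pk a(2)[symmetric] d'_def del: of_nat_power)
  then show "p * d < p ^ k + 1" by linarith
  have "(L + 1) * d' \<le> 2 * q * L + 1"
  proof (rule ccontr)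
    assume "\<not> ?thesis"
    then have "2 * q * L + 2 \<le> (L + 1) * d'" by simp
    then have "(a * L - 1) * (2 * q * L + 2) \<le> (a * L - 1) * ((L + 1) * d')"
      by (rule mult_left_mono[OF _ aL1])
    also have "\<dots> = (L + 1) * ((a * L - 1) * d')" by (simp add: algebra_simps)
    also have "\<dots> \<le> (L + 1) * (a * q * L - 1)" using le' L0 by (intro mult_left_mono) auto
    finally have "q * L * (a * L - a - 2) + 2 * (a * L) + L - 1 \<le> 0" by (simp add: algebra_simps)
    moreover have *: "a * L - a - 2 \<ge> 0"
    proof -
      have "a * (L - 1) \<ge> 1 * (L - 1)"
        by (rule mult_right_mono) (use a L' a2 in linarith)+
      then have "a * L - a \<ge> L - 1" by (simp add: right_diff_distrib)
      then show ?thesis using L' a a2 by linarith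
    qed
    moreover have "q * L * (a * L - a - 2) \<ge> 0"
      by (intro mult_nonneg_nonneg) (use q L0 * in linarith)+
    ultimately show False using aL L' a a2 by linarith
  qed
  then have "int (d * (p ^ l + 1)) \<le> int (2 * p ^ k + 1)"
    by (simp add: pk L_def d'_def mult.commute del: of_nat_power) (simp add: algebra_simps)
  then have "d * (p ^ l + 1) \<le> 2 * p ^ k + 1" by (simp only: of_nat_le_iff)
  then show "d * (p ^ l + 1) < 2 * (p ^ k + 1)" by (rule le_less_trans) simp
qed

section \<open>Comparing weights in the equation between the pulled back coordinates\<close>

context artin_schreier begin

text \<open>Frobenius gives (B + b y)^p = B^p + b^p y^p, and y^p = x^N - c y makes the result linear
  in y again.\<close>

lemma poly_power_p_linear:
  "ev [:B, b:] ^ p + cst c * ev [:B, b:] =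
     ev [:B ^ p + b ^ p * monom 1 N + [:c:] * B, [:c:] * b - [:c:] * b ^ p:]"
proof -
  have "ev [:B, b:] ^ p = E B ^ p + E b ^ p * y ^ p"
    using frobenius[of "E B" "y * E b" 1] by (simp add: ev_pCons power_mult_distrib mult.commute)
  also have "y ^ p = x ^ N - cst c * y" unfolding equation[symmetric] by simp
  finally show ?thesis
    by (simp only: ev_pCons E.hom_add E.hom_mult E.hom_power E.hom_minus E_monom E_const ev.hom_zero cst.hom_one)
      (simp add: algebra_simps)
qed

lemma weight_identity:
  assumes f: "degree f < p" "f \<noteq> 0" and g: "degree g < p" "g \<noteq> 0"
    and eq: "ev f ^ p + cst c * ev f = ev g ^ (p ^ l + 1)"
    and wt: "wt g = p * d" "wt f = d * (p ^ l + 1)"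
    and cop: "coprime d p" and l: "1 < l" "l < k"
  shows "d * (p ^ l + 1) = N"
proof -
  \<comment> \<open>p^l + 1 is 1 modulo p, so the weight is d modulo p.\<close>
  have ndvd: "\<not> p dvd wt f"
  proof -
    have "wt f = d + p * (d * p ^ (l - 1))" using l wt(2) by (cases l) (auto simp: algebra_simps)
    moreover have "\<not> p dvd d" using cop p_gt_1 by (metis coprime_absorb_right less_numeral_extra(4) nat_dvd_1_iff_1)
    ultimately show ?thesis by (metis dvd_add_left_iff dvd_triv_left)
  qed
  have Df: "D f \<noteq> 0" by (rule D_nz[OF f(2) ndvd])
  have "ev (f ^ p + [:[:c:]:] * f) = ev (g ^ (p ^ l + 1))"
    using eq by (simp only: ev.hom_add ev.hom_mult ev.hom_power ev_const E_const)
  from ev_D_cong[OF this] have "ev (D (f ^ p + [:[:c:]:] * f)) = ev (D (g ^ (p ^ l + 1)))" .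
  moreover have "D (f ^ p + [:[:c:]:] * f) = [:[:c:]:] * D f"
    by (simp only: D_add D_mult D_power D_const of_nat_p) simp
  moreover have "of_nat (p ^ l + 1) = (1 :: 'k poly poly)" using l by (simp add: power_0_left)
  then have "D (g ^ (p ^ l + 1)) = g ^ (p ^ l) * D g" unfolding D_power by simp
  ultimately have rel: "cst c * ev (D f) = ev g ^ (p ^ l) * ev (D g)"
    by (simp only: ev.hom_mult ev.hom_power ev_const E_const)
  have nz: "ev (D f) \<noteq> 0" "ev g \<noteq> 0" using ev_reduced_eq_0 degree_D f g Df by blast+
  then have "ev (D g) \<noteq> 0" using rel c_nz by auto
  then have Dg: "D g \<noteq> 0" by auto
  have "ord_at infinity (cst c * ev (D f)) = - int (wt (D f))"
    using inf.ord_mult[of "cst c" "ev (D f)"] inf.ord_unit[OF inf.const_unit[of "cst c"]] c_nz nz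
      inf.ord_ev[OF Df degree_D[OF f(1)]] by simp
  moreover have "ord_at infinity (ev g ^ (p ^ l) * ev (D g)) = - int (p ^ l * wt g) - int (wt (D g))"
    using inf.ord_mult[of "ev g ^ (p ^ l)" "ev (D g)"] inf.ord_power[of "ev g" "p ^ l"] nz \<open>ev (D g) \<noteq> 0\<close>
      inf.ord_ev[OF Dg degree_D[OF g(1)]] inf.ord_ev[OF g(2,1)] by simp
  ultimately have "int (wt (D f)) = int (p ^ l * wt g) + int (wt (D g))" using rel by simp
  then have "wt (D f) = p ^ l * wt g + wt (D g)" by (simp only: of_nat_add[symmetric] of_nat_eq_iff)
  \<comment> \<open>The term \<open>wt (D g)\<close> is discarded, and \<open>wt_D_le\<close> bounds
    \<open>wt (D f)\<close> from above.\<close>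
  then have "p * p ^ l * d + p ^ k + 1 \<le> d * (p ^ l + 1) + p * p ^ k"
    using wt_D_le[OF Df] wt by (simp add: mult_ac)
  note bounds = weight_bound_arith[OF p_gt_1 l this]
  have "coeff g j = 0" if "j > 0" for j
  proof (rule ccontr)
    assume "coeff g j \<noteq> 0"
    then have "N * j \<le> p * d" using wt_ge[of g j] wt by simp
    moreover have "N * 1 \<le> N * j" using that by (intro mult_le_mono2) simp
    ultimately have "N * 1 \<le> p * d" by (rule order_trans[rotated])
    then show False using bounds(1) by simp
  qed
  then have g_const: "g = [:coeff g 0:]" by (intro poly_eqI) (auto simp: coeff_pCons split: nat.splits)
  have f2: "coeff f j = 0" if "j > 1" for j
  proof (rule ccontr)
    assume "coeff f j \<noteq> 0"
    then have "N * j \<le> d * (p ^ l + 1)" using wt_ge[of f j] wt by simp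
    moreover have "N * 2 \<le> N * j" using that by (intro mult_le_mono2) simp
    ultimately have "N * 2 \<le> d * (p ^ l + 1)" by (rule order_trans[rotated])
    then show False using bounds(2) by simp
  qed
  define B b where "B = coeff f 0" and "b = coeff f 1"
  have f_lin: "f = [:B, b:]"
    using f2 by (intro poly_eqI) (auto simp: coeff_pCons B_def b_def split: nat.splits)
  have "ev [:B ^ p + b ^ p * monom 1 N + [:c:] * B, [:c:] * b - [:c:] * b ^ p:] = E (coeff g 0) ^ (p ^ l + 1)"
    using eq ev_const[of "coeff g 0"] unfolding g_const[symmetric] poly_power_p_linear[symmetric] f_lin[symmetric] by simp
  then have "ev ([:B ^ p + b ^ p * monom 1 N + [:c:] * B, [:c:] * b - [:c:] * b ^ p:] - [:coeff g 0 ^ (p ^ l + 1):]) = 0"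
    by (simp only: ev.hom_minus ev_const E.hom_power diff_self)
  moreover have "[:B ^ p + b ^ p * monom 1 N + [:c:] * B, [:c:] * b - [:c:] * b ^ p:] - [:coeff g 0 ^ (p ^ l + 1):] =
      [:B ^ p + b ^ p * monom 1 N + [:c:] * B - coeff g 0 ^ (p ^ l + 1), [:c:] * b - [:c:] * b ^ p:]"
    by (simp only: diff_pCons diff_0_right)
  ultimately have "ev [:B ^ p + b ^ p * monom 1 N + [:c:] * B - coeff g 0 ^ (p ^ l + 1), [:c:] * b - [:c:] * b ^ p:] = 0"
    by simp
  then have "[:B ^ p + b ^ p * monom 1 N + [:c:] * B - coeff g 0 ^ (p ^ l + 1), [:c:] * b - [:c:] * b ^ p:] = 0"
    by (rule ev_reduced_eq_0[rotated]) (use p_gt_1 in \<open>auto intro: le_less_trans[OF degree_pCons_le]\<close>)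
  then have "[:c:] * b = [:c:] * b ^ p" by simp
  then have "[:inverse c:] * ([:c:] * b) = [:inverse c:] * ([:c:] * b ^ p)" by simp
  then have bp: "b = b ^ p" using c_nz by simp
  obtain j where j: "coeff f j \<noteq> 0" "wt f = p * degree (coeff f j) + N * j"
    using wt_attained[OF f(2)] .
  \<comment> \<open>The dominant monomial of f contains y: for j = 0 its weight would be a multiple
    of p.\<close>
  have "j \<noteq> 0" using ndvd j(2) by (metis add.right_neutral dvd_triv_left mult_0_right)
  then have "j = 1" using f2[of j] j(1) by linarith
  then have "b \<noteq> 0" using j(1) by (simp add: b_def)
  have "degree b = p * degree b" using arg_cong[OF bp, of degree] degree_power_eq[OF \<open>b \<noteq> 0\<close>, of p] by simp
  then have "degree b = 0" using p_gt_1 by simp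
  then show ?thesis using j(2) \<open>j = 1\<close> wt(2) by (simp add: b_def)
qed

end

section \<open>Morphisms between two curves\<close>

context artin_schreier begin

lemma ord_infinity_x: "ord_at infinity x = - int p"
  using inf.ord_E[of "[:0, 1:]"] by simp

lemma ev_y_const: "ev [:[:- b:], 1:] = y - cst b"
  by (simp add: ev_pCons E.hom_uminus cst.hom_uminus)

lemma wt_y_const: "wt [:[:- b:], 1:] = N"
proof -
  obtain j where j: "coeff [:[:- b:], 1:] j \<noteq> 0"
    "wt [:[:- b:], 1:] = p * degree (coeff [:[:- b:], 1:] j) + N * j"
    using wt_attained[of "[:[:- b:], 1:]"] by auto
  then have "j \<le> 1" using le_degree by fastforce
  moreover have "N \<le> wt [:[:- b:], 1:]" using wt_ge[of "[:[:- b:], 1:]" 1] by simp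
  ultimately show ?thesis using j(2) by (cases j) auto
qed

lemma ord_infinity_y_const: "ord_at infinity (y - cst b) = - int N"
  using inf.ord_ev[of "[:[:- b:], 1:]"] p_gt_1 by (simp add: wt_y_const ev_y_const)

lemma ord_infinity_y: "ord_at infinity y = - int N"
  using ord_infinity_y_const[of 0] by simp

lemma y_neq_const: "y \<noteq> cst b"
  using ev_reduced_eq_0[of "[:[:- b:], 1:]"] p_gt_1 by (auto simp: ev_y_const)

end

text \<open>Both function fields contain the same x of the ambient field, but a morphism acts
  through a map \<open>sg\<close> that need not fix x.\<close>

locale two_curves = A: artin_schreier cst x y p k c + B: artin_schreier cst x y' p l c
  for cst :: "'k::alg_closed_field \<Rightarrow> 'f::field" and x y y' p k l c

subsection \<open>The morphism \<open>(x, y) \<mapsto> (x^m, y)\<close>\<close>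

locale power_morphism = two_curves cst x y y' p k l c
  for cst :: "'k::alg_closed_field \<Rightarrow> 'f::field" and x y y' p k l c +
  fixes m assumes m: "p ^ k + 1 = m * (p ^ l + 1)"
begin

text \<open>\<open>E'\<close> and \<open>ev'\<close> evaluate polynomials on the target curve at the
  functions x^m and y of the source curve.\<close>

definition E' :: "'k poly \<Rightarrow> 'f" where "E' h = A.E (pcompose h (monom 1 m))"

definition ev' :: "'k poly poly \<Rightarrow> 'f" where "ev' g = poly (map_poly E' g) y"

text \<open>A fraction g(x, y') / h(x) is sent to g(x^m, y) / h(x^m), for an arbitrarily chosen
  representation; \<open>sg_quotient\<close> shows that the choice is immaterial.\<close>

definition sg :: "'f \<Rightarrow> 'f" where
  "sg f = (case SOME (g, h). h \<noteq> 0 \<and> f = B.ev g / B.E h of (g, h) \<Rightarrow> ev' g / E' h)"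

lemma m_pos: "m > 0" using m by (cases m) auto

lemma E'_hom: "comm_ring_hom E'"
  by unfold_locales (simp_all add: E'_def pcompose_add pcompose_mult pcompose_1 A.E.hom_add A.E.hom_mult)

sublocale E': comm_ring_hom E' by (rule E'_hom)

sublocale ev': comm_ring_hom ev'
  unfolding ev'_def[abs_def] by (rule comm_ring_hom_eval_map_poly[OF E'_hom])

lemma E'_eq_0_iff [simp]: "E' h = 0 \<longleftrightarrow> h = 0"
  using pcompose_eq_0[of h "monom 1 m"] m_pos by (auto simp: E'_def degree_monom_eq)

lemma E'_const [simp]: "E' [:a:] = cst a" by (simp add: E'_def)

lemma E'_x: "E' [:0, 1:] = x ^ m" by (simp add: E'_def pcompose_pCons A.E_monom)

lemma ev'_const [simp]: "ev' [:h:] = E' h" by (simp add: ev'_def Polynomial.map_poly_pCons)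

lemma ev'_pCons: "ev' (pCons h g) = E' h + y * ev' g" by (simp add: ev'_def Polynomial.map_poly_pCons)

lemma ev'_smult: "ev' (smult h g) = E' h * ev' g" using ev'.hom_mult[of "[:h:]" g] by simp

lemma ev'_rel: "ev' B.rel = 0"
proof -
  have "ev' (monom 1 p) = y ^ p" by (simp add: ev'_def map_poly_monom poly_monom)
  moreover have "E' (monom 1 (p ^ l + 1)) = (x ^ m) ^ (p ^ l + 1)"
    using E'.hom_power[of "[:0, 1:]" "p ^ l + 1"] by (simp add: E'_x monom_altdef)
  moreover have "(x ^ m) ^ (p ^ l + 1) = x ^ (p ^ k + 1)" unfolding m power_mult ..
  ultimately show ?thesis
    using A.equation by (simp add: B.rel_def ev'.hom_add ev'_pCons E'.hom_uminus algebra_simps del: power_Suc)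
qed

text \<open>After cross-multiplication two representations differ by a multiple of
  \<open>B.rel\<close>, which \<open>ev'\<close> annihilates because (x^m)^(p^l + 1) = x^(p^k +
  1).\<close>

lemma sg_quotient:
  assumes "h \<noteq> 0" shows "sg (B.ev g / B.E h) = ev' g / E' h"
proof -
  let ?P = "\<lambda>(g', h'). h' \<noteq> 0 \<and> B.ev g / B.E h = B.ev g' / B.E h'"
  obtain g' h' where gh: "(SOME gh. ?P gh) = (g', h')" by (cases "SOME gh. ?P gh")
  have "?P (SOME gh. ?P gh)" by (rule someI[of ?P "(g, h)"]) (use assms in auto)
  then have gh': "h' \<noteq> 0" "B.ev g / B.E h = B.ev g' / B.E h'" unfolding gh by auto
  then have "B.ev (smult h' g - smult h g') = 0"
    using assms by (simp add: B.ev.hom_minus B.ev_smult field_simps)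
  then obtain q where "smult h' g - smult h g' = B.rel * q" by (auto simp: B.ev_eq_0_iff_rel dvd_def)
  then have "ev' (smult h' g - smult h g') = 0" by (simp add: ev'.hom_mult ev'_rel)
  then have "E' h' * ev' g = E' h * ev' g'" by (simp add: ev'.hom_minus ev'_smult)
  then have "ev' g / E' h = ev' g' / E' h'" using assms gh' by (simp add: field_simps)
  then show ?thesis unfolding sg_def gh by simp
qed

lemma sg_ev: "sg (B.ev g) = ev' g" using sg_quotient[of 1 g] by simp
lemma sg_E: "sg (B.E h) = E' h" using sg_ev[of "[:h:]"] by simp
lemma sg_x: "sg x = x ^ m" using sg_E[of "[:0, 1:]"] by (simp add: E'_x)
lemma sg_y: "sg y' = y" using sg_ev[of "[:0, 1:]"] by (simp add: ev'_pCons)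
lemma sg_cst: "sg (cst a) = cst a" using sg_E[of "[:a:]"] by simp

lemma E'_F: "E' h \<in> A.F" by (simp add: E'_def)

lemma ev'_F: "ev' g \<in> A.F"
  by (induction g) (auto simp: ev'_pCons E'_F)

lemma comorphism_sg: "comorphism (range cst) A.F B.F sg (\<lambda>P. {g \<in> B.F. sg g \<in> P})"
proof (rule comorphism_comap[OF A.nonsingular_curve B.nonsingular_curve])
  show "sg g \<in> A.F" if gB: "g \<in> B.F" for g
  proof -
    obtain q h where "g = B.ev q / B.E h" "h \<noteq> 0" using B.F_reduced[OF gB] by metis
    then show ?thesis using sg_quotient ev'_F E'_F by auto
  qed
  show "sg a = a" if "a \<in> range cst" for a using that sg_cst by auto
  fix f1 f2 assume f: "f1 \<in> B.F" "f2 \<in> B.F"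
  obtain g1 h1 where 1: "f1 = B.ev g1 / B.E h1" "h1 \<noteq> 0" using B.F_reduced[OF f(1)] by metis
  obtain g2 h2 where 2: "f2 = B.ev g2 / B.E h2" "h2 \<noteq> 0" using B.F_reduced[OF f(2)] by metis
  have nz: "h1 * h2 \<noteq> 0" using 1 2 by simp
  have "f1 + f2 = B.ev (smult h2 g1 + smult h1 g2) / B.E (h1 * h2)"
    using 1 2 by (simp add: B.ev.hom_add B.ev_smult A.E.hom_mult add_divide_distrib mult.commute)
  then have "sg (f1 + f2) = ev' (smult h2 g1 + smult h1 g2) / E' (h1 * h2)"
    using sg_quotient[OF nz] by metis
  also have "\<dots> = ev' g1 / E' h1 + ev' g2 / E' h2"
    using 1 2 by (simp add: ev'.hom_add ev'_smult E'.hom_mult add_divide_distrib mult.commute)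
  finally show "sg (f1 + f2) = sg f1 + sg f2" using 1 2 sg_quotient by metis
  have "f1 * f2 = B.ev (g1 * g2) / B.E (h1 * h2)"
    using 1 2 by (simp add: B.ev.hom_mult A.E.hom_mult)
  then have "sg (f1 * f2) = ev' (g1 * g2) / E' (h1 * h2)"
    using sg_quotient[OF nz] by metis
  also have "\<dots> = (ev' g1 / E' h1) * (ev' g2 / E' h2)"
    by (simp add: ev'.hom_mult E'.hom_mult)
  finally show "sg (f1 * f2) = sg f1 * sg f2" using 1 2 sg_quotient by metis
qed

definition \<rho> where "\<rho> P = {g \<in> B.F. sg g \<in> P}"

sublocale \<rho>: comorphism "range cst" A.F B.F sg \<rho>
  using comorphism_sg unfolding \<rho>_def[abs_def] .

lemma ord_x_power: "ord_at A.infinity (x ^ n) = - int (n * p)"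
  using A.inf.ord_power[of x n] A.ord_infinity_x by simp

lemma \<rho>_infinity: "\<rho> A.infinity = B.infinity"
proof (rule B.infinity_eqI)
  show "\<rho> A.infinity \<in> B.points" by (rule \<rho>.\<phi>_points[OF A.infinity_point])
  have "ord_at A.infinity (x ^ m) < 0"
    unfolding ord_x_power using m_pos A.p_gt_1 by simp
  then have "x ^ m \<notin> A.infinity"
    using A.inf.mem_P_iff_ord[of "x ^ m"] by simp
  then show "x \<notin> \<rho> A.infinity" by (simp add: \<rho>_def sg_x)
qed

lemma ramification_\<rho>: "ramification_index (range cst) A.F \<rho> A.infinity = m"
proof -
  have "- int (m * p) = int (ramification_index (range cst) A.F \<rho> A.infinity) * (- int p)"
    using \<rho>.ord_sg(1)[OF A.infinity_point, of x] ord_x_power[of m] B.ord_infinity_x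
    by (simp add: sg_x \<rho>_infinity)
  then have "int (p * m) = int (p * ramification_index (range cst) A.F \<rho> A.infinity)" by (simp add: mult.commute)
  then have "p * m = p * ramification_index (range cst) A.F \<rho> A.infinity" by (simp only: of_nat_eq_iff)
  then show ?thesis using A.p_gt_1 by (metis mult_left_cancel not_one_less_zero)
qed

text \<open>x - a divides x^m - a^m, so every polynomial in x divides a polynomial in x^m.
  Denominators can thus be moved into the image field.\<close>

lemma multiple_in_image: "h \<noteq> 0 \<Longrightarrow> \<exists>h1 h2. h2 \<noteq> 0 \<and> A.E h * A.E h1 = E' h2"
proof (induction "degree h" arbitrary: h)
  case 0
  then obtain d where d: "h = [:d:]" by (metis degree_eq_zeroE)
  then show ?case using 0 by (intro exI[of _ 1] exI[of _ "[:d:]"]) auto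
next
  case (Suc n)
  then obtain a where a: "poly h a = 0" using alg_closed_imp_poly_has_root[of h] by auto
  obtain h' where h': "h = [:- a, 1:] * h'" using a by (metis poly_eq_0_iff_dvd dvd_def)
  have nz: "h' \<noteq> 0" using Suc.prems h' by auto
  have "degree h = Suc (degree h')" unfolding h' using nz by (subst degree_mult_eq) auto
  then have n: "n = degree h'" using Suc.hyps(2) by simp
  obtain h1 h2 where IH: "h2 \<noteq> 0" "A.E h' * A.E h1 = E' h2" using Suc.hyps(1)[OF n nz] by blast
  have "poly (monom 1 m - [:a ^ m:]) a = 0" by (simp add: poly_monom)
  then obtain q where q: "monom 1 m - [:a ^ m:] = [:- a, 1:] * q" by (metis poly_eq_0_iff_dvd dvd_def)
  have "A.E [:- a, 1:] * A.E q = x ^ m - cst (a ^ m)"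
    unfolding A.E.hom_mult[symmetric] q[symmetric] by (simp add: A.E.hom_minus A.E_monom)
  also have "\<dots> = E' [:- (a ^ m), 1:]"
    using E'.hom_add[of "[:- (a ^ m):]" "[:0, 1:]"] by (simp add: E'_x A.cst.hom_uminus)
  finally have eq: "A.E [:- a, 1:] * A.E q = E' [:- (a ^ m), 1:]" .
  have "A.E h * A.E (q * h1) = (A.E [:- a, 1:] * A.E q) * (A.E h' * A.E h1)"
    unfolding h' A.E.hom_mult by (simp only: mult_ac)
  also have "\<dots> = E' ([:- (a ^ m), 1:] * h2)" unfolding eq IH(2) E'.hom_mult ..
  finally have "A.E h * A.E (q * h1) = E' ([:- (a ^ m), 1:] * h2)" .
  moreover have "[:- (a ^ m), 1:] * h2 \<noteq> 0" using IH(1) by (simp del: mult_pCons_left)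
  ultimately show ?case by blast
qed

text \<open>The powers 1, x, ..., x^(m - 1) form a basis. Their pole orders i p are distinct modulo
  the ramification index m, since m divides p^k + 1 and is prime to p; they span because y and all
  denominators are available in the image field.\<close>

lemma degree_\<rho>: "morphism_degree (range cst) A.F B.F \<rho> = m"
proof -
  interpret R: field "ring_of_type_algebra :: 'f ring" by (rule field_from_type_algebra)
  let ?Us = "map ((^) x) (rev [0..<m])"
  have cop: "coprime m p"
  proof (rule coprimeI)
    fix d assume d: "d dvd m" "d dvd p"
    have "d dvd p ^ k" using d(2) A.k_pos by (metis dvd_power dvd_trans)
    moreover have "d dvd p ^ k + 1" using d(1) m by simp
    ultimately have "d dvd 1" by (metis dvd_add_right_iff)
    then show "is_unit d" .
  qed
  have "R.independent (sg ` B.F) ?Us"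
  proof (rule independent_rev_uptI[OF \<rho>.subfield_image])
    fix n a assume n: "n < m" and a: "\<And>i. i < n \<Longrightarrow> a i \<in> sg ` B.F"
    show "x ^ n \<noteq> (\<Sum>i<n. a i * x ^ i)"
    proof (rule \<rho>.not_sum_if_distinct_orders[OF A.infinity_point])
      show "inj_on (\<lambda>i. ord_at A.infinity (x ^ i) mod int (ramification_index (range cst) A.F \<rho> A.infinity)) {..n}"
      proof (rule inj_onI)
        fix i j assume ij: "i \<in> {..n}" "j \<in> {..n}"
          "ord_at A.infinity (x ^ i) mod int (ramification_index (range cst) A.F \<rho> A.infinity) =
           ord_at A.infinity (x ^ j) mod int (ramification_index (range cst) A.F \<rho> A.infinity)"
        then have "int m dvd (- int (i * p)) - (- int (j * p))"
          by (simp add: ramification_\<rho> ord_x_power mod_eq_dvd_iff)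
        then have "int m dvd (int j - int i) * int p" by (simp add: algebra_simps)
        then have "int m dvd int j - int i"
          using cop by (simp add: coprime_dvd_mult_left_iff)
        moreover have "\<bar>int j - int i\<bar> < int m" using ij n by auto
        ultimately show "i = j" using zdvd_not_zless[of "\<bar>int j - int i\<bar>" "int m"] by fastforce
      qed
    qed (use a in auto)
  qed
  then have dim: "R.dimension m (sg ` B.F) (R.Span (sg ` B.F) ?Us)"
    using R.dimension_independent[of "sg ` B.F" ?Us] by simp
  define S where "S = R.Span (sg ` B.F) ?Us"
  have S_iff: "v \<in> S \<longleftrightarrow> (\<exists>a. (\<forall>i<m. a i \<in> sg ` B.F) \<and> v = (\<Sum>i<m. a i * x ^ i))" for v
    unfolding S_def by (rule Span_rev_upt_iff[OF \<rho>.subfield_image])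
  interpret I: field_subset "sg ` B.F" by (rule field_subset.intro[OF \<rho>.subfield_image])
  have S_add: "u + v \<in> S" if "u \<in> S" "v \<in> S" for u v
    using that R.Span_subgroup_props(3)[OF \<rho>.subfield_image, of ?Us u v] by (simp add: S_def del: R.Span.simps)
  have S_smult: "u * v \<in> S" if "u \<in> sg ` B.F" "v \<in> S" for u v
    using that R.Span_smult_closed[OF \<rho>.subfield_image, of ?Us u v] by (simp add: S_def del: R.Span.simps)
  have S_0: "0 \<in> S"
    using R.Span_subgroup_props(2)[OF \<rho>.subfield_image, of ?Us] by (simp add: S_def del: R.Span.simps)
  have S_sum: "sum g J \<in> S" if "\<And>j. j \<in> J \<Longrightarrow> g j \<in> S" for g :: "nat \<Rightarrow> 'f" and J
    using that by (induction J rule: infinite_finite_induct) (auto intro: S_0 S_add)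
  have S_x: "x ^ i \<in> S" for i
  proof -
    have "(\<Sum>j<m. (if j = i mod m then (1::'f) else 0) * x ^ j) = (\<Sum>j<m. if j = i mod m then x ^ j else 0)"
      by (rule sum.cong) auto
    also have "\<dots> = x ^ (i mod m)" using m_pos by simp
    finally have "x ^ (i mod m) = (\<Sum>j<m. (if j = i mod m then (1::'f) else 0) * x ^ j)" ..
    then have xS: "x ^ (i mod m) \<in> S" unfolding S_iff
      by (intro exI[of _ "\<lambda>j. if j = i mod m then (1::'f) else 0"]) auto
    have "x ^ m \<in> sg ` B.F" by (rule image_eqI[of _ _ x]) (auto simp: sg_x)
    then have "(x ^ m) ^ (i div m) \<in> sg ` B.F" by (rule I.closed_power)
    then have "(x ^ m) ^ (i div m) * x ^ (i mod m) \<in> S" using xS by (rule S_smult)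
    then show ?thesis by (simp flip: power_mult power_add)
  qed
  have S_ev: "A.ev g \<in> S" for g
    unfolding A.ev_sum
  proof (rule S_sum)
    fix j
    have "y \<in> sg ` B.F" by (rule image_eqI[of _ _ y']) (auto simp: sg_y)
    then have "y ^ j \<in> sg ` B.F" by (rule I.closed_power)
    moreover have "A.E (coeff g j) \<in> S" unfolding A.E_sum
    proof (rule S_sum)
      fix i have "cst (coeff (coeff g j) i) \<in> sg ` B.F"
        by (rule image_eqI[of _ _ "cst (coeff (coeff g j) i)"]) (auto simp: sg_cst)
      then show "cst (coeff (coeff g j) i) * x ^ i \<in> S" by (rule S_smult[OF _ S_x])
    qed
    ultimately show "A.E (coeff g j) * y ^ j \<in> S" using S_smult[of "y ^ j" "A.E (coeff g j)"] by (simp add: mult.commute)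
  qed
  have "A.F \<subseteq> S"
  proof
    fix f assume "f \<in> A.F"
    then obtain g h where gh: "f = A.ev g / A.E h" "h \<noteq> 0" using A.F_reduced by metis
    obtain h1 h2 where h: "h2 \<noteq> 0" "A.E h * A.E h1 = E' h2" using multiple_in_image[OF gh(2)] by blast
    have "A.E h1 \<noteq> 0" using h by auto
    then have "f = inverse (E' h2) * A.ev (smult h1 g)"
      unfolding gh(1) h(2)[symmetric] A.ev_smult using gh(2) by (simp add: field_simps)
    moreover have "E' h2 \<in> sg ` B.F" by (rule image_eqI[of _ _ "B.E h2"]) (auto simp: sg_E)
    then have "inverse (E' h2) \<in> sg ` B.F" by (rule I.closed_basic(6))
    ultimately show "f \<in> S" using S_smult S_ev by simp
  qed
  moreover have "S \<subseteq> A.F"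
  proof
    fix v assume "v \<in> S"
    then obtain a where a: "\<forall>i<m. a i \<in> sg ` B.F" "v = (\<Sum>i<m. a i * x ^ i)" using S_iff by blast
    then show "v \<in> A.F" using \<rho>.sg_F by (auto intro!: A.F.closed_sum)
  qed
  ultimately have "R.dimension m (sg ` B.F) A.F" using dim by (simp add: S_def)
  then show ?thesis
    unfolding \<rho>.morphism_degree_eq by (rule R.dimI[OF \<rho>.subfield_image])
qed

lemma morphism_exists:
  "\<exists>\<rho>. curve_morphism (range cst) A.F B.F \<rho> \<and> nonconstant (range cst) A.F \<rho> \<and>
     \<rho> A.infinity = B.infinity \<and> totally_ramified_at (range cst) A.F B.F \<rho> A.infinity \<and>
     morphism_degree (range cst) A.F B.F \<rho> = m"
  using \<rho>.curve_morphism \<rho>.nonconstant \<rho>_infinity ramification_\<rho> degree_\<rho>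
  by (intro exI[of _ \<rho>]) (simp add: totally_ramified_at_def)

end

subsection \<open>Totally ramified morphisms\<close>

text \<open>Translates to the list polynomials used by \<open>algebraic\<close>, whose leading
  coefficient comes first; hence the reversal of \<open>coeffs\<close>.\<close>

lemma algebraic_type_algebraI:
  fixes Q :: "'f::field poly"
  assumes "\<And>i. coeff Q i \<in> E" "Q \<noteq> 0" "poly Q z = 0"
  shows "(ring.algebraic ring_of_type_algebra over E) z"
proof -
  interpret R: field "ring_of_type_algebra :: 'f ring" by (rule field_from_type_algebra)
  have pow: "a [^]\<^bsub>ring_of_type_algebra\<^esub> n = a ^ n" for a :: 'f and n :: nat
    by (induction n) (simp_all add: mult.commute)
  have eval: "R.eval cs z = (\<Sum>i<length cs. rev cs ! i * z ^ i)" for cs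
  proof (induction cs)
    case (Cons a cs)
    have "(\<Sum>i<length cs. rev (a # cs) ! i * z ^ i) = (\<Sum>i<length cs. rev cs ! i * z ^ i)"
      by (rule sum.cong) (auto simp: nth_append)
    then show ?case using Cons by (simp add: pow nth_append add.commute)
  qed simp
  have "R.eval (rev (coeffs Q)) z = poly Q z"
    unfolding eval poly_altdef
    using assms(2) by (auto simp: length_coeffs_degree nth_coeffs_coeff lessThan_Suc_atMost intro!: sum.cong)
  moreover have "set (rev (coeffs Q)) \<subseteq> E"
    using assms(1) by (auto simp: coeffs_def)
  moreover have "Polynomials.lead_coeff (rev (coeffs Q)) \<noteq> 0" "rev (coeffs Q) \<noteq> []"
    using assms(2) by (auto simp: hd_rev last_coeffs_eq_coeff_degree)
  ultimately show ?thesis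
    using assms(3)
    by (intro R.algebraicI[of "rev (coeffs Q)"]) (auto simp: univ_poly_def polynomial_def)
qed

section \<open>Finiteness of the extension and the degree under total ramification\<close>

context two_curves
begin

text \<open>A relation for \<open>x1 = sg x\<close> over K[x] is also one for x over K[x1]. So x is
  algebraic over the image field, y is algebraic over its extension by x through the equation, and
  the tower is finite.\<close>

lemma finite_extension_pullback:
  assumes "comorphism (range cst) A.F B.F sg \<phi>"
  shows "\<exists>n. ring.dimension ring_of_type_algebra n (sg ` B.F) A.F"
proof -
  interpret S: comorphism "range cst" A.F B.F sg \<phi> by fact
  interpret R: field "ring_of_type_algebra :: 'f ring" by (rule field_from_type_algebra)
  define G where "G = sg ` B.F"
  have sf: "subfield G ring_of_type_algebra" unfolding G_def by (rule S.subfield_image)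
  interpret G: field_subset G by (rule field_subset.intro[OF sf])
  have G_I: "sg g \<in> G" if "g \<in> B.F" for g using that by (simp add: G_def)
  have cst_G: "cst a \<in> G" for a using G_I[of "cst a"] S.sg_const[of "cst a"] by simp
  have GF: "G \<subseteq> A.F" using S.sg_F by (auto simp: G_def)
  define x1 where "x1 = sg x"
  have X_G: "x1 \<in> G" by (simp add: x1_def G_I)
  have eval_X: "poly (map_poly cst h) x1 = sg (A.E h)" for h
  proof (induction h)
    case 0
    then show ?case by simp
  next
    case (pCons a h)
    then show ?case
      by (simp add: Polynomial.map_poly_pCons A.E_pCons S.sg_add S.sg_mult S.sg_const x1_def)
  qed
  obtain r where r: "r \<noteq> 0" "poly (map_poly A.E r) x1 = 0"
    using A.algebraic[of x1] unfolding A.E_def[abs_def] by blast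
  \<comment> \<open>Transposes the relation: the coefficients of x^i are collected into a polynomial
    to be evaluated at \<open>x1\<close>.\<close>
  define c' where "c' i = map_poly (\<lambda>h. coeff h i) r" for i
  define n where "n = Max ((\<lambda>j. degree (coeff r j)) ` {..degree r})"
  define Q where "Q = (\<Sum>i\<le>n. monom (poly (map_poly cst (c' i)) x1) i)"
  have degn: "degree (coeff r j) \<le> n" if "j \<le> degree r" for j
    unfolding n_def by (rule Max_ge) (use that in auto)
  have coeff_Q: "coeff Q i = (if i \<le> n then poly (map_poly cst (c' i)) x1 else 0)" for i
    by (simp add: Q_def coeff_sum)
  have c'_X: "poly (map_poly cst (c' i)) x1 = (\<Sum>j\<le>degree r. cst (coeff (coeff r j) i) * x1 ^ j)" for i
  proof -
    have "degree (map_poly cst (c' i)) \<le> degree r"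
      unfolding c'_def by (rule order_trans[OF degree_map_poly_le degree_map_poly_le])
    then have "poly (map_poly cst (c' i)) x1 = (\<Sum>j\<le>degree r. coeff (map_poly cst (c' i)) j * x1 ^ j)"
      unfolding poly_altdef
      by (intro sum.mono_neutral_left) (auto simp: coeff_map_poly intro!: le_degree)
    then show ?thesis by (simp add: coeff_map_poly c'_def)
  qed
  have "poly Q x = (\<Sum>i\<le>n. \<Sum>j\<le>degree r. cst (coeff (coeff r j) i) * x1 ^ j * x ^ i)"
    by (simp add: Q_def poly_sum poly_monom c'_X sum_distrib_right)
  also have "\<dots> = (\<Sum>j\<le>degree r. \<Sum>i\<le>n. cst (coeff (coeff r j) i) * x1 ^ j * x ^ i)"
    by (rule sum.swap)
  also have "\<dots> = (\<Sum>j\<le>degree r. A.E (coeff r j) * x1 ^ j)"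
  proof (rule sum.cong[OF refl])
    fix j assume j: "j \<in> {..degree r}"
    have "A.E (coeff r j) = (\<Sum>i\<le>n. cst (coeff (coeff r j) i) * x ^ i)"
      unfolding A.E_sum using degn[of j] j by (intro sum.mono_neutral_left) (auto simp: coeff_eq_0)
    then show "(\<Sum>i\<le>n. cst (coeff (coeff r j) i) * x1 ^ j * x ^ i) = A.E (coeff r j) * x1 ^ j"
      by (simp add: sum_distrib_right sum_distrib_left mult_ac)
  qed
  also have "\<dots> = poly (map_poly A.E r) x1"
    unfolding poly_altdef using degree_map_poly_le[of A.E r]
    by (intro sum.mono_neutral_cong_right) (auto simp: coeff_map_poly intro!: le_degree)
  finally have Qx: "poly Q x = 0" using r(2) by simp
  \<comment> \<open>Injectivity of \<open>sg\<close> makes \<open>x1\<close> transcendental over the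
    constants, so a nonzero \<open>c' i\<close> does not vanish at \<open>x1\<close>.\<close>
  have "Q \<noteq> 0"
  proof -
    obtain j where j: "coeff r j \<noteq> 0" "j \<le> degree r" using r(1) by (metis leading_coeff_0_iff order_refl)
    define i where "i = degree (coeff r j)"
    have "coeff (c' i) j \<noteq> 0" using j by (simp add: c'_def i_def coeff_map_poly)
    then have "c' i \<noteq> 0" by auto
    then have "sg (A.E (c' i)) \<noteq> 0" using S.sg_eq_0_iff[of "A.E (c' i)"] B.E_F[of "c' i"] by simp
    then have "coeff Q i \<noteq> 0" using degn[OF j(2)] by (simp add: coeff_Q eval_X i_def)
    then show ?thesis by auto
  qed
  moreover have "coeff Q i \<in> G" for i using B.E_F by (simp add: coeff_Q eval_X G_I)
  ultimately have alg_x: "(R.algebraic over G) x" using Qx by (intro algebraic_type_algebraI[of Q])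
  define G1 where "G1 = R.simple_extension G x"
  have sf1: "subfield G1 ring_of_type_algebra"
    unfolding G1_def using R.simple_extension_is_subfield[OF sf, of x] alg_x by simp
  interpret G1: field_subset G1 by (rule field_subset.intro[OF sf1])
  have G_G1: "G \<subseteq> G1" unfolding G1_def by (rule R.simple_extension_incl) simp_all
  have x_G1: "x \<in> G1" unfolding G1_def by (rule R.simple_extension_mem[OF G.subring]) simp
  define q where "q = monom 1 p + [:- (x ^ (p ^ k + 1)), cst c:]"
  have "coeff q i \<in> G1" for i
    using cst_G[of c] G_G1 x_G1 by (auto simp: q_def coeff_pCons coeff_monom split: nat.splits)
  moreover have "coeff [:- (x ^ (p ^ k + 1)), cst c:] p = 0"
    using A.p_gt_1 by (intro coeff_eq_0) (auto intro: le_less_trans[OF degree_pCons_le])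
  then have "coeff q p \<noteq> 0" by (simp add: q_def)
  then have "q \<noteq> 0" by auto
  moreover have "poly q y = 0" using A.equation by (simp add: q_def poly_monom algebra_simps)
  ultimately have alg_y: "(R.algebraic over G1) y" by (intro algebraic_type_algebraI[of q])
  define G2 where "G2 = R.simple_extension G1 y"
  have sf2: "subfield G2 ring_of_type_algebra"
    unfolding G2_def using R.simple_extension_is_subfield[OF sf1, of y] alg_y by simp
  have G1_G2: "G1 \<subseteq> G2" unfolding G2_def by (rule R.simple_extension_incl) simp_all
  have y_G2: "y \<in> G2" unfolding G2_def by (rule R.simple_extension_mem[OF G1.subring]) simp
  have "G1 \<subseteq> A.F" unfolding G1_def by (rule R.simple_extension_subring_incl[OF A.F.subring GF A.x_F])
  then have "G2 \<subseteq> A.F" unfolding G2_def by (rule R.simple_extension_subring_incl[OF A.F.subring _ A.y_F])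
  moreover have "A.F \<subseteq> G2" unfolding A.F_def
    by (rule R.generate_field_min_subfield1[OF _ sf2]) (use cst_G G_G1 G1_G2 x_G1 y_G2 in auto)
  ultimately have "G2 = A.F" by blast
  moreover have "R.finite_dimension G G2"
  proof (rule R.telescopic_base_dim(1)[OF sf sf1])
    show "R.finite_dimension G G1"
      unfolding G1_def using R.finite_dimension_simple_extension[OF sf, of x] alg_x by simp
    show "R.finite_dimension G1 G2"
      unfolding G2_def using R.finite_dimension_simple_extension[OF sf1, of y] alg_y by simp
  qed
  ultimately show ?thesis unfolding R.finite_dimension_def G_def by simp
qed

lemma totally_ramified_degree:
  assumes mor: "curve_morphism (range cst) A.F B.F \<phi>" "nonconstant (range cst) A.F \<phi>"
    and inf: "\<phi> A.infinity = B.infinity"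
    and ram: "totally_ramified_at (range cst) A.F B.F \<phi> A.infinity"
    and cop: "coprime (morphism_degree (range cst) A.F B.F \<phi>) p"
    and l: "1 < l" "l < k"
  shows "morphism_degree (range cst) A.F B.F \<phi> * (p ^ l + 1) = p ^ k + 1"
proof -
  define sg where "sg = pullback (range cst) A.F \<phi>"
  have co: "comorphism (range cst) A.F B.F sg \<phi>"
    unfolding sg_def by (rule comorphism_pullback[OF A.nonsingular_curve B.nonsingular_curve mor])
  interpret S: comorphism "range cst" A.F B.F sg \<phi> by (rule co)
  interpret R: field "ring_of_type_algebra :: 'f ring" by (rule field_from_type_algebra)
  define d where "d = morphism_degree (range cst) A.F B.F \<phi>"
  have ram_d: "ramification_index (range cst) A.F \<phi> A.infinity = d"
    using ram by (simp add: totally_ramified_at_def d_def)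
  \<comment> \<open>The degree is known to be an actual dimension only once the extension is
    finite.\<close>
  have dim: "R.dimension d (sg ` B.F) A.F"
  proof -
    obtain n where "R.dimension n (sg ` B.F) A.F" using finite_extension_pullback[OF co] by blast
    moreover from this have "d = n"
      unfolding d_def S.morphism_degree_eq by (rule R.dimI[OF S.subfield_image])
    ultimately show ?thesis by simp
  qed
  \<comment> \<open>A second point over infinity would force the degree above the ramification index
    at infinity.\<close>
  have fibre: "\<phi> P \<noteq> B.infinity" if P: "P \<in> A.points" "P \<noteq> A.infinity" for P
  proof
    assume *: "\<phi> P = B.infinity"
    obtain a b where "as_affine cst x y p k c P a b" using A.affine_or_infinity[OF P] .
    then interpret P: as_affine cst x y p k c P a b .
    \<comment> \<open>Shifting away from (a, b) makes x - a' and y - b' units at P and keeps their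
      poles at infinity. So t is regular at P with order 1 at infinity, while f is a unit at P with
      order d p >= d at infinity.\<close>
    have "\<exists>a'. a' \<noteq> a" "\<exists>b'. b' \<noteq> b" by (metis one_neq_zero)+
    then obtain a' b' where ab: "a' \<noteq> a" "b' \<noteq> b" by blast
    have ua: "x - cst a' \<in> P - P.M"
      using P.unit_add[OF P.const_unit[of "cst (a - a')"] P.x_M] ab by (simp add: A.cst.hom_minus)
    have ub: "y - cst b' \<in> P - P.M"
      using P.unit_add[OF P.const_unit[of "cst (b - b')"] P.y_M] ab by (simp add: A.cst.hom_minus)
    define t where "t = x ^ (p ^ (k - 1)) * inverse (y - cst b')"
    define f where "f = inverse (x - cst a') ^ d"
    have t1: "t \<in> P" unfolding t_def using P.unit_inverse[OF ub] by simp
    have t2: "t \<noteq> 0" unfolding t_def using A.y_neq_const by simp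
    have f1: "f \<in> P - P.M" unfolding f_def by (rule P.unit_power[OF P.unit_inverse[OF ua]])
    have ordy: "ord_at A.infinity (inverse (y - cst b')) = int (p ^ k + 1)"
      using A.inf.ord_inverse[of "y - cst b'"] A.ord_infinity_y_const[of b'] A.y_neq_const[of b'] by simp
    have ordx: "ord_at A.infinity (x ^ (p ^ (k - 1))) = - int (p ^ k)"
      using A.inf.ord_power[of x "p ^ (k - 1)"] A.ord_infinity_x A.inf.p_pow_k by (simp add: mult.commute)
    have t3: "ord_at A.infinity t = 1"
      unfolding t_def using A.inf.ord_mult[of "x ^ (p ^ (k - 1))" "inverse (y - cst b')"] ordx ordy A.y_neq_const[of b']
      by simp
    have "ord_at A.infinity (x - cst a') = - int p"
      using A.inf.ord_E[of "[:- a', 1:]"] by (simp add: A.E_pCons A.cst.hom_uminus)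
    then have "ord_at A.infinity f = int d * int p"
      unfolding f_def using A.inf.ord_power[of "inverse (x - cst a')" d] A.inf.ord_inverse[of "x - cst a'"] by simp
    moreover have "int d * 1 \<le> int d * int p" using A.p_gt_1 by (intro mult_left_mono) auto
    ultimately have f3: "ord_at A.infinity f \<ge> int d" by simp
    have "ramification_index (range cst) A.F \<phi> A.infinity < d"
      by (rule S.degree_gt_ramification[OF A.infinity_point P(1) _ t1 t2 t3 _ _ _ dim])
        (use * inf f1 f3 ram_d in auto)
    then show False using ram_d by simp
  qed
  have regular: "sg x \<in> P" "sg y' \<in> P" if P: "P \<in> A.points" "P \<noteq> A.infinity" for P
  proof -
    have Q: "\<phi> P \<in> B.points" by (rule S.\<phi>_points[OF P(1)])
    have "x \<in> \<phi> P" using B.infinity_eqI[OF Q] fibre[OF P] by blast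
    moreover from this have "y' \<in> \<phi> P" by (rule B.y_in_if_x_in[OF Q])
    ultimately show "sg x \<in> P" "sg y' \<in> P" using S.sg_mem_iff[OF P(1)] by auto
  qed
  obtain g where g: "sg x = A.ev g" "degree g < p"
    using A.regular_affine_reduced[of "sg x"] regular S.sg_F[of x] by auto
  obtain f where f: "sg y' = A.ev f" "degree f < p"
    using A.regular_affine_reduced[of "sg y'"] regular S.sg_F[of y'] by auto
  have nz: "sg x \<noteq> 0" "sg y' \<noteq> 0" using S.sg_eq_0_iff by auto
  then have gf: "g \<noteq> 0" "f \<noteq> 0" using g f by auto
  have "sg (y' ^ p + cst c * y') = sg (x ^ (p ^ l + 1))" by (simp only: B.equation)
  then have eq: "A.ev f ^ p + cst c * A.ev f = A.ev g ^ (p ^ l + 1)"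
    by (simp add: S.sg_add S.sg_mult S.sg_power S.sg_const g f del: power_Suc)
  have "- int (A.wt g) = int d * - int p"
    using A.inf.ord_ev[OF gf(1) g(2)] S.ord_sg(1)[OF A.infinity_point B.x_F] B.ord_infinity_x
    by (simp add: g(1)[symmetric] inf ram_d)
  then have "int (A.wt g) = int (p * d)" by (simp add: mult.commute)
  then have wg: "A.wt g = p * d" by (simp only: of_nat_eq_iff)
  have "- int (A.wt f) = int d * - int (p ^ l + 1)"
    using A.inf.ord_ev[OF gf(2) f(2)] S.ord_sg(1)[OF A.infinity_point B.y_F B.y_nz] B.ord_infinity_y
    by (simp add: f(1)[symmetric] inf ram_d del: of_nat_add of_nat_Suc of_nat_power)
  then have "int (A.wt f) = int (d * (p ^ l + 1))" by (simp only: of_nat_mult mult_minus_right neg_equal_iff_equal)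
  then have wf: "A.wt f = d * (p ^ l + 1)" by (simp only: of_nat_eq_iff)
  show ?thesis
    unfolding d_def[symmetric]
    by (rule A.weight_identity[OF f(2) gf(2) g(2) gf(1) eq wg wf _ l]) (use cop in \<open>simp add: d_def\<close>)
qed

end

section \<open>The ambient field\<close>

definition poly_fract :: "'k::field poly \<Rightarrow> 'k poly fract" where "poly_fract h = Fract h 1"

lemma poly_fract_simps [simp]:
  "poly_fract 0 = 0" "poly_fract 1 = 1" "poly_fract (g + h) = poly_fract g + poly_fract h"
  "poly_fract (g * h) = poly_fract g * poly_fract h" "poly_fract h = 0 \<longleftrightarrow> h = 0"
  by (simp_all add: poly_fract_def Zero_fract_def One_fract_def eq_fract)

lemma comm_ring_hom_const_fun: "comm_ring_hom (const_fun :: 'k::field \<Rightarrow> 'k ambient)"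
proof
  show "const_fun (a * b) = const_fun a * const_fun b" for a b :: 'k
    by (simp add: const_fun_def mult.commute flip: poly_fract_def to_ac_mult poly_fract_simps(4))
qed (simp_all add: const_fun_def flip: poly_fract_def to_ac_add poly_fract_simps one_pCons)

lemma eval_x_fun: "poly (map_poly const_fun h) x_fun = to_ac (poly_fract h)"
proof (induction h)
  case (pCons a h)
  have "pCons a h = [:a:] + [:0, 1:] * h" by simp
  then have "poly_fract (pCons a h) = poly_fract [:a:] + poly_fract [:0, 1:] * poly_fract h"
    by (metis poly_fract_simps(3,4))
  then show ?case
    using pCons comm_ring_hom_const_fun
    by (simp add: const_fun_def x_fun_def poly_fract_def[symmetric] Polynomial.map_poly_pCons)
qed simp

lemma clear_denominators:
  fixes q :: "'k::field poly fract poly"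
  shows "\<exists>d r. d \<noteq> 0 \<and> smult (poly_fract d) q = map_poly poly_fract r"
proof (induction q)
  case 0
  show ?case by (intro exI[of _ 1] exI[of _ 0]) simp
next
  case (pCons z q)
  then obtain d r where dr: "d \<noteq> 0" "smult (poly_fract d) q = map_poly poly_fract r" by blast
  obtain a b where z: "z = Fract a b" "b \<noteq> 0" by (cases z)
  have "poly_fract (d * b) * z = poly_fract (d * a)"
    using z by (simp add: poly_fract_def eq_fract)
  moreover have "smult (poly_fract (d * b)) q = smult (poly_fract b) (map_poly poly_fract r)"
    by (simp add: mult.commute flip: dr(2))
  moreover have "\<dots> = map_poly poly_fract (smult b r)"
    by (rule poly_eqI) (simp add: coeff_map_poly)
  ultimately have "smult (poly_fract (d * b)) (pCons z q) = map_poly poly_fract (pCons (d * a) (smult b r))"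
    by (simp add: Polynomial.map_poly_pCons)
  then show ?case using dr(1) z(2) by (intro exI[of _ "d * b"] exI[of _ "pCons (d * a) (smult b r)"]) simp
qed

lemma algebraic_over_x_fun:
  fixes f :: "'k::field ambient"
  shows "\<exists>r. r \<noteq> 0 \<and> poly (map_poly (\<lambda>h. poly (map_poly const_fun h) x_fun) r) f = 0"
proof -
  obtain q :: "'k poly fract poly" where q: "q \<noteq> 0" "poly (map_poly to_ac q) f = 0"
    by (rule alg_closure_algebraic)
  obtain d r where dr: "d \<noteq> 0" "smult (poly_fract d) q = map_poly poly_fract r"
    using clear_denominators by blast
  have "map_poly (\<lambda>h. poly (map_poly const_fun h) x_fun) r = map_poly to_ac (map_poly poly_fract r)"
    by (rule poly_eqI) (simp add: coeff_map_poly eval_x_fun)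
  also have "\<dots> = smult (to_ac (poly_fract d)) (map_poly to_ac q)"
    unfolding dr(2)[symmetric] by (rule poly_eqI) (simp add: coeff_map_poly)
  finally have "poly (map_poly (\<lambda>h. poly (map_poly const_fun h) x_fun) r) f = 0" using q(2) by simp
  moreover have "r \<noteq> 0" using dr q(1) by auto
  ultimately show ?thesis by blast
qed

lemma artin_schreier_y_fun:
  fixes c :: "'k::alg_closed_field"
  assumes "prime p" "CHAR('k) = p" "k > 0" "c \<noteq> 0"
  shows "artin_schreier const_fun x_fun (y_fun p c k) p k c"
proof (rule artin_schreier.intro)
  show "h = 0" if "poly (map_poly const_fun h) x_fun = 0" for h :: "'k poly"
    using that by (simp add: eval_x_fun)
  show "y_fun p c k ^ p + const_fun c * y_fun p c k = x_fun ^ (p ^ k + 1)"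
    by (rule y_fun_equation) (use assms prime_gt_1_nat in auto)
qed (use assms comm_ring_hom_const_fun algebraic_over_x_fun in auto)

theorem theorem1p1:
  fixes p l k :: nat and c :: "'p::prime_card mod_ring alg_closure"
  assumes "p = CARD('p)" and "odd p" and "1 < l" and "l < k" and "c \<noteq> 0"
  shows
    "(p ^ l + 1 dvd p ^ k + 1 \<longrightarrow>
       (\<exists>\<rho>. B_morphism p c k l \<rho> \<and> nonconstant constants (B_field p c k) \<rho> \<and>
            \<rho> (B_infinity p c k) = B_infinity p c l \<and>
            totally_ramified_at constants (B_field p c k) (B_field p c l) \<rho> (B_infinity p c k) \<and>
            B_degree p c k l \<rho> = (p ^ k + 1) div (p ^ l + 1))) \<and>
     (\<forall>\<phi>. B_morphism p c k l \<phi> \<longrightarrow> nonconstant constants (B_field p c k) \<phi> \<longrightarrow>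
            \<phi> (B_infinity p c k) = B_infinity p c l \<longrightarrow>
            totally_ramified_at constants (B_field p c k) (B_field p c l) \<phi> (B_infinity p c k) \<longrightarrow>
            coprime (B_degree p c k l \<phi>) p \<longrightarrow>
            p ^ l + 1 dvd p ^ k + 1 \<and>
            B_degree p c k l \<phi> = (p ^ k + 1) div (p ^ l + 1))"
proof -
  have prime: "prime p" using assms(1) prime_card by simp
  have CHAR: "CHAR('p mod_ring alg_closure) = p" using assms(1) by simp
  interpret A: artin_schreier const_fun x_fun "y_fun p c k" p k c
    by (rule artin_schreier_y_fun[OF prime CHAR]) (use assms in auto)
  interpret B: artin_schreier const_fun x_fun "y_fun p c l" p l c
    by (rule artin_schreier_y_fun[OF prime CHAR]) (use assms in auto)
  interpret AB: two_curves const_fun x_fun "y_fun p c k" "y_fun p c l" p k l c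
    by unfold_locales
  have eqs: "constants = range (const_fun :: _ \<Rightarrow> 'p mod_ring alg_closure ambient)"
    "B_field p c k = A.F" "B_field p c l = B.F"
    "B_infinity p c k = A.infinity" "B_infinity p c l = B.infinity"
    by (simp_all add: constants_def B_field_def A.F_def B.F_def B_infinity_def A.infinity_def B.infinity_def)
  show ?thesis
    unfolding eqs
  proof (intro conjI impI allI)
    assume "p ^ l + 1 dvd p ^ k + 1"
    then obtain m where m: "p ^ k + 1 = m * (p ^ l + 1)" by (auto simp: dvd_def mult.commute)
    interpret power_morphism const_fun x_fun "y_fun p c k" "y_fun p c l" p k l c m
      by unfold_locales (rule m)
    have "(p ^ k + 1) div (p ^ l + 1) = m"
      unfolding m by (rule nonzero_mult_div_cancel_right) simp
    then show "\<exists>\<rho>. curve_morphism (range const_fun) A.F B.F \<rho> \<and> nonconstant (range const_fun) A.F \<rho> \<and>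
        \<rho> A.infinity = B.infinity \<and> totally_ramified_at (range const_fun) A.F B.F \<rho> A.infinity \<and>
        morphism_degree (range const_fun) A.F B.F \<rho> = (p ^ k + 1) div (p ^ l + 1)"
      using morphism_exists by simp
  next
    fix \<phi>
    assume \<phi>: "curve_morphism (range const_fun) A.F B.F \<phi>" "nonconstant (range const_fun) A.F \<phi>"
      "\<phi> A.infinity = B.infinity" "totally_ramified_at (range const_fun) A.F B.F \<phi> A.infinity"
      "coprime (morphism_degree (range const_fun) A.F B.F \<phi>) p"
    have d: "morphism_degree (range const_fun) A.F B.F \<phi> * (p ^ l + 1) = p ^ k + 1"
      by (rule AB.totally_ramified_degree[OF \<phi> assms(3,4)])
    show "p ^ l + 1 dvd p ^ k + 1"
      unfolding d[symmetric] by (rule dvd_triv_right)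
    show "morphism_degree (range const_fun) A.F B.F \<phi> = (p ^ k + 1) div (p ^ l + 1)"
      unfolding d[symmetric] by (rule nonzero_mult_div_cancel_right[symmetric]) simp
  qed
qed

end
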